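(* For every positive integer $n$ and every $p\in[1,\infty]$, the reduced group $\ell^p$-operator algebra $B^p_r(F_n)$ of the free group $F_n$ on $n$ generators has no nontrivial idempotents.
   Context: An idempotent in a unital Banach algebra $A$ is an element $a\in A$ with $a^2=a$; it is nontrivial if it is neither $0$ nor the unit element $I$. For a discrete group $\Gamma$, $\mathbb{C}\Gamma$ is the group algebra of finitely supported functions $f=\sum_{\alpha\in\Gamma}f_\alpha\alpha$ on $\Gamma$ with the convolution product. For $p\in[1,\infty]$, the left regular representation $\lambda:\Gamma\to\mathcal{B}(\ell^p(\Gamma))$ is $(\lambda(\gamma)\xi)(\alpha)=\xi(\gamma^{-1}\alpha)$, and for $f\in\mathbb{C}\Gamma$ one sets $\|f\|_{\mathcal{B}(\ell^p(\Gamma))}:=\|\sum_{\alpha}f_\alpha\lambda(\alpha)\|$ (operator norm on $\ell^p(\Gamma)$). The reduced group $\ell^p$-operator algebra $B^p_r(\Gamma)$ (the subscript $r$ stands for "reduced") is the closure of $\mathbb{C}\Gamma$ (acting through $\lambda$) in this norm. *)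

theory Defs
  imports "HOL-Analysis.Analysis" "HOL-Algebra.Ring"
begin

section \<open>Free groups as groups of reduced words\<close>

text \<open>The letter \<open>(x, True)\<close> stands for the generator \<open>x\<close> and \<open>(x, False)\<close> for its inverse.\<close>

definition inv_letter :: "'a \<times> bool \<Rightarrow> 'a \<times> bool" where
  "inv_letter l = (fst l, \<not> snd l)"

definition reduced_word :: "('a \<times> bool) list \<Rightarrow> bool" where
  "reduced_word w \<longleftrightarrow> successively (\<lambda>k l. l \<noteq> inv_letter k) w"

definition cancel_cons :: "'a \<times> bool \<Rightarrow> ('a \<times> bool) list \<Rightarrow> ('a \<times> bool) list" where
  "cancel_cons l w = (if w \<noteq> [] \<and> hd w = inv_letter l then tl w else l # w)"

text \<open>The product is concatenation followed by free reduction.\<close>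

definition free_group :: "'a set \<Rightarrow> ('a \<times> bool) list monoid" where
  "free_group S =
     \<lparr>carrier = {w. reduced_word w \<and> set w \<subseteq> S \<times> UNIV},
      monoid.mult = (\<lambda>v w. foldr cancel_cons v w),
      one = []\<rparr>"

lemma inv_letter_invol [simp]: "inv_letter (inv_letter l) = l"
  by (simp add: inv_letter_def)

lemma inv_letter_neq [simp]: "inv_letter l \<noteq> l" "l \<noteq> inv_letter l"
  by (simp_all add: inv_letter_def prod_eq_iff)

lemma reduced_word_Cons:
  "reduced_word (l # w) \<longleftrightarrow> reduced_word w \<and> (w = [] \<or> hd w \<noteq> inv_letter l)"
  by (cases w) (auto simp: reduced_word_def)

lemma reduced_word_cancel_cons: "reduced_word w \<Longrightarrow> reduced_word (cancel_cons l w)"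
  by (cases w) (auto simp: cancel_cons_def reduced_word_Cons)

lemma cancel_cons_inverse:
  "reduced_word w \<Longrightarrow> cancel_cons l (cancel_cons (inv_letter l) w) = w"
  by (cases w) (auto simp: cancel_cons_def reduced_word_Cons)

lemma reduced_word_foldr: "reduced_word w \<Longrightarrow> reduced_word (foldr cancel_cons v w)"
  by (induction v) (auto simp: reduced_word_cancel_cons)

lemma set_cancel_cons: "set (cancel_cons l w) \<subseteq> insert l (set w)"
  by (cases w) (auto simp: cancel_cons_def)

lemma set_foldr_cancel_cons: "set (foldr cancel_cons v w) \<subseteq> set v \<union> set w"
proof (induction v)
  case (Cons l v)
  then show ?case using set_cancel_cons[of l "foldr cancel_cons v w"] by auto
qed simp

lemma foldr_cancel_cons_Cons:
  assumes "reduced_word z"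
  shows "foldr cancel_cons (cancel_cons l w) z = cancel_cons l (foldr cancel_cons w z)"
proof (cases "w \<noteq> [] \<and> hd w = inv_letter l")
  case True
  then obtain v where "w = inv_letter l # v" by (cases w) auto
  then show ?thesis
    using assms by (simp add: cancel_cons_def[of l "inv_letter l # v"] cancel_cons_inverse reduced_word_foldr)
next
  case False
  then have "cancel_cons l w = l # w" by (auto simp: cancel_cons_def)
  then show ?thesis by simp
qed

lemma foldr_cancel_cons_assoc:
  "reduced_word z \<Longrightarrow>
    foldr cancel_cons (foldr cancel_cons x y) z = foldr cancel_cons x (foldr cancel_cons y z)"
  by (induction x) (simp_all add: foldr_cancel_cons_Cons)

lemma foldr_cancel_cons_Nil: "reduced_word w \<Longrightarrow> foldr cancel_cons w [] = w"
  by (induction w) (auto simp: reduced_word_Cons cancel_cons_def)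

lemma foldr_cancel_cons_inverse:
  "reduced_word z \<Longrightarrow> foldr cancel_cons (map inv_letter (rev w)) (foldr cancel_cons w z) = z"
proof (induction w arbitrary: z)
  case (Cons l w)
  then show ?case
    using cancel_cons_inverse[of "foldr cancel_cons w z" "inv_letter l"]
    by (simp add: reduced_word_foldr)
qed simp

lemma reduced_word_inverse: "reduced_word w \<Longrightarrow> reduced_word (map inv_letter (rev w))"
  unfolding reduced_word_def successively_map successively_rev
  by (erule successively_mono) (metis inv_letter_invol)

lemma group_free_group: "group (free_group S)"
proof (rule groupI)
  fix x assume x: "x \<in> carrier (free_group S)"
  let ?y = "map inv_letter (rev x)"
  have "?y \<in> carrier (free_group S)"
    using x by (auto simp: free_group_def reduced_word_inverse inv_letter_def)
  moreover have "?y \<otimes>\<^bsub>free_group S\<^esub> x = \<one>\<^bsub>free_group S\<^esub>"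
    using x foldr_cancel_cons_inverse[of "[]" x] foldr_cancel_cons_Nil[of x]
    by (simp add: free_group_def reduced_word_def)
  ultimately show "\<exists>y\<in>carrier (free_group S). y \<otimes>\<^bsub>free_group S\<^esub> x = \<one>\<^bsub>free_group S\<^esub>"
    by blast
next
  fix x y assume "x \<in> carrier (free_group S)" "y \<in> carrier (free_group S)"
  then show "x \<otimes>\<^bsub>free_group S\<^esub> y \<in> carrier (free_group S)"
    using set_foldr_cancel_cons[of x y] by (auto simp: free_group_def reduced_word_foldr)
qed (auto simp: free_group_def foldr_cancel_cons_assoc reduced_word_def)


section \<open>The spaces \<open>\<ell>\<^sup>p\<close> and their bounded operators\<close>

text \<open>The exponent is an extended nonnegative real.
  Elements of \<open>\<ell>\<^sup>p(X)\<close> are total functions vanishing outside \<open>X\<close>.\<close>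

definition lp_space :: "ennreal \<Rightarrow> 'a set \<Rightarrow> ('a \<Rightarrow> complex) set" where
  "lp_space p X =
     {\<xi>. (\<forall>x. x \<notin> X \<longrightarrow> \<xi> x = 0) \<and>
         (if p = \<infinity> then bounded (\<xi> ` X)
          else (\<lambda>x. norm (\<xi> x) powr enn2real p) summable_on X)}"

definition lp_norm :: "ennreal \<Rightarrow> 'a set \<Rightarrow> ('a \<Rightarrow> complex) \<Rightarrow> real" where
  "lp_norm p X \<xi> =
     (if p = \<infinity> then SUP x\<in>X. norm (\<xi> x)
      else (\<Sum>\<^sub>\<infinity>x\<in>X. norm (\<xi> x) powr enn2real p) powr (1 / enn2real p))"

text \<open>Operators are extensional, i.e. \<open>undefined\<close> off \<open>\<ell>\<^sup>p(X)\<close>, so that HOL equality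
  coincides with equality of operators.\<close>

definition lp_bounded_ops ::
  "ennreal \<Rightarrow> 'a set \<Rightarrow> (('a \<Rightarrow> complex) \<Rightarrow> ('a \<Rightarrow> complex)) set" where
  "lp_bounded_ops p X =
     {T \<in> lp_space p X \<rightarrow>\<^sub>E lp_space p X.
        (\<forall>\<xi>\<in>lp_space p X. \<forall>\<eta>\<in>lp_space p X.
           T (\<lambda>x. \<xi> x + \<eta> x) = (\<lambda>x. T \<xi> x + T \<eta> x)) \<and>
        (\<forall>c. \<forall>\<xi>\<in>lp_space p X. T (\<lambda>x. c * \<xi> x) = (\<lambda>x. c * T \<xi> x)) \<and>
        (\<exists>C. \<forall>\<xi>\<in>lp_space p X. lp_norm p X (T \<xi>) \<le> C * lp_norm p X \<xi>)}"

definition lp_opnorm ::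
  "ennreal \<Rightarrow> 'a set \<Rightarrow> (('a \<Rightarrow> complex) \<Rightarrow> ('a \<Rightarrow> complex)) \<Rightarrow> real" where
  "lp_opnorm p X T = (SUP \<xi>\<in>{\<xi> \<in> lp_space p X. lp_norm p X \<xi> \<le> 1}. lp_norm p X (T \<xi>))"


section \<open>The reduced group \<open>\<ell>\<^sup>p\<close>-operator algebra\<close>

definition group_algebra :: "('a, 'b) monoid_scheme \<Rightarrow> ('a \<Rightarrow> complex) set" where
  "group_algebra G = {f. finite {\<alpha>. f \<alpha> \<noteq> 0} \<and> {\<alpha>. f \<alpha> \<noteq> 0} \<subseteq> carrier G}"

definition left_regular ::
  "ennreal \<Rightarrow> ('a, 'b) monoid_scheme \<Rightarrow> 'a \<Rightarrow> ('a \<Rightarrow> complex) \<Rightarrow> ('a \<Rightarrow> complex)" where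
  "left_regular p G \<gamma> =
     (\<lambda>\<xi>\<in>lp_space p (carrier G).
        \<lambda>\<alpha>. if \<alpha> \<in> carrier G then \<xi> (inv\<^bsub>G\<^esub> \<gamma> \<otimes>\<^bsub>G\<^esub> \<alpha>) else 0)"

definition left_regular_ext ::
  "ennreal \<Rightarrow> ('a, 'b) monoid_scheme \<Rightarrow> ('a \<Rightarrow> complex) \<Rightarrow> ('a \<Rightarrow> complex) \<Rightarrow> ('a \<Rightarrow> complex)" where
  "left_regular_ext p G f =
     (\<lambda>\<xi>\<in>lp_space p (carrier G).
        \<lambda>x. \<Sum>\<alpha> | f \<alpha> \<noteq> 0. f \<alpha> * left_regular p G \<alpha> \<xi> x)"

text \<open>The carrier is the operator-norm closure of the image of the group algebra in the
  bounded operators on \<open>\<ell>\<^sup>p(G)\<close>.\<close>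

definition reduced_lp_algebra ::
  "ennreal \<Rightarrow> ('a, 'b) monoid_scheme \<Rightarrow> (('a \<Rightarrow> complex) \<Rightarrow> ('a \<Rightarrow> complex)) ring" where
  "reduced_lp_algebra p G =
     \<lparr>carrier = {T \<in> lp_bounded_ops p (carrier G).
        \<forall>\<epsilon>>0. \<exists>f\<in>group_algebra G.
          lp_opnorm p (carrier G) (\<lambda>\<xi>\<in>lp_space p (carrier G).
            \<lambda>x. T \<xi> x - left_regular_ext p G f \<xi> x) < \<epsilon>},
      monoid.mult = compose (lp_space p (carrier G)),
      one = (\<lambda>\<xi>\<in>lp_space p (carrier G). \<xi>),
      zero = (\<lambda>\<xi>\<in>lp_space p (carrier G). \<lambda>x. 0),
      add = (\<lambda>S T. \<lambda>\<xi>\<in>lp_space p (carrier G). \<lambda>x. S \<xi> x + T \<xi> x)\<rparr>"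

definition nontrivial_idempotent :: "('a, 'b) ring_scheme \<Rightarrow> 'a \<Rightarrow> bool" where
  "nontrivial_idempotent R a \<longleftrightarrow>
     a \<in> carrier R \<and> a \<otimes>\<^bsub>R\<^esub> a = a \<and> a \<noteq> \<zero>\<^bsub>R\<^esub> \<and> a \<noteq> \<one>\<^bsub>R\<^esub>"

end

theory Submission
  imports Defs "HOL-Complex_Analysis.Complex_Analysis" "Jordan_Normal_Form.Determinant"
    "HOL-Library.Poly_Mapping"
begin

text \<open>
  Everything is reduced to a statement about \<open>\<ell>\<^sup>2\<close>-functions on the free group \<open>F\<close>, where a
  trace has to be an integer and lies in \<open>[0, 1]\<close>.

  Let \<open>T\<close> be an idempotent of the algebra and choose \<open>f\<close> in the group ring with \<open>\<parallel>T - f\<parallel>\<close> small.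
  Put \<open>u = 2 f - 1\<close> and \<open>a = 1 - u\<^sup>2 = 4 (f - f\<^sup>2)\<close>, so that \<open>\<parallel>a\<parallel> \<le> \<delta>\<close> with \<open>\<delta>\<close> small.  If
  convolution by \<open>y\<close> has norm at most \<open>c\<close> on \<open>\<ell>\<^sup>p\<close>, then \<open>\<parallel>y\<parallel>\<^sub>2 \<le> c\<close>, whatever \<open>p\<close> is
  (lemma \<open>conv_bound_imp_norm_le\<close>).  Hence \<open>\<parallel>u\<^sup>m a\<^sup>j\<parallel>\<^sub>2 \<le> C\<^sup>m \<delta>\<^sup>j\<close>, and the binomial series
  \<open>u (1 - a)\<^bsup>-1/2\<^esup>\<close>, the sign of \<open>u\<close>, converges in \<open>\<ell>\<^sup>2(F)\<close> to a function \<open>S\<close> with convolution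
  square \<open>1\<close>.  Then \<open>e = (1 + S) / 2\<close> is an element of \<open>\<ell>\<^sup>2(F)\<close> with \<open>e * e = e\<close>; it need not act
  boundedly on any \<open>\<ell>\<^sup>p\<close>.

  \<^item> Positivity (\<open>ell2_convolution_idempotent\<close>).  Let \<open>q\<close> be the orthogonal projection of the
    unit onto \<open>{\<eta>. e * \<eta> = \<eta>}\<close>.  Then \<open>q\<close> is self-adjoint, \<open>q * e = e\<close> and \<open>e * q = q\<close>, so that
    \<open>e(1) = q(1) = \<parallel>q\<parallel>\<^sup>2 \<in> [0, 1]\<close>, with \<open>e\<close> equal to \<open>0\<close> or to the unit at the two ends.
  \<^item> Integrality (\<open>trace_integrality\<close>).  \<open>F\<close> acts on the vertices and on the edges of its
    Cayley tree.  Sending a vertex to the first edge on its way to the root is a bijection from the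
    vertices other than the root, and it commutes with each group element up to finitely many
    vertices.  So \<open>u\<close> acts on functions on the vertices in two ways which differ by a matrix with
    finitely many nonzero entries.  Away from the root the diagonal entries of \<open>u\<^sup>k\<close> in both actions
    are the coefficient of \<open>u\<^sup>k\<close> at \<open>1\<close>, so the trace of the difference is this coefficient, up to the
    value put in at the root.  The generating function of these traces is the negative logarithmic derivative of the perturbation determinant \<open>d(t)\<close>, a
    determinant of finite size.  Because \<open>u\<^sup>2\<close> is close to \<open>1\<close>, all entries of the resolvent
    continue analytically from a neighbourhood of \<open>0\<close> to an annulus around \<open>t = 1\<close> which contains
    \<open>0\<close>, so the integral of \<open>d'/d\<close> over the circle \<open>\<bar>t - 1\<bar> = 1\<close> is a multiple of \<open>2 \<pi> \<i>\<close>.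
    Evaluating the integral term by term gives \<open>2 \<pi> \<i> e(1)\<close>.

  Thus \<open>S = \<plusminus>1\<close>.  The partial sums of the series stay within \<open>1/4\<close> of \<open>u\<close> in the norm of
  operators on \<open>\<ell>\<^sup>p\<close>, and such a bound survives coefficientwise limits (\<open>conv_bound_LIMSEQ\<close>); so \<open>f\<close> is
  near \<open>0\<close> or near \<open>1\<close>, hence so is \<open>T\<close>.  An idempotent of norm less than \<open>1\<close> vanishes, and
  applying this to \<open>T\<close> or to \<open>1 - T\<close> gives the theorem.
\<close>

section \<open>The free group acting on the edges of its Cayley tree\<close>

typedef 'a free = "{w :: ('a \<times> bool) list. reduced_word w}"
  morphisms word Abs_free
  by (rule exI[of _ "[]"]) (simp add: reduced_word_def)

setup_lifting type_definition_free

lemma reduced_word_word [simp]: "reduced_word (word x)"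
  using word[of x] by simp

instantiation free :: (type) group_add
begin

lift_definition zero_free :: "'a free" is "[]" by (simp add: reduced_word_def)
lift_definition plus_free :: "'a free \<Rightarrow> 'a free \<Rightarrow> 'a free" is "foldr cancel_cons"
  by (rule reduced_word_foldr)
lift_definition uminus_free :: "'a free \<Rightarrow> 'a free" is "\<lambda>w. map inv_letter (rev w)"
  by (rule reduced_word_inverse)
definition minus_free :: "'a free \<Rightarrow> 'a free \<Rightarrow> 'a free" where "minus_free x y = x + - y"

instance
proof
  fix x y z :: "'a free"
  show "x + y + z = x + (y + z)" by transfer (rule foldr_cancel_cons_assoc)
  show "0 + x = x" by transfer simp
  show "x + 0 = x" by transfer (rule foldr_cancel_cons_Nil)
  show "- x + x = 0"
  proof transfer
    fix x :: "('a \<times> bool) list" assume "reduced_word x"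
    then show "foldr cancel_cons (map inv_letter (rev x)) x = []"
      using foldr_cancel_cons_inverse[of "[]" x] foldr_cancel_cons_Nil[of x]
      by (simp add: reduced_word_def)
  qed
  show "x + - y = x - y" by (simp add: minus_free_def)
qed

end

text \<open>Edges are oriented from an element to its product with a generator.  If the last letter of \<open>w\<close> is
  positive, the last edge on the way from the root to \<open>w\<close> starts at the parent of \<open>w\<close>, otherwise at \<open>w\<close>
  itself.  Thus a nonempty \<open>w\<close> corresponds to the edge from \<open>edge_origin w\<close> to
  its product with the generator \<open>fst (last w)\<close>; \<open>edge_end\<close> recovers \<open>w\<close> as the end of this edge that is
  further from the root.\<close>

definition edge_origin :: "('a \<times> bool) list \<Rightarrow> ('a \<times> bool) list" where
  "edge_origin w = (if snd (last w) then butlast w else w)"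

definition edge_end :: "('a \<times> bool) list \<Rightarrow> 'a \<Rightarrow> ('a \<times> bool) list" where
  "edge_end h s = (if h \<noteq> [] \<and> last h = (s, False) then h else h @ [(s, True)])"

lemma reduced_word_snoc:
  "reduced_word (w @ [l]) \<longleftrightarrow> reduced_word w \<and> (w = [] \<or> l \<noteq> inv_letter (last w))"
  by (auto simp: reduced_word_def successively_append_iff)

lemma reduced_edge_origin: "reduced_word w \<Longrightarrow> reduced_word (edge_origin w)"
  by (cases w rule: rev_cases) (auto simp: edge_origin_def reduced_word_snoc)

lemma reduced_edge_end: "reduced_word h \<Longrightarrow> reduced_word (edge_end h s)"
  by (auto simp: edge_end_def reduced_word_snoc inv_letter_def prod_eq_iff)

lemma edge_end_nonempty: "edge_end h s \<noteq> []"
  by (auto simp: edge_end_def)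

lemma fst_last_edge_end: "fst (last (edge_end h s)) = s"
  by (auto simp: edge_end_def)

lemma edge_origin_edge_end: "edge_origin (edge_end h s) = h"
  by (auto simp: edge_end_def edge_origin_def)

lemma edge_end_edge_origin:
  assumes "reduced_word w" "w \<noteq> []"
  shows "edge_end (edge_origin w) (fst (last w)) = w"
proof (cases w rule: rev_cases)
  case (snoc v l)
  then show ?thesis using assms
    by (cases l; cases "snd l") (auto simp: edge_end_def edge_origin_def reduced_word_snoc inv_letter_def)
qed (use assms in simp)

text \<open>Left multiplication of edges, transported to the vertices other than the root.\<close>

lift_definition edge_act :: "'a free \<Rightarrow> 'a free \<Rightarrow> 'a free" is
  "\<lambda>x w. if w = [] then [] else edge_end (foldr cancel_cons x (edge_origin w)) (fst (last w))"
  by (auto simp: reduced_edge_end reduced_edge_origin reduced_word_foldr)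

lemma edge_act_0_right [simp]: "edge_act x 0 = 0"
  by transfer simp

lemma edge_act_0_left [simp]: "edge_act 0 w = w"
  by transfer (simp add: edge_end_edge_origin)

lemma edge_act_add: "edge_act (x + y) w = edge_act x (edge_act y w)"
  by transfer
    (simp add: edge_end_nonempty edge_origin_edge_end fst_last_edge_end foldr_cancel_cons_assoc reduced_edge_origin)

lemma edge_act_fixed:
  assumes "edge_act x w = w" "w \<noteq> 0"
  shows "x = 0"
proof -
  define o' where "o' = Abs_free (edge_origin (word w))"
  have o': "word o' = edge_origin (word w)"
    by (simp add: o'_def Abs_free_inverse reduced_edge_origin)
  have "edge_end (foldr cancel_cons (word x) (edge_origin (word w))) (fst (last (word w))) = word w"
    using assms by (metis edge_act.rep_eq word_inject zero_free.rep_eq)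
  then have "foldr cancel_cons (word x) (edge_origin (word w)) = edge_origin (word w)"
    by (metis edge_origin_edge_end)
  then have "x + o' = o'" by (simp add: word_inject[symmetric] plus_free.rep_eq o')
  then show ?thesis by (metis add.left_neutral add_right_imp_eq)
qed

text \<open>Left multiplication by a letter is compatible with taking the first edge towards the root, except at
  the root and at the vertex that is moved to the root.\<close>

lemma edge_act_letter:
  assumes w: "reduced_word w" "w \<noteq> []" "w \<noteq> [inv_letter l]"
  shows "edge_end (cancel_cons l (edge_origin w)) (fst (last w)) = cancel_cons l w"
proof -
  obtain v k where vk: "w = v @ [k]" using w(2) by (cases w rule: rev_cases) auto
  have red: "reduced_word (cancel_cons l w)" using w by (simp add: reduced_word_cancel_cons)
  have ne: "cancel_cons l w \<noteq> []" and last: "last (cancel_cons l w) = last w"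
    using w(2,3) by (cases w; auto simp: cancel_cons_def)+
  have "edge_origin (cancel_cons l w) = cancel_cons l (edge_origin w)"
  proof (cases "snd k")
    case True
    have "butlast (cancel_cons l w) = cancel_cons l (butlast w)"
      using w(3) vk by (cases v) (auto simp: cancel_cons_def)
    then show ?thesis using True last vk by (simp add: edge_origin_def)
  next
    case False
    then show ?thesis using last vk by (simp add: edge_origin_def)
  qed
  then show ?thesis using edge_end_edge_origin[OF red ne] last by simp
qed

lemma finite_edge_act_neq:
  fixes x :: "'a free"
  shows "finite {w. x + w \<noteq> edge_act x w}"
proof -
  have "finite {w. foldr cancel_cons v (word w) \<noteq> word (edge_act (Abs_free v) w)}" if "reduced_word v" for v :: "('a \<times> bool) list"
    using that
  proof (induction v)
    case Nil
    have "Abs_free [] = (0 :: 'a free)" by (simp add: zero_free.abs_eq)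
    then show ?case by simp
  next
    case (Cons l v)
    let ?x = "Abs_free v" and ?l = "Abs_free [l]"
    have rv: "reduced_word v" using Cons.prems by (simp add: reduced_word_Cons)
    have wx: "word ?x = v" "word ?l = [l]"
      using rv by (simp_all add: Abs_free_inverse reduced_word_def)
    have lv: "Abs_free (l # v) = ?l + ?x"
      using Cons.prems rv by (simp add: word_inject[symmetric] plus_free.rep_eq wx Abs_free_inverse)
        (auto simp: cancel_cons_def reduced_word_Cons)
    have "word (edge_act ?l u) = cancel_cons l (word u)" if "word u \<noteq> []" "word u \<noteq> [inv_letter l]" for u
      using that edge_act_letter[of "word u" l] by (simp add: edge_act.rep_eq wx)
    then have sub: "{w. foldr cancel_cons (l # v) (word w) \<noteq> word (edge_act (Abs_free (l # v)) w)}
      \<subseteq> {w. foldr cancel_cons v (word w) \<noteq> word (edge_act ?x w)} \<union>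
        {w. word (edge_act ?x w) \<in> {[], [inv_letter l]}}"
      unfolding lv edge_act_add by (auto simp: edge_act_add)
    have "w = edge_act (- ?x) (Abs_free (word (edge_act ?x w)))" for w
      by (simp add: word_inverse flip: edge_act_add)
    then have "{w. word (edge_act ?x w) \<in> {[], [inv_letter l]}} \<subseteq> (\<lambda>z. edge_act (- ?x) (Abs_free z)) ` {[], [inv_letter l]}"
      by blast
    then have "finite {w. word (edge_act ?x w) \<in> {[], [inv_letter l]}}"
      by (rule finite_subset) simp
    then show ?case using Cons.IH[OF rv] sub by (meson finite_UnI finite_subset)
  qed
  from this[of "word x"] show ?thesis
    by (simp add: word_inverse plus_free.rep_eq word_inject[symmetric])
qed

section \<open>Logarithmic derivatives of perturbation determinants\<close>

lemma derivation_prod: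
  fixes D :: "'a::comm_ring_1 \<Rightarrow> 'a"
  assumes mult: "\<And>x y. D (x * y) = D x * y + x * D y" and "finite I"
  shows "D (\<Prod>i\<in>I. f i) = (\<Sum>i\<in>I. D (f i) * (\<Prod>k\<in>I - {i}. f k))"
  using \<open>finite I\<close>
proof (induction I rule: finite_induct)
  case empty
  have "D 1 = D 1 + D 1" using mult[of 1 1] by simp
  then show ?case by simp
next
  case (insert j I)
  have "(\<Prod>k\<in>insert j I - {i}. f k) = f j * (\<Prod>k\<in>I - {i}. f k)" if "i \<in> I" for i
  proof -
    have "insert j I - {i} = insert j (I - {i})" using insert that by auto
    then show ?thesis using insert by simp
  qed
  moreover have "insert j I - {j} = I" using insert by auto
  ultimately show ?case
    using insert by (simp add: mult sum_distrib_left mult.commute mult.left_commute)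
qed

text \<open>Jacobi's formula.  It holds for every derivation, because the Leibniz expansion only uses the product
  rule; collecting the terms in which row \<open>i\<close> is differentiated gives a determinant to which Laplace
  expansion along row \<open>i\<close> applies.\<close>

lemma derivation_det:
  fixes D :: "'a::comm_ring_1 \<Rightarrow> 'a"
  assumes add: "\<And>x y. D (x + y) = D x + D y"
    and mult: "\<And>x y. D (x * y) = D x * y + x * D y"
    and A: "A \<in> carrier_mat n n"
  shows "D (Determinant.det A) = (\<Sum>i<n. \<Sum>j<n. D (A $$ (i,j)) * cofactor A i j)"
proof -
  have D0: "D 0 = 0" using add[of 0 0] by simp
  have D1: "D 1 = 0" using mult[of 1 1] by simp
  have Dm: "D (- x) = - D x" for x using add[of x "-x"] D0 by (simp add: eq_neg_iff_add_eq_0 add.commute)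
  have Dsum: "D (sum f P) = (\<Sum>p\<in>P. D (f p))" for P and f :: "(nat \<Rightarrow> nat) \<Rightarrow> 'a"
    by (induction P rule: infinite_finite_induct) (auto simp: D0 add)
  have Dsign: "D (signof p * x) = signof p * D x" for p x
    by (auto simp: sign_def Dm)
  define B where "B i = Matrix.mat n n (\<lambda>(k,j). if k = i then D (A $$ (i,j)) else A $$ (k,j))" for i
  have B: "B i \<in> carrier_mat n n" for i by (simp add: B_def)
  have row: "(\<Sum>p | p permutes {0..<n}. signof p * (D (A $$ (i, p i)) * (\<Prod>k\<in>{0..<n} - {i}. A $$ (k, p k))))
      = (\<Sum>j<n. D (A $$ (i,j)) * cofactor A i j)" if i: "i < n" for i
  proof -
    have "Determinant.det (B i) = (\<Sum>j<n. B i $$ (i,j) * cofactor (B i) i j)"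
      by (rule laplace_expansion_row[OF B i])
    also have "\<dots> = (\<Sum>j<n. D (A $$ (i,j)) * cofactor A i j)"
    proof (rule sum.cong[OF refl])
      fix j assume "j \<in> {..<n}"
      have "mat_delete (B i) i j = mat_delete A i j"
        using A i \<open>j \<in> _\<close> unfolding mat_delete_def B_def
        by (intro eq_matI) auto
      then show "B i $$ (i,j) * cofactor (B i) i j = D (A $$ (i,j)) * cofactor A i j"
        using i \<open>j \<in> _\<close> by (simp add: cofactor_def) (simp add: B_def)
    qed
    finally have 1: "Determinant.det (B i) = (\<Sum>j<n. D (A $$ (i,j)) * cofactor A i j)" .
    have "Determinant.det (B i) = (\<Sum>p | p permutes {0..<n}. signof p * (\<Prod>k = 0..<n. B i $$ (k, p k)))"
      by (rule det_def'[OF B])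
    also have "\<dots> = (\<Sum>p | p permutes {0..<n}. signof p * (D (A $$ (i, p i)) * (\<Prod>k\<in>{0..<n} - {i}. A $$ (k, p k))))"
    proof (rule sum.cong[OF refl])
      fix p assume "p \<in> {p. p permutes {0..<n}}"
      then have p: "p k < n" if "k < n" for k
        using that permutes_in_image[of p "{0..<n}" k] by auto
      have "(\<Prod>k = 0..<n. B i $$ (k, p k)) = B i $$ (i, p i) * (\<Prod>k\<in>{0..<n} - {i}. B i $$ (k, p k))"
        using i by (intro prod.remove) auto
      also have "\<dots> = D (A $$ (i, p i)) * (\<Prod>k\<in>{0..<n} - {i}. A $$ (k, p k))"
        using i p by (auto simp: B_def intro!: arg_cong2[where f = "(*)"] prod.cong)
      finally show "signof p * (\<Prod>k = 0..<n. B i $$ (k, p k)) =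
        signof p * (D (A $$ (i, p i)) * (\<Prod>k\<in>{0..<n} - {i}. A $$ (k, p k)))" by simp
    qed
    finally show ?thesis using 1 by simp
  qed
  have "D (Determinant.det A) = (\<Sum>p | p permutes {0..<n}. signof p * D (\<Prod>k = 0..<n. A $$ (k, p k)))"
    unfolding det_def'[OF A] Dsum Dsign ..
  also have "\<dots> = (\<Sum>p | p permutes {0..<n}. \<Sum>i<n. signof p * (D (A $$ (i, p i)) * (\<Prod>k\<in>{0..<n} - {i}. A $$ (k, p k))))"
    by (simp add: derivation_prod[of D, OF mult] sum_distrib_left atLeast0LessThan)
  also have "\<dots> = (\<Sum>i<n. \<Sum>p | p permutes {0..<n}. signof p * (D (A $$ (i, p i)) * (\<Prod>k\<in>{0..<n} - {i}. A $$ (k, p k))))"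
    by (rule sum.swap)
  also have "\<dots> = (\<Sum>i<n. \<Sum>j<n. D (A $$ (i,j)) * cofactor A i j)"
    by (intro sum.cong[OF refl]) (simp add: row)
  finally show ?thesis .
qed

lemma derivation_det_inverse:
  fixes D :: "'a::comm_ring_1 \<Rightarrow> 'a"
  assumes "\<And>x y. D (x + y) = D x + D y"
    and "\<And>x y. D (x * y) = D x * y + x * D y"
    and A: "A \<in> carrier_mat n n" and C: "C \<in> carrier_mat n n" and AC: "A * C = 1\<^sub>m n"
  shows "D (Determinant.det A) = Determinant.det A * (\<Sum>i<n. \<Sum>j<n. D (A $$ (i,j)) * C $$ (j,i))"
proof -
  have "adj_mat A = adj_mat A * (A * C)"
    using adj_mat(1)[OF A] by (simp add: AC)
  also have "\<dots> = Determinant.det A \<cdot>\<^sub>m 1\<^sub>m n * C"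
    using adj_mat[OF A] A C by (simp flip: assoc_mult_mat[OF adj_mat(1)[OF A] A C])
  also have "\<dots> = Determinant.det A \<cdot>\<^sub>m C"
    using C mult_smult_assoc_mat[of "1\<^sub>m n" n n C n "Determinant.det A"] by simp
  finally have adj: "adj_mat A = Determinant.det A \<cdot>\<^sub>m C" .
  have "cofactor A i j = Determinant.det A * C $$ (j,i)" if "i < n" "j < n" for i j
  proof -
    have "adj_mat A $$ (j,i) = cofactor A i j"
      using A that by (simp add: adj_mat_def)
    then show ?thesis using C that by (simp add: adj)
  qed
  then show ?thesis
    by (simp add: derivation_det[of D, OF assms(1-3)] sum_distrib_left mult.left_commute)
qed

lemma sum_swap3: "(\<Sum>d\<in>A. \<Sum>e\<in>B. \<Sum>a\<in>C. f d e a) = (\<Sum>a\<in>C. \<Sum>d\<in>A. \<Sum>e\<in>B. f d e a)"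
proof -
  have "(\<Sum>d\<in>A. \<Sum>e\<in>B. \<Sum>a\<in>C. f d e a) = (\<Sum>d\<in>A. \<Sum>a\<in>C. \<Sum>e\<in>B. f d e a)"
    by (intro sum.cong refl sum.swap)
  also have "\<dots> = (\<Sum>a\<in>C. \<Sum>d\<in>A. \<Sum>e\<in>B. f d e a)" by (rule sum.swap)
  finally show ?thesis .
qed

text \<open>With \<open>F\<close>, \<open>U\<close> the blocks of the powers of two operators whose difference is \<open>r\<close>, and
  \<open>G = \<Sum>F\<^sub>k X\<^sup>k\<close>, \<open>H = \<Sum>U\<^sub>k X\<^sup>k\<close>, the first hypothesis is the resolvent identity
  \<open>H = G + X G r H\<close>.  It makes \<open>1 + X r H\<close> an inverse of \<open>A = 1 - X r G\<close>, and Jacobi's formula becomes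
  \<open>(det A)' = det A \<cdot> tr ((1 + X r H) A')\<close>; the trace has the coefficients \<open>- T k\<close>.\<close>

lemma fps_det_perturbation_deriv:
  fixes r :: "nat \<Rightarrow> nat \<Rightarrow> 'a::field" and F U :: "nat \<Rightarrow> nat \<Rightarrow> nat \<Rightarrow> 'a" and T :: "nat \<Rightarrow> 'a"
  assumes U: "\<And>k i j. i < n \<Longrightarrow> j < n \<Longrightarrow>
      U k i j = F k i j + (\<Sum>l<k. \<Sum>b<n. \<Sum>c<n. F l i b * r b c * U (k - 1 - l) c j)"
    and T: "\<And>k. T k = (\<Sum>b<n. \<Sum>c<n. r b c * (of_nat (k+1) * F k c b +
      (\<Sum>a<k. \<Sum>d<n. \<Sum>e<n. U a c d * r d e * (of_nat (k - a) * F (k - 1 - a) e b))))"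
  defines "A \<equiv> Matrix.mat n n (\<lambda>(i,j). (if i = j then 1 else 0)
      - fps_X * (\<Sum>c<n. fps_const (r i c) * Abs_fps (\<lambda>k. F k c j)))"
  shows "fps_deriv (Determinant.det A) = - Determinant.det A * Abs_fps T"
    and "fps_nth (Determinant.det A) 0 = 1"
proof -
  define g where "g i j = Abs_fps (\<lambda>k. F k i j)" for i j
  define h where "h i j = Abs_fps (\<lambda>k. U k i j)" for i j
  define s where "s i j = fps_const (r i j)" for i j
  define dg where "dg i j = fps_deriv (fps_X * g i j)" for i j
  have hg: "h i j = g i j + fps_X * (\<Sum>b<n. \<Sum>c<n. g i b * s b c * h c j)" if "i < n" "j < n" for i j
  proof (rule fps_ext)
    fix k
    show "fps_nth (h i j) k = fps_nth (g i j + fps_X * (\<Sum>b<n. \<Sum>c<n. g i b * s b c * h c j)) k"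
    proof (cases k)
      case 0
      then show ?thesis using U[OF that, of 0] by (simp add: h_def g_def)
    next
      case (Suc m)
      have "fps_nth (g i b * s b c * h c j) m = (\<Sum>l<k. F l i b * r b c * U (k - 1 - l) c j)" for b c
      proof -
        have "fps_nth (g i b * s b c * h c j) m = (\<Sum>l=0..m. F l i b * r b c * U (m - l) c j)"
          unfolding fps_mult_nth[of "g i b * s b c"] by (simp add: g_def h_def s_def)
        also have "\<dots> = (\<Sum>l<k. F l i b * r b c * U (k - 1 - l) c j)"
          by (rule sum.cong) (auto simp: Suc)
        finally show ?thesis .
      qed
      then have "fps_nth (\<Sum>b<n. \<Sum>c<n. g i b * s b c * h c j) m
         = (\<Sum>b<n. \<Sum>c<n. \<Sum>l<k. F l i b * r b c * U (k - 1 - l) c j)"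
        by (simp add: fps_sum_nth)
      also have "\<dots> = (\<Sum>b<n. \<Sum>l<k. \<Sum>c<n. F l i b * r b c * U (k - 1 - l) c j)"
        by (intro sum.cong refl sum.swap)
      also have "\<dots> = (\<Sum>l<k. \<Sum>b<n. \<Sum>c<n. F l i b * r b c * U (k - 1 - l) c j)"
        by (rule sum.swap)
      finally show ?thesis using U[OF that, of k]
        by (simp add: h_def g_def Suc)
    qed
  qed
  define C where "C = Matrix.mat n n (\<lambda>(i,j). (if i = j then 1 else 0) + fps_X * (\<Sum>e<n. s i e * h e j))"
  have [simp]: "A \<in> carrier_mat n n" "C \<in> carrier_mat n n" by (simp_all add: A_def C_def)
  have AC: "A * C = 1\<^sub>m n"
  proof (rule eq_matI)
    fix i j assume "i < dim_row (1\<^sub>m n :: 'a fps mat)" "j < dim_col (1\<^sub>m n :: 'a fps mat)"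
    then have ij: "i < n" "j < n" by simp_all
    define \<alpha> where "\<alpha> k = (\<Sum>c<n. s i c * g c k)" for k
    define \<beta> where "\<beta> k = (\<Sum>e<n. s k e * h e j)" for k
    have "(\<Sum>k<n. \<alpha> k * \<beta> k) = (\<Sum>c<n. s i c * (\<Sum>k<n. \<Sum>e<n. g c k * s k e * h e j))"
      unfolding \<alpha>_def \<beta>_def sum_distrib_right
      by (subst sum.swap) (simp add: sum_distrib_left mult.assoc)
    then have "fps_X * (\<Sum>k<n. \<alpha> k * \<beta> k) = (\<Sum>c<n. s i c * (h c j - g c j))"
      using ij by (simp add: hg sum_distrib_left[of fps_X] mult.left_commute[of fps_X])
    also have "\<dots> = \<beta> i - \<alpha> j"
      by (simp add: \<alpha>_def \<beta>_def right_diff_distrib sum_subtractf)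
    finally have \<alpha>\<beta>: "fps_X * (\<Sum>k<n. \<alpha> k * \<beta> k) = \<beta> i - \<alpha> j" .
    have "(A * C) $$ (i,j) = (\<Sum>k<n. ((if i = k then 1 else 0) - fps_X * \<alpha> k) * ((if k = j then 1 else 0) + fps_X * \<beta> k))"
      using ij by (simp add: A_def C_def scalar_prod_def atLeast0LessThan \<alpha>_def \<beta>_def s_def g_def)
    also have "\<dots> = (\<Sum>k<n. (if i = k then (if k = j then 1 else 0) + fps_X * \<beta> k else 0)
        - (if k = j then fps_X * \<alpha> k else 0) - fps_X * (fps_X * (\<alpha> k * \<beta> k)))"
      by (intro sum.cong refl) (auto simp: algebra_simps)
    also have "\<dots> = (if i = j then 1 else 0) + fps_X * \<beta> i - fps_X * \<alpha> j - fps_X * (fps_X * (\<Sum>k<n. \<alpha> k * \<beta> k))"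
      using ij by (simp add: sum_subtractf sum_distrib_left)
    also have "\<dots> = (1\<^sub>m n) $$ (i,j)"
      unfolding \<alpha>\<beta> using ij by (simp add: algebra_simps)
    finally show "(A * C) $$ (i,j) = (1\<^sub>m n) $$ (i,j)" .
  qed (simp_all add: A_def C_def)
  have dA: "fps_deriv (A $$ (i,j)) = - (\<Sum>c<n. s i c * dg c j)" if "i < n" "j < n" for i j
  proof -
    have "A $$ (i,j) = (if i = j then 1 else 0) - (\<Sum>c<n. s i c * (fps_X * g c j))"
      using that by (simp add: A_def s_def g_def sum_distrib_left mult.left_commute)
    then show ?thesis
      by (simp add: fps_deriv_sum dg_def s_def fps_deriv_mult_const_left)
  qed
  have C_entry: "C $$ (j,i) = (if i = j then 1 else 0) + fps_X * (\<Sum>e<n. s j e * h e i)"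
    if "i < n" "j < n" for i j
    using that by (simp add: C_def eq_commute)
  have T_eq: "Abs_fps T = (\<Sum>b<n. \<Sum>c<n. s b c * dg c b)
      + fps_X * (\<Sum>b<n. \<Sum>c<n. \<Sum>d<n. \<Sum>e<n. s b c * (h c d * s d e * dg e b))"
  proof (rule fps_ext)
    fix k
    have dg_nth: "fps_nth (dg e b) m = of_nat (m + 1) * F m e b" for e b m
      by (simp add: dg_def g_def algebra_simps)
    have 1: "fps_nth (\<Sum>b<n. \<Sum>c<n. s b c * dg c b) k = (\<Sum>b<n. \<Sum>c<n. r b c * (of_nat (k+1) * F k c b))"
      by (simp add: fps_sum_nth s_def dg_nth del: of_nat_Suc of_nat_add)
    have 2: "fps_nth (fps_X * (s b c * (h c d * s d e * dg e b))) k
        = r b c * (\<Sum>a<k. U a c d * r d e * (of_nat (k - a) * F (k - 1 - a) e b))" for b c d e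
    proof (cases k)
      case (Suc m)
      have "fps_nth (h c d * s d e * dg e b) m = (\<Sum>a=0..m. U a c d * r d e * (of_nat (m - a + 1) * F (m - a) e b))"
        unfolding fps_mult_nth[of "h c d * s d e"] by (simp add: h_def s_def dg_nth del: of_nat_Suc of_nat_add)
      also have "\<dots> = (\<Sum>a<k. U a c d * r d e * (of_nat (k - a) * F (k - 1 - a) e b))"
        by (rule sum.cong) (auto simp: Suc Suc_diff_le)
      finally show ?thesis by (simp add: Suc s_def)
    qed auto
    have "fps_nth (fps_X * (\<Sum>b<n. \<Sum>c<n. \<Sum>d<n. \<Sum>e<n. s b c * (h c d * s d e * dg e b))) k
       = (\<Sum>b<n. \<Sum>c<n. \<Sum>d<n. \<Sum>e<n. r b c * (\<Sum>a<k. U a c d * r d e * (of_nat (k - a) * F (k - 1 - a) e b)))"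
      by (simp only: sum_distrib_left[of fps_X] fps_sum_nth 2)
    also have "\<dots> = (\<Sum>b<n. \<Sum>c<n. r b c * (\<Sum>d<n. \<Sum>e<n. \<Sum>a<k. U a c d * r d e * (of_nat (k - a) * F (k - 1 - a) e b)))"
      by (simp only: sum_distrib_left)
    also have "\<dots> = (\<Sum>b<n. \<Sum>c<n. r b c * (\<Sum>a<k. \<Sum>d<n. \<Sum>e<n. U a c d * r d e * (of_nat (k - a) * F (k - 1 - a) e b)))"
      by (intro sum.cong refl arg_cong2[where f = "(*)"] sum_swap3)
    finally show "fps_nth (Abs_fps T) k = fps_nth ((\<Sum>b<n. \<Sum>c<n. s b c * dg c b)
      + fps_X * (\<Sum>b<n. \<Sum>c<n. \<Sum>d<n. \<Sum>e<n. s b c * (h c d * s d e * dg e b))) k"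
      using 1 by (simp add: T distrib_left sum.distrib)
  qed
  have "(\<Sum>i<n. \<Sum>j<n. fps_deriv (A $$ (i,j)) * C $$ (j,i)) = - Abs_fps T"
  proof -
    have "(\<Sum>i<n. \<Sum>j<n. fps_deriv (A $$ (i,j)) * C $$ (j,i))
       = (\<Sum>i<n. \<Sum>j<n. - (if i = j then (\<Sum>c<n. s i c * dg c j) else 0)
            - fps_X * ((\<Sum>c<n. s i c * dg c j) * (\<Sum>e<n. s j e * h e i)))"
      by (intro sum.cong refl) (auto simp: dA C_entry algebra_simps)
    also have "\<dots> = - (\<Sum>i<n. \<Sum>c<n. s i c * dg c i)
        - fps_X * (\<Sum>i<n. \<Sum>j<n. (\<Sum>c<n. s i c * dg c j) * (\<Sum>e<n. s j e * h e i))"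
      by (simp add: sum_subtractf sum_negf sum_distrib_left)
    also have "(\<Sum>i<n. \<Sum>j<n. (\<Sum>c<n. s i c * dg c j) * (\<Sum>e<n. s j e * h e i))
       = (\<Sum>b<n. \<Sum>c<n. \<Sum>d<n. \<Sum>e<n. s b c * (h c d * s d e * dg e b))"
    proof -
      have "(\<Sum>i<n. \<Sum>j<n. (\<Sum>c<n. s i c * dg c j) * (\<Sum>e<n. s j e * h e i))
        = (\<Sum>i<n. \<Sum>j<n. \<Sum>e<n. \<Sum>c<n. s j e * (h e i * s i c * dg c j))"
        unfolding sum_product
        by (rule sum.cong[OF refl], rule sum.cong[OF refl], rule trans[OF sum.swap]) (simp only: mult_ac)
      also have "\<dots> = (\<Sum>j<n. \<Sum>i<n. \<Sum>e<n. \<Sum>c<n. s j e * (h e i * s i c * dg c j))"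
        by (rule sum.swap)
      also have "\<dots> = (\<Sum>j<n. \<Sum>e<n. \<Sum>i<n. \<Sum>c<n. s j e * (h e i * s i c * dg c j))"
        by (intro sum.cong refl sum.swap)
      finally show ?thesis .
    qed
    finally show ?thesis by (simp add: T_eq)
  qed
  then show "fps_deriv (Determinant.det A) = - Determinant.det A * Abs_fps T"
    by (subst derivation_det_inverse[OF _ _ _ _ AC]) (simp_all add: algebra_simps)
  have A0: "fps_nth (A $$ (i,j)) 0 = (if i = j then 1 else 0)" if "i < n" "j < n" for i j
    using that by (simp add: A_def)
  have "fps_nth (Determinant.det A) 0 = (\<Sum>p | p permutes {0..<n}. signof p * (\<Prod>i = 0..<n. if i = p i then 1 else 0))"
  proof -
    have prod0: "fps_nth (prod f S) 0 = (\<Prod>i\<in>S. fps_nth (f i) 0)" for f :: "nat \<Rightarrow> 'a fps" and S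
      by (induction S rule: infinite_finite_induct) auto
    have sign0: "fps_nth (signof p * x) 0 = signof p * fps_nth x 0" for p and x :: "'a fps"
      by (auto simp: sign_def)
    have "p i < n" if "p permutes {0..<n}" "i < n" for p i
      using that permutes_in_image[of p "{0..<n}" i] by auto
    then show ?thesis
      by (simp add: det_def'[of A n] fps_sum_nth sign0 prod0 A0)
  qed
  also have "\<dots> = Determinant.det (1\<^sub>m n :: 'a mat)"
  proof -
    have "p i < n" if "p permutes {0..<n}" "i < n" for p i
      using that permutes_in_image[of p "{0..<n}" i] by auto
    then have "(\<Prod>i = 0..<n. (1\<^sub>m n :: 'a mat) $$ (i, p i)) = (\<Prod>i = 0..<n. if i = p i then 1 else 0)"
      if "p permutes {0..<n}" for p
      using that by (intro prod.cong) auto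
    then show ?thesis
      by (subst det_def'[of _ n]) (simp_all del: det_one)
  qed
  finally show "fps_nth (Determinant.det A) 0 = 1" by simp
qed

section \<open>Traces of finite-rank perturbations\<close>

definition delta :: "'v \<Rightarrow> 'v \<Rightarrow> complex" where
  "delta v = (\<lambda>w. if w = v then 1 else 0)"

definition linear_op :: "(('v \<Rightarrow> complex) \<Rightarrow> ('v \<Rightarrow> complex)) \<Rightarrow> bool" where
  "linear_op P \<longleftrightarrow> (\<forall>\<xi> \<eta>. P (\<lambda>w. \<xi> w + \<eta> w) = (\<lambda>w. P \<xi> w + P \<eta> w)) \<and>
     (\<forall>c \<xi>. P (\<lambda>w. \<xi> w * c) = (\<lambda>w. P \<xi> w * c))"

lemma linear_op_add: "linear_op P \<Longrightarrow> P (\<lambda>w. \<xi> w + \<eta> w) = (\<lambda>w. P \<xi> w + P \<eta> w)"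
  and linear_op_scale: "linear_op P \<Longrightarrow> P (\<lambda>w. \<xi> w * c) = (\<lambda>w. P \<xi> w * c)"
  by (simp_all add: linear_op_def)

lemma linear_op_sum:
  assumes "linear_op P"
  shows "P (\<lambda>w. \<Sum>i\<in>I. f i w) = (\<lambda>w. \<Sum>i\<in>I. P (f i) w)"
proof -
  have "P (\<lambda>w. 0) = (\<lambda>w. 0)" using linear_op_scale[OF assms, of "\<lambda>_. 0" 0] by simp
  then show ?thesis
    by (induction I rule: infinite_finite_induct) (simp_all add: linear_op_add[OF assms])
qed

lemma linear_op_funpow: "linear_op P \<Longrightarrow> linear_op (P ^^ k)"
  by (induction k) (auto simp: linear_op_def)

lemma finite_support_expand:
  assumes "finite W" "\<And>w. w \<notin> W \<Longrightarrow> \<xi> w = 0"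
  shows "\<xi> = (\<lambda>v. \<Sum>w\<in>W. delta w v * \<xi> w)"
proof
  fix v
  have "(\<Sum>w\<in>W. delta w v * \<xi> w) = (\<Sum>w\<in>W. if w = v then \<xi> w else 0)"
    by (intro sum.cong) (auto simp: delta_def)
  then show "\<xi> v = (\<Sum>w\<in>W. delta w v * \<xi> w)" using assms by auto
qed

text \<open>Duhamel's formula for powers: telescope by replacing the factors \<open>U\<close> by \<open>P\<close> one at a time.\<close>

lemma funpow_perturbation:
  assumes P: "linear_op P"
    and U: "\<And>\<xi> w. U \<xi> w = P \<xi> w + (\<Sum>b\<in>B. \<Sum>c\<in>B. delta b w * r b c * \<xi> c)"
  shows "(U ^^ k) \<xi> w = (P ^^ k) \<xi> w +
    (\<Sum>l<k. \<Sum>b\<in>B. \<Sum>c\<in>B. (P ^^ l) (delta b) w * r b c * (U ^^ (k - 1 - l)) \<xi> c)"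
proof (induction k arbitrary: w)
  case (Suc k)
  have 1: "P ((U ^^ k) \<xi>) = (\<lambda>w. P ((P ^^ k) \<xi>) w +
    (\<Sum>l<k. \<Sum>b\<in>B. \<Sum>c\<in>B. P ((P ^^ l) (delta b)) w * (r b c * (U ^^ (k - 1 - l)) \<xi> c)))"
  proof -
    have "(U ^^ k) \<xi> = (\<lambda>w. (P ^^ k) \<xi> w +
      (\<Sum>l<k. \<Sum>b\<in>B. \<Sum>c\<in>B. (P ^^ l) (delta b) w * (r b c * (U ^^ (k - 1 - l)) \<xi> c)))"
      using Suc.IH by (auto simp: mult.assoc)
    then show ?thesis
      by (simp only: linear_op_add[OF P] linear_op_sum[OF P] linear_op_scale[OF P])
  qed
  have 2: "(\<Sum>b\<in>B. \<Sum>c\<in>B. delta b w * r b c * (U ^^ k) \<xi> c) = (\<Sum>b\<in>B. \<Sum>c\<in>B. (P ^^ 0) (delta b) w * r b c * (U ^^ (Suc k - 1 - 0)) \<xi> c)"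
    by simp
  have "(U ^^ Suc k) \<xi> w = P ((U ^^ k) \<xi>) w + (\<Sum>b\<in>B. \<Sum>c\<in>B. delta b w * r b c * (U ^^ k) \<xi> c)"
    using U by simp
  also have "\<dots> = (P ^^ Suc k) \<xi> w + ((\<Sum>b\<in>B. \<Sum>c\<in>B. (P ^^ 0) (delta b) w * r b c * (U ^^ (Suc k - 1 - 0)) \<xi> c) +
      (\<Sum>l<k. \<Sum>b\<in>B. \<Sum>c\<in>B. (P ^^ Suc l) (delta b) w * r b c * (U ^^ (Suc k - 1 - Suc l)) \<xi> c))"
    unfolding 1 2 by (simp add: mult.assoc)
  finally show ?case by (simp only: sum.lessThan_Suc_shift)
qed simp

text \<open>The trace of \<open>U\<^sup>k\<^sup>+\<^sup>1 - P\<^sup>k\<^sup>+\<^sup>1\<close> is the sum of the traces of \<open>P\<^sup>l R U\<^sup>k\<^sup>-\<^sup>l\<close>, hence by cyclicity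
  of those of \<open>R U\<^sup>k\<^sup>-\<^sup>l P\<^sup>l\<close>.  Expanding \<open>U\<^sup>k\<^sup>-\<^sup>l\<close> once more leaves only entries of powers in the finite
  block \<open>B\<close>; each \<open>P\<^sup>k\<^sup>-\<^sup>1\<^sup>-\<^sup>a\<close> arises for \<open>k - a\<close> values of \<open>l\<close>.\<close>

lemma trace_perturbation:
  assumes P: "linear_op P" and linU: "linear_op U"
    and finP: "\<And>\<xi>. finite {w. \<xi> w \<noteq> 0} \<Longrightarrow> finite {w. P \<xi> w \<noteq> 0}"
    and B: "finite B"
    and U: "\<And>\<xi> w. U \<xi> w = P \<xi> w + (\<Sum>b\<in>B. \<Sum>c\<in>B. delta b w * r b c * \<xi> c)"
    and T: "\<And>k w. (U ^^ k) (delta w) w - (P ^^ k) (delta w) w = (if w = w0 then T k else 0)"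
  shows "T (Suc k) = (\<Sum>b\<in>B. \<Sum>c\<in>B. r b c * (of_nat (k+1) * (P ^^ k) (delta b) c +
      (\<Sum>a<k. \<Sum>d\<in>B. \<Sum>e\<in>B. (U ^^ a) (delta d) c * r d e * (of_nat (k - a) * (P ^^ (k - 1 - a)) (delta b) e))))"
proof -
  have fin: "finite {w. (P ^^ l) (delta b) w \<noteq> 0}" for l b
  proof (induction l)
    case 0
    have "{w. delta b w \<noteq> 0} \<subseteq> {b}" by (auto simp: delta_def)
    then show ?case by (simp add: finite_subset)
  qed (simp add: finP)
  define W where "W = insert w0 (\<Union>b\<in>B. \<Union>l\<le>k. {w. (P ^^ l) (delta b) w \<noteq> 0})"
  have W: "finite W" unfolding W_def using B fin by auto
  define X where "X a b c = (\<Sum>d\<in>B. \<Sum>e\<in>B. (U ^^ a) (delta d) c * r d e * (P ^^ (k - 1 - a)) (delta b) e)" for a b c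
  have UP: "(U ^^ (k - l)) ((P ^^ l) (delta b)) c = (P ^^ k) (delta b) c + (\<Sum>a<k - l. X a b c)"
    if "l \<le> k" for l b c
  proof -
    have P': "P \<xi> w = U \<xi> w + (\<Sum>b\<in>B. \<Sum>c\<in>B. delta b w * (- r b c) * \<xi> c)" for \<xi> w
      using U[of \<xi> w] by (simp add: sum_negf)
    have "(P ^^ (k - l)) ((P ^^ l) (delta b)) c = (U ^^ (k - l)) ((P ^^ l) (delta b)) c +
      (\<Sum>a<k - l. \<Sum>d\<in>B. \<Sum>e\<in>B. (U ^^ a) (delta d) c * (- r d e) * (P ^^ (k - l - 1 - a)) ((P ^^ l) (delta b)) e)"
      by (rule funpow_perturbation[where U = P and r = "\<lambda>b c. - r b c", OF linU P'])
    moreover have "(P ^^ (k - l)) ((P ^^ l) (delta b)) = (P ^^ k) (delta b)"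
      using that by (simp flip: funpow_add comp_apply[of "P ^^ (k - l)"])
    moreover have "(\<Sum>a<k - l. \<Sum>d\<in>B. \<Sum>e\<in>B. (U ^^ a) (delta d) c * (- r d e) * (P ^^ (k - l - 1 - a)) ((P ^^ l) (delta b)) e)
       = - (\<Sum>a<k - l. X a b c)"
    proof -
      have "(P ^^ (k - l - 1 - a)) ((P ^^ l) (delta b)) = (P ^^ (k - 1 - a)) (delta b)" if "a < k - l" for a
      proof -
        have "k - 1 - a = (k - l - 1 - a) + l" using that by simp
        then show ?thesis by (simp only: funpow_add comp_apply)
      qed
      then show ?thesis by (simp add: X_def sum_negf)
    qed
    ultimately show ?thesis by simp
  qed
  have "T (Suc k) = (\<Sum>w\<in>W. (U ^^ Suc k) (delta w) w - (P ^^ Suc k) (delta w) w)"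
    using W by (simp add: T W_def del: funpow.simps)
  also have "\<dots> = (\<Sum>w\<in>W. \<Sum>l<Suc k. \<Sum>b\<in>B. \<Sum>c\<in>B. (P ^^ l) (delta b) w * r b c * (U ^^ (k - l)) (delta w) c)"
    by (subst funpow_perturbation[where r = r, OF P U]) simp
  also have "\<dots> = (\<Sum>l<Suc k. \<Sum>b\<in>B. \<Sum>c\<in>B. \<Sum>w\<in>W. (P ^^ l) (delta b) w * r b c * (U ^^ (k - l)) (delta w) c)"
    by (simp only: sum.swap[where A = W])
  also have "\<dots> = (\<Sum>l<Suc k. \<Sum>b\<in>B. \<Sum>c\<in>B. r b c * (U ^^ (k - l)) ((P ^^ l) (delta b)) c)"
  proof (intro sum.cong refl)
    fix l b c assume l: "l \<in> {..<Suc k}" and b: "b \<in> B"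
    have "(P ^^ l) (delta b) = (\<lambda>v. \<Sum>w\<in>W. delta w v * (P ^^ l) (delta b) w)"
      using W l b by (intro finite_support_expand) (auto simp: W_def)
    then have "(U ^^ (k - l)) ((P ^^ l) (delta b)) = (U ^^ (k - l)) (\<lambda>v. \<Sum>w\<in>W. delta w v * (P ^^ l) (delta b) w)"
      by simp
    also have "\<dots> = (\<lambda>v. \<Sum>w\<in>W. (U ^^ (k - l)) (delta w) v * (P ^^ l) (delta b) w)"
      by (simp only: linear_op_sum[OF linear_op_funpow[OF linU]] linear_op_scale[OF linear_op_funpow[OF linU]])
    finally show "(\<Sum>w\<in>W. (P ^^ l) (delta b) w * r b c * (U ^^ (k - l)) (delta w) c) =
        r b c * (U ^^ (k - l)) ((P ^^ l) (delta b)) c"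
      by (simp add: sum_distrib_left mult_ac)
  qed
  also have "\<dots> = (\<Sum>b\<in>B. \<Sum>c\<in>B. r b c * (\<Sum>l<Suc k. (U ^^ (k - l)) ((P ^^ l) (delta b)) c))"
    by (simp only: sum_distrib_left sum.swap[where A = "{..<Suc k}"])
  also have "\<dots> = (\<Sum>b\<in>B. \<Sum>c\<in>B. r b c * (of_nat (k+1) * (P ^^ k) (delta b) c + (\<Sum>a<k. of_nat (k - a) * X a b c)))"
  proof (intro sum.cong refl arg_cong2[where f = "(*)"])
    fix b c
    have "(\<Sum>l<Suc k. (U ^^ (k - l)) ((P ^^ l) (delta b)) c) = (\<Sum>l<Suc k. (P ^^ k) (delta b) c + (\<Sum>a<k - l. X a b c))"
      by (intro sum.cong refl UP) simp
    also have "\<dots> = of_nat (k+1) * (P ^^ k) (delta b) c + (\<Sum>l<Suc k. \<Sum>a | a < k \<and> l < k - a. X a b c)"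
    proof -
      have "{..<k - l} = {a. a < k \<and> l < k - a}" for l by auto
      then show ?thesis by (simp add: sum.distrib)
    qed
    also have "(\<Sum>l<Suc k. \<Sum>a | a < k \<and> l < k - a. X a b c) = (\<Sum>a<k. \<Sum>l | l < Suc k \<and> l < k - a. X a b c)"
      using sum.swap_restrict[of "{..<Suc k}" "{..<k}" "\<lambda>l a. X a b c" "\<lambda>l a. l < k - a"] by simp
    also have "\<dots> = (\<Sum>a<k. of_nat (k - a) * X a b c)"
    proof (intro sum.cong refl)
      fix a
      have "{l. l < Suc k \<and> l < k - a} = {..<k - a}" by auto
      then show "(\<Sum>l | l < Suc k \<and> l < k - a. X a b c) = of_nat (k - a) * X a b c" by simp
    qed
    finally show "(\<Sum>l<Suc k. (U ^^ (k - l)) ((P ^^ l) (delta b)) c) =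
       of_nat (k+1) * (P ^^ k) (delta b) c + (\<Sum>a<k. of_nat (k - a) * X a b c)" .
  qed
  finally show ?thesis
    by (simp only: X_def sum_distrib_left mult_ac)
qed

section \<open>Resolvents on an annulus around 1\<close>

text \<open>It contains both the origin, where the power series live, and the circle of radius \<open>1\<close> around \<open>1\<close>
  that separates the two roots of \<open>1 - t\<^sup>2\<close>.\<close>

definition annulus :: "complex set" where
  "annulus = {t. 1/2 < cmod (t - 1) \<and> cmod (t - 1) < 3/2}"

lemma annulus_facts:
  shows open_annulus: "open annulus" and connected_annulus_1: "connected annulus" and zero_in_annulus: "0 \<in> annulus"
proof -
  show "open annulus"
    unfolding annulus_def by (intro open_Collect_conj open_Collect_less continuous_intros)
  show "connected annulus"
    using connected_annulus(1)[of "1/2" "1 :: complex" "3/2"] by (simp add: annulus_def)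
  show "0 \<in> annulus" by (simp add: annulus_def)
qed

lemma annulus_bounds:
  assumes "t \<in> annulus"
  shows "cmod t \<le> 5/2" "1/2 \<le> cmod (1 + t)" "1/4 \<le> cmod (1 - t\<^sup>2)" "1 - t\<^sup>2 \<noteq> 0" "1 + t \<noteq> 0"
proof -
  have t: "1/2 < cmod (t - 1)" "cmod (t - 1) < 3/2" using assms by (auto simp: annulus_def)
  show "cmod t \<le> 5/2" using norm_triangle_ineq[of "t - 1" 1] t by simp
  show 1: "1/2 \<le> cmod (1 + t)"
    using norm_triangle_ineq2[of 2 "1 - t"] t by (simp add: norm_minus_commute)
  have "1 - t\<^sup>2 = (1 - t) * (1 + t)" by (simp add: algebra_simps power2_eq_square)
  then have "cmod (1 - t\<^sup>2) = cmod (t - 1) * cmod (1 + t)" by (simp add: norm_mult norm_minus_commute)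
  moreover have "1/2 * (1/2) \<le> cmod (t - 1) * cmod (1 + t)"
    using t 1 by (intro mult_mono) auto
  ultimately show 2: "1/4 \<le> cmod (1 - t\<^sup>2)" by simp
  show "1 - t\<^sup>2 \<noteq> 0" using 2 by auto
  show "1 + t \<noteq> 0" using 1 by auto
qed

lemma common_geometric_bound:
  fixes f g :: "nat \<Rightarrow> real"
  assumes "\<exists>M. \<forall>j. f j \<le> M * \<delta> ^ j" "\<exists>M. \<forall>j. g j \<le> M * \<delta> ^ j" "0 \<le> \<delta>"
  obtains M where "\<And>j. f j \<le> M * \<delta> ^ j" "\<And>j. g j \<le> M * \<delta> ^ j"
proof -
  obtain K L where K: "\<And>j. f j \<le> K * \<delta> ^ j" and L: "\<And>j. g j \<le> L * \<delta> ^ j" using assms(1,2) by blast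
  have "K * \<delta> ^ j \<le> max K L * \<delta> ^ j" "L * \<delta> ^ j \<le> max K L * \<delta> ^ j" for j
    using assms(3) by (auto intro!: mult_right_mono)
  then show thesis using K L that[of "max K L"] order_trans by meson
qed

text \<open>If \<open>P m j = \<psi>(u\<^sup>m a\<^sup>j)\<close> for a linear functional \<open>\<psi>\<close> and \<open>a = 1 - u\<^sup>2\<close>, then \<open>resolvent P t\<close> is
  \<open>\<psi>((1 - t u)\<^bsup>-1\<^esup>)\<close>: expand \<open>(1 + t u) / (1 - t\<^sup>2 u\<^sup>2)\<close> with \<open>1 - t\<^sup>2 u\<^sup>2 = (1 - t\<^sup>2) + t\<^sup>2 a\<close> in powers
  of \<open>a\<close>.  Smallness of \<open>a\<close> gives convergence away from \<open>t = \<plusminus>1\<close>.\<close>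

definition resolvent_term :: "(nat \<Rightarrow> nat \<Rightarrow> complex) \<Rightarrow> nat \<Rightarrow> complex \<Rightarrow> complex" where
  "resolvent_term P j t = (-1) ^ j * t ^ (2 * j) * (P 0 j + t * P 1 j) / (1 - t\<^sup>2) ^ Suc j"

definition resolvent :: "(nat \<Rightarrow> nat \<Rightarrow> complex) \<Rightarrow> complex \<Rightarrow> complex" where
  "resolvent P t = suminf (\<lambda>j. resolvent_term P j t)"

lemma power_quotient_bound:
  assumes t: "t \<in> annulus" and \<delta>: "0 \<le> \<delta>" "\<delta> \<le> 1/50" and M: "0 \<le> M" and x: "cmod x \<le> M * \<delta> ^ j"
  shows "cmod ((-1) ^ j * t ^ (2 * j) * x / (1 - t\<^sup>2) ^ j) \<le> M * (1/2) ^ j"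
proof -
  note b = annulus_bounds[OF t]
  have "(cmod t)\<^sup>2 \<le> (5/2)\<^sup>2" using b(1) by (intro power_mono) auto
  then have "(cmod t)\<^sup>2 \<le> 25/4" by (simp add: power2_eq_square)
  then have "cmod (t\<^sup>2 / (1 - t\<^sup>2)) \<le> (25/4) / (1/4)"
    unfolding norm_divide norm_power using b by (intro frac_le) auto
  then have "cmod (t\<^sup>2 / (1 - t\<^sup>2)) ^ j \<le> 25 ^ j" by (intro power_mono) auto
  then have "cmod (t\<^sup>2 / (1 - t\<^sup>2)) ^ j * cmod x \<le> 25 ^ j * (M * \<delta> ^ j)"
    using x by (intro mult_mono) auto
  also have "\<dots> \<le> M * (1/2) ^ j"
  proof -
    have "(25 * \<delta>) ^ j \<le> (1/2) ^ j" using \<delta> by (intro power_mono) auto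
    then have "M * (25 * \<delta>) ^ j \<le> M * (1/2) ^ j" using M by (rule mult_left_mono)
    then show ?thesis by (simp only: power_mult_distrib mult_ac)
  qed
  finally show ?thesis
    by (simp add: norm_mult norm_divide norm_power power_divide power_mult)
qed

lemma resolvent_term_bound:
  assumes t: "t \<in> annulus" and \<delta>: "0 \<le> \<delta>" "\<delta> \<le> 1/50" and M: "0 \<le> M"
    and P: "cmod (P 0 j) \<le> M * \<delta> ^ j" "cmod (P 1 j) \<le> M * \<delta> ^ j"
  shows "cmod (resolvent_term P j t) \<le> 14 * M * (1/2) ^ j"
proof -
  note b = annulus_bounds[OF t]
  have "cmod (P 0 j + t * P 1 j) \<le> cmod (P 0 j) + cmod t * cmod (P 1 j)"
    using norm_triangle_ineq[of "P 0 j" "t * P 1 j"] by (simp add: norm_mult)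
  also have "\<dots> \<le> M * \<delta> ^ j + 5/2 * (M * \<delta> ^ j)"
    using P b(1) by (intro add_mono mult_mono) auto
  finally have "cmod (P 0 j + t * P 1 j) \<le> (7/2 * M) * \<delta> ^ j" by simp
  then have "cmod ((-1) ^ j * t ^ (2 * j) * (P 0 j + t * P 1 j) / (1 - t\<^sup>2) ^ j) \<le> (7/2 * M) * (1/2) ^ j"
    using M by (intro power_quotient_bound[OF t \<delta>]) auto
  then have "cmod ((-1) ^ j * t ^ (2 * j) * (P 0 j + t * P 1 j) / (1 - t\<^sup>2) ^ j) / cmod (1 - t\<^sup>2)
      \<le> (7/2 * M) * (1/2) ^ j / (1/4)"
    using b(3) M by (intro frac_le) auto
  then show ?thesis
    by (simp add: resolvent_term_def norm_divide norm_mult mult_ac)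
qed

lemma resolvent_uniform_limit:
  assumes \<delta>: "0 \<le> \<delta>" "\<delta> \<le> 1/50"
    and P: "\<And>j. cmod (P 0 j) \<le> M * \<delta> ^ j" "\<And>j. cmod (P 1 j) \<le> M * \<delta> ^ j"
  shows "uniform_limit annulus (\<lambda>n t. \<Sum>j<n. resolvent_term P j t) (resolvent P) sequentially"
proof -
  have M: "0 \<le> M" using P(1)[of 0] by (simp add: order_trans[OF norm_ge_zero])
  show ?thesis
    unfolding resolvent_def
    by (rule Weierstrass_m_test[where M = "\<lambda>j. 14 * M * (1/2) ^ j"])
       (auto intro!: resolvent_term_bound[OF _ \<delta> M] P summable_mult summable_geometric)
qed

lemma resolvent_term_holomorphic: "resolvent_term P j holomorphic_on annulus"
  unfolding resolvent_term_def using annulus_bounds(4) by (intro holomorphic_intros) auto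

lemma resolvent_holomorphic:
  assumes "0 \<le> \<delta>" "\<delta> \<le> 1/50"
    and "\<And>j. cmod (P 0 j) \<le> M * \<delta> ^ j" "\<And>j. cmod (P 1 j) \<le> M * \<delta> ^ j"
  shows "resolvent P holomorphic_on annulus"
proof (rule holomorphic_uniform_sequence[OF open_annulus])
  show "(\<lambda>t. \<Sum>j<n. resolvent_term P j t) holomorphic_on annulus" for n
    by (intro holomorphic_on_sum resolvent_term_holomorphic)
  show "\<exists>d>0. cball t d \<subseteq> annulus \<and>
      uniform_limit (cball t d) (\<lambda>n t. \<Sum>j<n. resolvent_term P j t) (resolvent P) sequentially"
    if t: "t \<in> annulus" for t
  proof -
    obtain d where "d > 0" "cball t d \<subseteq> annulus" using open_contains_cball open_annulus t by blast
    then show ?thesis using uniform_limit_on_subset[OF resolvent_uniform_limit[OF assms]] by blast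
  qed
qed

text \<open>This is \<open>(1 - t u)\<^bsup>-1\<^esup> = 1 + t u (1 - t u)\<^bsup>-1\<^esup>\<close>; in terms of the series, a telescoping sum.\<close>

lemma resolvent_recurrence:
  assumes t: "t \<in> annulus" and \<delta>: "0 \<le> \<delta>" "\<delta> \<le> 1/50"
    and P: "\<And>m. \<exists>M. \<forall>j. cmod (P m j) \<le> M * \<delta> ^ j"
    and rec: "\<And>m j. P (m + 2) j = P m j - P m (Suc j)"
  shows "resolvent P t = P 0 0 + t * resolvent (\<lambda>i. P (Suc i)) t"
proof -
  note b = annulus_bounds[OF t]
  define A where "A j = (-1) ^ j * t ^ (2 * j) * P 0 j / (1 - t\<^sup>2) ^ j" for j
  have summ: "summable (\<lambda>j. resolvent_term (\<lambda>i. P (i + m)) j t)" for m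
  proof -
    obtain M where M: "\<And>j. cmod (P m j) \<le> M * \<delta> ^ j" "\<And>j. cmod (P (Suc m) j) \<le> M * \<delta> ^ j"
      using common_geometric_bound[OF P P \<delta>(1)] by blast
    have "0 \<le> M" using M(1)[of 0] by (simp add: order_trans[OF norm_ge_zero])
    then have "cmod (resolvent_term (\<lambda>i. P (i + m)) j t) \<le> 14 * M * (1/2) ^ j" for j
      using M by (intro resolvent_term_bound[OF t \<delta>]) auto
    moreover have "summable (\<lambda>j. 14 * M * (1/2 :: real) ^ j)"
      by (rule summable_mult) (simp add: summable_geometric)
    ultimately show ?thesis
      by (rule summable_comparison_test'[where N = 0, rotated])
  qed
  have step: "resolvent_term P j t - t * resolvent_term (\<lambda>i. P (Suc i)) j t = A j - A (Suc j)" for j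
  proof -
    have alg: "c * (x + t * y) / D - t * (c * (y + t * z) / D) = c * (x - t\<^sup>2 * z) / D" for c x y z D
      by (simp add: algebra_simps power2_eq_square diff_divide_distrib add_divide_distrib)
    have "resolvent_term P j t - t * resolvent_term (\<lambda>i. P (Suc i)) j t
      = (-1) ^ j * t ^ (2 * j) * (P 0 j - t\<^sup>2 * P 2 j) / (1 - t\<^sup>2) ^ Suc j"
      using alg[of "(-1) ^ j * t ^ (2 * j)" "P 0 j" "P 1 j" "(1 - t\<^sup>2) ^ Suc j" "P 2 j"]
      by (simp only: resolvent_term_def One_nat_def numeral_2_eq_2)
    also have "P 0 j - t\<^sup>2 * P 2 j = (1 - t\<^sup>2) * P 0 j + t\<^sup>2 * P 0 (Suc j)"
    proof -
      have "P 2 j = P 0 j - P 0 (Suc j)" using rec[of 0 j] by (simp add: numeral_2_eq_2)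
      then show ?thesis by (simp only:) (simp add: algebra_simps)
    qed
    also have "(-1) ^ j * t ^ (2 * j) * ((1 - t\<^sup>2) * P 0 j + t\<^sup>2 * P 0 (Suc j)) / (1 - t\<^sup>2) ^ Suc j = A j - A (Suc j)"
    proof -
      have "c * (y * x + t\<^sup>2 * w) / (y * Y) = c * x / Y - (- c) * t\<^sup>2 * w / (y * Y)" if "y \<noteq> 0" "Y \<noteq> 0" for c x y w Y :: complex
        using that by (simp add: field_simps)
      from this[of "1 - t\<^sup>2" "(1 - t\<^sup>2) ^ j" "(-1) ^ j * t ^ (2 * j)" "P 0 j" "P 0 (Suc j)"]
      have "(-1) ^ j * t ^ (2 * j) * ((1 - t\<^sup>2) * P 0 j + t\<^sup>2 * P 0 (Suc j)) / (1 - t\<^sup>2) ^ Suc j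
        = A j - (- ((-1) ^ j * t ^ (2 * j))) * t\<^sup>2 * P 0 (Suc j) / (1 - t\<^sup>2) ^ Suc j"
        using b(4) by (simp add: A_def)
      moreover have "(- ((-1) ^ j * t ^ (2 * j))) * t\<^sup>2 * P 0 (Suc j) / (1 - t\<^sup>2) ^ Suc j = A (Suc j)"
        by (simp add: A_def power2_eq_square mult_ac)
      ultimately show ?thesis by (simp only:)
    qed
    finally show ?thesis .
  qed
  obtain M where M: "\<And>j. cmod (P 0 j) \<le> M * \<delta> ^ j" using P by metis
  have M0: "0 \<le> M" using M[of 0] by (simp add: order_trans[OF norm_ge_zero])
  have "A \<longlonglongrightarrow> 0"
  proof (rule Lim_null_comparison)
    show "\<forall>\<^sub>F j in sequentially. norm (A j) \<le> M * (1/2) ^ j"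
      unfolding A_def by (intro always_eventually allI power_quotient_bound[OF t \<delta> M0] M)
    show "(\<lambda>j. M * (1/2) ^ j) \<longlonglongrightarrow> 0"
      by (intro tendsto_mult_right_zero LIMSEQ_power_zero) simp
  qed
  then have "(\<lambda>j. A j - A (Suc j)) sums (A 0 - 0)" by (rule telescope_sums')
  then have "suminf (\<lambda>j. resolvent_term P j t - t * resolvent_term (\<lambda>i. P (Suc i)) j t) = P 0 0"
    by (simp add: step sums_iff A_def)
  moreover have "suminf (\<lambda>j. resolvent_term P j t - t * resolvent_term (\<lambda>i. P (Suc i)) j t)
      = resolvent P t - t * resolvent (\<lambda>i. P (Suc i)) t"
    unfolding resolvent_def using summ[of 0] summ[of 1]
    by (simp add: suminf_diff[symmetric] suminf_mult summable_mult)
  ultimately show ?thesis by (simp add: algebra_simps)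
qed

text \<open>The recurrence determines the Taylor coefficients at \<open>0\<close> one after the other.\<close>

lemma resolvent_has_fps_expansion:
  assumes \<delta>: "0 \<le> \<delta>" "\<delta> \<le> 1/50"
    and P: "\<And>m. \<exists>M. \<forall>j. cmod (P m j) \<le> M * \<delta> ^ j"
    and rec: "\<And>m j. P (m + 2) j = P m j - P m (Suc j)"
  shows "resolvent P holomorphic_on annulus"
    and "resolvent P has_fps_expansion Abs_fps (\<lambda>k. P k 0)"
proof -
  define R where "R m = resolvent (\<lambda>i. P (i + m))" for m
  have hol: "R m holomorphic_on annulus" for m
  proof -
    obtain M where M: "\<And>j. cmod (P m j) \<le> M * \<delta> ^ j" "\<And>j. cmod (P (Suc m) j) \<le> M * \<delta> ^ j"
      using common_geometric_bound[OF P P \<delta>(1)] by blast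
    show ?thesis unfolding R_def
      by (rule resolvent_holomorphic[OF \<delta>, where M = M]) (use M in auto)
  qed
  from hol[of 0] show "resolvent P holomorphic_on annulus" by (simp add: R_def)
  define F where "F m = fps_expansion (R m) 0" for m
  have F: "R m has_fps_expansion F m" for m
  proof -
    have "R m analytic_on {0}"
      using hol[of m] open_annulus zero_in_annulus by (meson analytic_at)
    then show ?thesis unfolding F_def by (rule analytic_at_imp_has_fps_expansion_0)
  qed
  have F_rec: "F m = fps_const (P m 0) + fps_X * F (Suc m)" for m
  proof -
    have eq: "R m t = P m 0 + t * R (Suc m) t" if "t \<in> annulus" for t
      using resolvent_recurrence[OF that \<delta>, of "\<lambda>i. P (i + m)"] P rec by (simp add: R_def algebra_simps)
    have "(\<lambda>t. P m 0 + t * R (Suc m) t) has_fps_expansion fps_const (P m 0) + fps_X * F (Suc m)"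
      by (intro fps_expansion_intros F)
    moreover have "\<forall>\<^sub>F t in nhds 0. P m 0 + t * R (Suc m) t = R m t"
      using eventually_nhds_in_open[OF open_annulus zero_in_annulus] by eventually_elim (simp add: eq)
    ultimately have "R m has_fps_expansion fps_const (P m 0) + fps_X * F (Suc m)"
      using has_fps_expansion_cong[OF _ refl] by fast
    then show ?thesis using F[of m] fps_expansion_unique_complex by blast
  qed
  have "fps_nth (F m) k = P (m + k) 0" for m k
  proof (induction k arbitrary: m)
    case 0
    show ?case by (subst F_rec) simp
  next
    case (Suc k)
    show ?case by (subst F_rec) (simp add: Suc.IH)
  qed
  then have "F 0 = Abs_fps (\<lambda>k. P k 0)" by (intro fps_ext) simp
  then show "resolvent P has_fps_expansion Abs_fps (\<lambda>k. P k 0)"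
    using F[of 0] by (simp add: R_def)
qed

lemma circle_in_annulus: "path_image (circlepath 1 1) \<subseteq> annulus"
  by (auto simp: path_image_circlepath annulus_def dist_norm norm_minus_commute)

lemma contour_integral_power_0:
  "((\<lambda>t. t ^ i / (1 - t\<^sup>2) ^ Suc 0) has_contour_integral - (of_real pi * \<i>)) (circlepath 1 1)"
proof -
  have "((\<lambda>t. (- (t ^ i) / (1 + t)) / (t - 1)) has_contour_integral (2 * of_real pi * \<i> * (- (1 ^ i) / (1 + 1)))) (circlepath 1 1)"
    by (rule Cauchy_integral_circlepath_simple[where f = "\<lambda>t. - (t ^ i) / (1 + t)"])
      (auto intro!: holomorphic_intros simp: dist_norm add_eq_0_iff)
  moreover have "(- (t ^ i) / (1 + t)) / (t - 1) = t ^ i / (1 - t\<^sup>2) ^ Suc 0" for t :: complex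
  proof -
    have "1 - t\<^sup>2 = - ((1 + t) * (t - 1))" by (simp add: algebra_simps power2_eq_square)
    moreover have "(- x / y) / z = x / - (y * z)" for x y z :: complex by simp
    ultimately show ?thesis by simp
  qed
  ultimately show ?thesis by simp
qed

text \<open>The derivative of \<open>t\<^bsup>i+1\<^esup> / (1 - t\<^sup>2)\<^bsup>j+1\<^esup>\<close> is a combination of the two integrands, and its integral
  around the circle vanishes.\<close>

lemma contour_integral_power_Suc:
  assumes c: "((\<lambda>t. t ^ i / (1 - t\<^sup>2) ^ Suc j) has_contour_integral c) (circlepath 1 1)"
  shows "((\<lambda>t. t ^ (i + 2) / (1 - t\<^sup>2) ^ Suc (Suc j)) has_contour_integral
    - (of_nat (Suc i) / of_nat (2 * Suc j)) * c) (circlepath 1 1)"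
proof -
  define I where "I = (\<lambda>t :: complex. t ^ i / (1 - t\<^sup>2) ^ Suc j)"
  define I' where "I' = (\<lambda>t :: complex. t ^ (i + 2) / (1 - t\<^sup>2) ^ Suc (Suc j))"
  have "((\<lambda>t. of_nat (Suc i) * I t + of_nat (2 * Suc j) * I' t) has_contour_integral
      (pathfinish (circlepath 1 1) ^ Suc i / (1 - (pathfinish (circlepath 1 1))\<^sup>2) ^ Suc j
       - pathstart (circlepath 1 1) ^ Suc i / (1 - (pathstart (circlepath 1 1))\<^sup>2) ^ Suc j)) (circlepath 1 1)"
  proof (rule contour_integral_primitive)
    show "((\<lambda>t. t ^ Suc i / (1 - t\<^sup>2) ^ Suc j) has_field_derivative
       of_nat (Suc i) * I t + of_nat (2 * Suc j) * I' t) (at t within annulus)" if "t \<in> annulus" for t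
    proof -
      have nz: "1 - t\<^sup>2 \<noteq> 0" using annulus_bounds(4)[OF that] .
      have "((\<lambda>t. t ^ Suc i / (1 - t\<^sup>2) ^ Suc j) has_field_derivative
        ((of_nat (Suc i) * t ^ i) * (1 - t\<^sup>2) ^ Suc j - t ^ Suc i * (of_nat (Suc j) * (1 - t\<^sup>2) ^ j * (- (2 * t))))
         / ((1 - t\<^sup>2) ^ Suc j * (1 - t\<^sup>2) ^ Suc j)) (at t within annulus)"
        using nz by (auto intro!: derivative_eq_intros simp del: power_Suc of_nat_Suc)
      moreover have "(N * T * (y * Y) - T' * (K * Y * (- (2 * t)))) / ((y * Y) * (y * Y)) = N * (T / (y * Y)) + (2 * K) * ((T' * t) / (y * (y * Y)))"
        if "y \<noteq> 0" "Y \<noteq> 0" for N T T' K y Y :: complex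
        using that by (simp add: field_simps)
      from this[of "1 - t\<^sup>2" "(1 - t\<^sup>2) ^ j" "of_nat (Suc i)" "t ^ i" "t ^ Suc i" "of_nat (Suc j)"]
      have "((of_nat (Suc i) * t ^ i) * (1 - t\<^sup>2) ^ Suc j - t ^ Suc i * (of_nat (Suc j) * (1 - t\<^sup>2) ^ j * (- (2 * t))))
         / ((1 - t\<^sup>2) ^ Suc j * (1 - t\<^sup>2) ^ Suc j) = of_nat (Suc i) * I t + of_nat (2 * Suc j) * I' t"
        using nz by (simp add: I_def I'_def power2_eq_square mult_ac)
      ultimately show ?thesis by simp
    qed
  qed (use circle_in_annulus in auto)
  then have "((\<lambda>t. of_nat (Suc i) * I t + of_nat (2 * Suc j) * I' t) has_contour_integral 0) (circlepath 1 1)"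
    by simp
  then have "((\<lambda>t. inverse (of_nat (2 * Suc j)) * ((of_nat (Suc i) * I t + of_nat (2 * Suc j) * I' t) - of_nat (Suc i) * I t))
     has_contour_integral inverse (of_nat (2 * Suc j)) * (0 - of_nat (Suc i) * c)) (circlepath 1 1)"
    by (intro has_contour_integral_lmul has_contour_integral_diff c[folded I_def])
  moreover have "inverse (of_nat (2 * Suc j)) * ((of_nat (Suc i) * I t + of_nat (2 * Suc j) * I' t) - of_nat (Suc i) * I t) = I' t" for t
    by (simp add: field_simps del: of_nat_Suc)
  moreover have "inverse K * (0 - N * c) = - (N / K) * c" for K N :: complex
    by (simp add: divide_inverse)
  ultimately show ?thesis by (simp only: I'_def)
qed

lemma contour_integral_even_power:
  "((\<lambda>t. t ^ (2 * j) / (1 - t\<^sup>2) ^ Suc j) has_contour_integral (- (of_real pi * \<i>) * ((-1/2) gchoose j))) (circlepath 1 1)"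
proof (induction j)
  case 0
  show ?case using contour_integral_power_0[of 0] by simp
next
  case (Suc j)
  have "(-1/2 :: complex) * ((-1/2) gchoose j) = of_nat j * ((-1/2) gchoose j) + of_nat (Suc j) * ((-1/2) gchoose (Suc j))"
    by (rule gbinomial_mult_1)
  then have eq: "(-1/2 :: complex) gchoose (Suc j) = - (of_nat (Suc (2 * j)) / of_nat (2 * Suc j)) * ((-1/2) gchoose j)"
    by (simp add: field_simps del: of_nat_Suc) (simp add: algebra_simps)
  have "- x * (- p * g) = - p * (- x * g)" for x p g :: complex by simp
  then show ?case using contour_integral_power_Suc[OF Suc.IH] unfolding eq by (simp only: mult_Suc_right add.commute)
qed

lemma contour_integral_odd_power:
  "((\<lambda>t. t ^ (2 * j + 1) / (1 - t\<^sup>2) ^ Suc j) has_contour_integral (- (of_real pi * \<i>) * (-1) ^ j)) (circlepath 1 1)"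
proof (induction j)
  case 0
  show ?case using contour_integral_power_0[of 1] by simp
next
  case (Suc j)
  have "of_nat (Suc (2 * j + 1)) / of_nat (2 * Suc j) = (1 :: complex)"
    by (simp del: of_nat_Suc)
  moreover have "2 * j + 1 + 2 = 2 * Suc j + 1" by simp
  ultimately show ?case using contour_integral_power_Suc[OF Suc.IH] by (simp only:) simp
qed

lemma contour_integral_resolvent:
  assumes \<delta>: "0 \<le> \<delta>" "\<delta> \<le> 1/50"
    and P: "\<And>j. cmod (P 0 j) \<le> M * \<delta> ^ j" "\<And>j. cmod (P 1 j) \<le> M * \<delta> ^ j"
  shows "(\<lambda>j. - (pi * \<i>) * ((-1) ^ j * ((-1/2) gchoose j) * P 0 j + P 1 j)) sums
    contour_integral (circlepath 1 1) (resolvent P)"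
proof -
  define I where "I j = - (pi * \<i>) * ((-1) ^ j * ((-1/2) gchoose j) * P 0 j + P 1 j)" for j
  have I: "(resolvent_term P j has_contour_integral I j) (circlepath 1 1)" for j
  proof -
    have "((\<lambda>t. (-1) ^ j * P 0 j * (t ^ (2 * j) / (1 - t\<^sup>2) ^ Suc j) + (-1) ^ j * P 1 j * (t ^ (2 * j + 1) / (1 - t\<^sup>2) ^ Suc j))
      has_contour_integral (-1) ^ j * P 0 j * (- (pi * \<i>) * ((-1/2) gchoose j)) + (-1) ^ j * P 1 j * (- (pi * \<i>) * (-1) ^ j)) (circlepath 1 1)"
      by (intro has_contour_integral_add has_contour_integral_lmul contour_integral_even_power contour_integral_odd_power)
    moreover have "(\<lambda>t. (-1) ^ j * P 0 j * (t ^ (2 * j) / (1 - t\<^sup>2) ^ Suc j) + (-1) ^ j * P 1 j * (t ^ (2 * j + 1) / (1 - t\<^sup>2) ^ Suc j)) = resolvent_term P j"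
      by (auto simp: resolvent_term_def add_divide_distrib algebra_simps)
    moreover have "(-1) ^ j * P 0 j * (- (pi * \<i>) * ((-1/2) gchoose j)) + (-1) ^ j * P 1 j * (- (pi * \<i>) * (-1) ^ j) = I j"
      by (simp add: I_def algebra_simps flip: power_mult_distrib)
    ultimately show ?thesis by simp
  qed
  have sum_I: "((\<lambda>t. \<Sum>j<n. resolvent_term P j t) has_contour_integral (\<Sum>j<n. I j)) (circlepath 1 1)" for n
    by (intro has_contour_integral_sum I) auto
  have "((\<lambda>n. contour_integral (circlepath 1 1) (\<lambda>t. \<Sum>j<n. resolvent_term P j t)) \<longlongrightarrow>
      contour_integral (circlepath 1 1) (resolvent P)) sequentially"
  proof (rule contour_integral_uniform_limit_circlepath(2))
    show "\<forall>\<^sub>F n in sequentially. (\<lambda>t. \<Sum>j<n. resolvent_term P j t) contour_integrable_on circlepath 1 1"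
      using sum_I has_contour_integral_integrable by (intro always_eventually allI) blast
    have "sphere 1 1 \<subseteq> annulus" using circle_in_annulus by (simp add: path_image_circlepath)
    then show "uniform_limit (sphere 1 1) (\<lambda>n t. \<Sum>j<n. resolvent_term P j t) (resolvent P) sequentially"
      by (rule uniform_limit_on_subset[OF resolvent_uniform_limit[OF assms]])
  qed auto
  then show ?thesis
    unfolding sums_def I_def[symmetric] by (simp add: contour_integral_unique[OF sum_I])
qed

text \<open>Along the circle \<open>d\<close> solves the linear equation \<open>d' = - T d\<close>; returning to the initial value forces
  the exponential of the integral to be \<open>1\<close>, unless \<open>d\<close> vanishes on the whole circle, which passes
  through \<open>0\<close>.\<close>

lemma contour_integral_log_derivative:
  assumes d: "d holomorphic_on annulus" and T: "T holomorphic_on annulus"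
    and ode: "\<And>t. t \<in> annulus \<Longrightarrow> deriv d t = - d t * T t" and d0: "d 0 \<noteq> 0"
  shows "\<exists>m :: int. contour_integral (circlepath 1 1) T = 2 * pi * \<i> * of_int m"
proof -
  define \<gamma> where "\<gamma> = circlepath (1 :: complex) 1"
  define \<gamma>' where "\<gamma>' s = 2 * pi * \<i> * exp (2 * of_real pi * \<i> * of_real s)" for s :: real
  have \<gamma>: "\<gamma> s = 1 + exp (2 * of_real pi * \<i> * of_real s)" for s
    by (simp add: \<gamma>_def circlepath)
  have \<gamma>_deriv: "(\<gamma> has_vector_derivative \<gamma>' s) (at s within X)" for s X
    using has_vector_derivative_circlepath[of 1 1 s X] by (simp add: \<gamma>_def \<gamma>'_def)
  have in_ann: "\<gamma> s \<in> annulus" for s by (simp add: \<gamma> annulus_def)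
  have cont: "continuous_on {0..1} (\<lambda>s. T (\<gamma> s) * \<gamma>' s)"
  proof (rule continuous_on_mult)
    have "\<gamma> = (\<lambda>s. 1 + exp (2 * of_real pi * \<i> * of_real s))" by (rule ext) (rule \<gamma>)
    then have "continuous_on {0..1} \<gamma>" by (simp add: continuous_intros)
    then show "continuous_on {0..1} (\<lambda>s. T (\<gamma> s))"
      by (rule continuous_on_compose2[OF holomorphic_on_imp_continuous_on[OF T]]) (use in_ann in auto)
    show "continuous_on {0..1} \<gamma>'" unfolding \<gamma>'_def by (intro continuous_intros)
  qed
  define J where "J s = integral {0..s} (\<lambda>s. T (\<gamma> s) * \<gamma>' s)" for s
  have J': "(J has_vector_derivative T (\<gamma> s) * \<gamma>' s) (at s within {0..1})" if "s \<in> {0..1}" for s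
    unfolding J_def by (rule integral_has_vector_derivative[OF cont that])
  define h where "h s = d (\<gamma> s) * exp (J s)" for s
  have "(h has_vector_derivative 0) (at s within {0..1})" if s: "s \<in> {0..1}" for s
  proof -
    have "(d has_field_derivative deriv d (\<gamma> s)) (at (\<gamma> s))"
      using holomorphic_derivI[OF d open_annulus in_ann] .
    then have "((d \<circ> \<gamma>) has_vector_derivative \<gamma>' s * deriv d (\<gamma> s)) (at s within {0..1})"
      by (rule field_vector_diff_chain_within[OF \<gamma>_deriv has_field_derivative_at_within])
    moreover have "((exp \<circ> J) has_vector_derivative (T (\<gamma> s) * \<gamma>' s) * exp (J s)) (at s within {0..1})"
      by (rule field_vector_diff_chain_within[OF J'[OF s]]) (auto intro!: derivative_eq_intros)
    ultimately have "((\<lambda>s. (d \<circ> \<gamma>) s * (exp \<circ> J) s) has_vector_derivative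
       (d \<circ> \<gamma>) s * ((T (\<gamma> s) * \<gamma>' s) * exp (J s)) + (\<gamma>' s * deriv d (\<gamma> s)) * (exp \<circ> J) s) (at s within {0..1})"
      by (rule has_vector_derivative_mult)
    then show ?thesis using ode[OF in_ann, of s] by (simp add: h_def[abs_def] algebra_simps)
  qed
  then have const: "h s = h 0" if "s \<in> {0..1}" for s
    using has_vector_derivative_zero_constant[of "{0..1}" h] that by (metis atLeastAtMost_iff convex_real_interval(5) order_refl zero_le_one)
  \<comment> \<open>The circle passes through the origin, where \<open>d\<close> does not vanish\<close>
  have "\<gamma> (1/2) = 0"
  proof -
    have "\<gamma> (1/2) = 1 + exp (of_real pi * \<i>)" unfolding \<gamma> by (simp add: mult.commute)
    then show ?thesis by simp
  qed
  then have "h (1/2) \<noteq> 0" using d0 by (simp add: h_def)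
  then have h0: "h 0 \<noteq> 0" using const[of "1/2"] by simp
  have "\<gamma> 1 = \<gamma> 0" unfolding \<gamma> by (simp add: exp_two_pi_i mult.commute mult.left_commute)
  then have "exp (J 1) = exp (J 0)" using const[of 1] h0 by (simp add: h_def)
  moreover have "J 0 = 0" by (simp add: J_def)
  ultimately have "exp (J 1) = 1" by simp
  then obtain m where "Re (J 1) = 0" "Im (J 1) = of_int (2 * m) * pi" unfolding exp_eq_1 by blast
  then have "J 1 = of_int (2 * m) * pi * \<i>" by (simp add: complex_eq_iff)
  moreover have "contour_integral (circlepath 1 1) T = J 1"
    unfolding contour_integral_integral J_def
    by (intro integral_cong) (auto simp: \<gamma>_def[symmetric] vector_derivative_at[OF \<gamma>_deriv])
  ultimately have "contour_integral (circlepath 1 1) T = 2 * pi * \<i> * of_int m" by (simp add: mult_ac)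
  then show ?thesis ..
qed

text \<open>The formal identity for the perturbation determinant is an identity between holomorphic functions
  near \<open>0\<close>, hence on the whole annulus.\<close>

lemma contour_integral_perturbation_trace:
  fixes r :: "nat \<Rightarrow> nat \<Rightarrow> complex"
  assumes U: "\<And>k i j. i < n \<Longrightarrow> j < n \<Longrightarrow>
      U k i j = F k i j + (\<Sum>l<k. \<Sum>b<n. \<Sum>c<n. F l i b * r b c * U (k - 1 - l) c j)"
    and T: "\<And>k. T k = (\<Sum>b<n. \<Sum>c<n. r b c * (of_nat (k+1) * F k c b +
      (\<Sum>a<k. \<Sum>d<n. \<Sum>e<n. U a c d * r d e * (of_nat (k - a) * F (k - 1 - a) e b))))"
    and F: "\<And>i j. i < n \<Longrightarrow> j < n \<Longrightarrow>
      \<exists>f. f holomorphic_on annulus \<and> f has_fps_expansion Abs_fps (\<lambda>k. F k i j)"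
    and \<tau>: "\<tau> holomorphic_on annulus" "\<tau> has_fps_expansion Abs_fps T"
  shows "\<exists>m :: int. contour_integral (circlepath 1 1) \<tau> = 2 * pi * \<i> * of_int m"
proof -
  obtain f where f_hol: "\<And>i j. i < n \<Longrightarrow> j < n \<Longrightarrow> f i j holomorphic_on annulus"
    and f_exp: "\<And>i j. i < n \<Longrightarrow> j < n \<Longrightarrow> f i j has_fps_expansion Abs_fps (\<lambda>k. F k i j)"
    using F by metis
  define A where "A = Matrix.mat n n (\<lambda>(i,j). (if i = j then 1 else 0)
      - fps_X * (\<Sum>c<n. fps_const (r i c) * Abs_fps (\<lambda>k. F k c j)))"
  define B where "B t i j = (if i = j then 1 else 0) - t * (\<Sum>c<n. r i c * f c j t)" for t i j
  define d where "d t = (\<Sum>p | p permutes {0..<n}. signof p * (\<Prod>i = 0..<n. B t i (p i)))" for t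
  have A: "A \<in> carrier_mat n n" by (simp add: A_def)
  have perm: "p i < n" if "p \<in> {p. p permutes {0..<n}}" "i \<in> {0..<n}" for p i
    using that permutes_in_image[of p "{0..<n}" i] by auto
  have sign: "signof p = fps_const (signof p)" for p :: "nat \<Rightarrow> nat"
    by (simp add: sign_def)
  have "d has_fps_expansion (\<Sum>p | p permutes {0..<n}. fps_const (signof p) * (\<Prod>i = 0..<n. A $$ (i, p i)))"
    unfolding d_def
  proof (intro fps_expansion_intros)
    fix p i assume "p \<in> {p. p permutes {0..<n}}" "i \<in> {0..<n}"
    then have i: "i < n" "p i < n" using perm by auto
    have "(\<lambda>t. (if i = p i then 1 else 0) - t * (\<Sum>c<n. r i c * f c (p i) t)) has_fps_expansion
      fps_const (if i = p i then 1 else 0) - fps_X * (\<Sum>c<n. fps_const (r i c) * Abs_fps (\<lambda>k. F k c (p i)))"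
      by (intro fps_expansion_intros f_exp i) auto
    then show "(\<lambda>t. B t i (p i)) has_fps_expansion A $$ (i, p i)"
      using i by (auto simp: A_def B_def split: if_splits)
  qed
  then have d_exp: "d has_fps_expansion Determinant.det A"
    by (simp add: det_def'[OF A] sign[symmetric])
  have d_hol: "d holomorphic_on annulus"
    unfolding d_def B_def by (intro holomorphic_intros f_hol) (auto intro: perm)
  note det = fps_det_perturbation_deriv[OF U T, folded A_def]
  have "(\<lambda>t. deriv d t + d t * \<tau> t) has_fps_expansion (fps_deriv (Determinant.det A) + Determinant.det A * Abs_fps T)"
    by (intro fps_expansion_intros d_exp \<tau>)
  then have "(\<lambda>t. deriv d t + d t * \<tau> t) has_fps_expansion 0" by (simp add: det(1))
  moreover have "(\<lambda>t. deriv d t + d t * \<tau> t) holomorphic_on annulus"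
    by (intro holomorphic_intros d_hol \<tau> open_annulus)
  ultimately have "deriv d t + d t * \<tau> t = 0" if "t \<in> annulus" for t
    using has_fps_expansion_0_analytic_continuation open_annulus connected_annulus_1 zero_in_annulus that by blast
  then have "deriv d t = - d t * \<tau> t" if "t \<in> annulus" for t
    using that by (simp add: eq_neg_iff_add_eq_0)
  moreover have "d 0 \<noteq> 0"
    using has_fps_expansion_imp_0_eq_fps_nth_0[OF d_exp] by (simp add: det(2))
  ultimately show ?thesis using contour_integral_log_derivative[OF d_hol \<tau>(1)] by blast
qed

section \<open>Square-summable functions on a group\<close>

text \<open>A minimising sequence is Cauchy by the parallelogram law; the minimum is orthogonal to the subspace.\<close>

lemma closed_subspace_projection:
  fixes x :: "'a::{real_inner,complete_space}"
  assumes K: "subspace K" "closed K"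
  obtains q where "q \<in> K" "\<And>k. k \<in> K \<Longrightarrow> inner (x - q) k = 0"
proof -
  have ne: "K \<noteq> {}" using K(1) subspace_0 by blast
  define d where "d = infdist x K"
  have d_le: "d \<le> norm (x - y)" if "y \<in> K" for y
    using infdist_le[OF that, of x] by (simp add: d_def dist_norm)
  have d0: "d \<ge> 0" by (simp add: d_def infdist_nonneg)
  have "\<exists>y\<in>K. norm (x - y) < d + inverse (Suc n)" for n
  proof (rule ccontr)
    assume "\<not> ?thesis"
    then have "d + inverse (Suc n) \<le> norm (x - y)" if "y \<in> K" for y using that by force
    then have "d + inverse (Suc n) \<le> d"
      unfolding d_def infdist_notempty[OF ne] using ne by (intro cINF_greatest) (auto simp: dist_norm)
    then show False by simp
  qed
  then obtain y where y: "\<And>n. y n \<in> K" "\<And>n. norm (x - y n) < d + inverse (Suc n)" by metis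
  define b where "b n = (d + inverse (real (Suc n)))^2 - d^2" for n
  have dist_y: "(norm (y n - y m))^2 \<le> 2 * b n + 2 * b m" for n m
  proof -
    have "(1/2) *\<^sub>R (y n + y m) \<in> K"
      using K(1) y by (intro subspace_scale subspace_add)
    then have "d \<le> norm (x - (1/2) *\<^sub>R (y n + y m))" by (rule d_le)
    then have 1: "d^2 \<le> (norm (x - (1/2) *\<^sub>R (y n + y m)))^2" using d0 by (simp add: power_mono)
    have "(norm (y n - y m))^2 + 4 * (norm (x - (1/2) *\<^sub>R (y n + y m)))^2
       = 2 * (norm (x - y n))^2 + 2 * (norm (x - y m))^2"
      unfolding power2_norm_eq_inner
      by (simp add: algebra_simps inner_commute)
    moreover have "(norm (x - y k))^2 \<le> (d + inverse (real (Suc k)))^2" for k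
      using y(2)[of k] by (intro power_mono) auto
    from this[of n] this[of m] have "2 * (norm (x - y n))^2 + 2 * (norm (x - y m))^2 \<le> 2 * b n + 2 * b m + 4 * d^2"
      by (simp add: b_def)
    ultimately show ?thesis using 1 by linarith
  qed
  have "b \<longlonglongrightarrow> (d + 0)^2 - d^2"
    unfolding b_def by (intro tendsto_intros LIMSEQ_inverse_real_of_nat)
  then have b0: "b \<longlonglongrightarrow> 0" by simp
  have "Cauchy y"
  proof (rule metric_CauchyI)
    fix \<epsilon> :: real assume "\<epsilon> > 0"
    then have "eventually (\<lambda>n. b n < \<epsilon>^2 / 4) sequentially"
      by (intro order_tendstoD(2)[OF b0]) simp
    then obtain M where M: "\<And>n. n \<ge> M \<Longrightarrow> b n < \<epsilon>^2 / 4" by (auto simp: eventually_sequentially)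
    have "dist (y n) (y m) < \<epsilon>" if "n \<ge> M" "m \<ge> M" for n m
    proof -
      have "(norm (y n - y m))^2 < \<epsilon>^2" using dist_y[of n m] M[OF that(1)] M[OF that(2)] by simp
      then show ?thesis using \<open>\<epsilon> > 0\<close> by (auto simp: dist_norm intro: power2_less_imp_less)
    qed
    then show "\<exists>M. \<forall>m\<ge>M. \<forall>n\<ge>M. dist (y m) (y n) < \<epsilon>" by blast
  qed
  then obtain q where q: "y \<longlonglongrightarrow> q" using Cauchy_convergent convergent_def by blast
  have qK: "q \<in> K" using closed_sequentially[OF K(2)] y(1) q by blast
  have "norm (x - q) \<le> d"
  proof (rule LIMSEQ_le)
    show "(\<lambda>n. norm (x - y n)) \<longlonglongrightarrow> norm (x - q)" by (intro tendsto_intros q)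
    show "(\<lambda>n. d + inverse (real (Suc n))) \<longlonglongrightarrow> d"
      using tendsto_add[OF tendsto_const LIMSEQ_inverse_real_of_nat, of d] by simp
    show "\<exists>N. \<forall>n\<ge>N. norm (x - y n) \<le> d + inverse (real (Suc n))" using y(2) less_imp_le by blast
  qed
  then have min: "norm (x - q) \<le> norm (x - k)" if "k \<in> K" for k using d_le[OF that] by simp
  have "inner (x - q) k = 0" if k: "k \<in> K" for k
  proof (cases "k = 0")
    case False
    define t where "t = inner (x - q) k / inner k k"
    have kk: "inner k k > 0" using False by simp
    have "q + t *\<^sub>R k \<in> K" using K(1) qK k by (intro subspace_add subspace_scale)
    from min[OF this] have "(norm (x - q))^2 \<le> (norm (x - (q + t *\<^sub>R k)))^2" by (simp add: power_mono)
    also have "\<dots> = inner (x - q - t *\<^sub>R k) (x - q - t *\<^sub>R k)"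
      by (simp add: power2_norm_eq_inner diff_diff_add)
    also have "\<dots> = (norm (x - q))^2 - 2 * t * inner (x - q) k + t^2 * inner k k"
      unfolding power2_norm_eq_inner by (simp only: inner_diff_left inner_diff_right inner_scaleR_left inner_scaleR_right power2_eq_square)
        (simp add: algebra_simps inner_commute[of k x] inner_commute[of k q])
    also have "\<dots> = (norm (x - q))^2 - (inner (x - q) k)^2 / inner k k"
      using kk by (simp add: t_def power2_eq_square field_simps)
    finally have "(inner (x - q) k)^2 / inner k k \<le> 0" by simp
    then have "(inner (x - q) k)^2 \<le> 0" using kk by (simp add: divide_le_0_iff)
    then show ?thesis by simp
  qed simp
  then show thesis using that qK by blast
qed

lemma Re_mult_cnj_self: "Re (z * cnj z) = (cmod z)\<^sup>2"
  by (simp add: complex_mult_cnj cmod_power2)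

typedef 'a ell2 = "{f :: 'a \<Rightarrow> complex. (\<lambda>x. (cmod (f x))\<^sup>2) summable_on UNIV}"
  morphisms coef Abs_ell2
  by (rule exI[of _ "\<lambda>_. 0"]) simp

setup_lifting type_definition_ell2

lemma square_summable_coef: "(\<lambda>x. (cmod (coef f x))\<^sup>2) summable_on UNIV"
  using coef[of f] by simp

lemma square_summable_mult:
  assumes "(\<lambda>x. (cmod (f x))\<^sup>2) summable_on A" "(\<lambda>x. (cmod (g x))\<^sup>2) summable_on A"
  shows "(\<lambda>x. f x * cnj (g x)) summable_on A"
proof (rule Infinite_Sum.abs_summable_summable, rule summable_on_comparison_test)
  show "(\<lambda>x. (cmod (f x))\<^sup>2 + (cmod (g x))\<^sup>2) summable_on A"
    by (rule summable_on_add[OF assms])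
  fix x
  have "2 * (cmod (f x) * cmod (g x)) \<le> (cmod (f x))\<^sup>2 + (cmod (g x))\<^sup>2"
    using sum_squares_bound[of "cmod (f x)" "cmod (g x)"] by simp
  moreover have "0 \<le> cmod (f x) * cmod (g x)" by simp
  ultimately show "cmod (f x * cnj (g x)) \<le> (cmod (f x))\<^sup>2 + (cmod (g x))\<^sup>2"
    unfolding norm_mult complex_mod_cnj by linarith
qed simp

lemma square_summable_add:
  assumes "(\<lambda>x. (cmod (f x))\<^sup>2) summable_on A" "(\<lambda>x. (cmod (g x))\<^sup>2) summable_on A"
  shows "(\<lambda>x. (cmod (f x + g x))\<^sup>2) summable_on A"
proof (rule summable_on_comparison_test)
  show "(\<lambda>x. 2 * (cmod (f x))\<^sup>2 + 2 * (cmod (g x))\<^sup>2) summable_on A"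
    by (intro summable_on_add summable_on_cmult_right assms)
  fix x
  have "(cmod (f x + g x))\<^sup>2 \<le> (cmod (f x) + cmod (g x))\<^sup>2"
    by (intro power_mono norm_triangle_ineq) simp
  also have "\<dots> \<le> 2 * (cmod (f x))\<^sup>2 + 2 * (cmod (g x))\<^sup>2"
    using sum_squares_bound[of "cmod (f x)" "cmod (g x)"] by (simp add: power2_sum)
  finally show "(cmod (f x + g x))\<^sup>2 \<le> 2 * (cmod (f x))\<^sup>2 + 2 * (cmod (g x))\<^sup>2" .
qed simp

lemma square_summable_scale:
  "(\<lambda>x. (cmod (f x))\<^sup>2) summable_on A \<Longrightarrow> (\<lambda>x. (cmod (c * f x))\<^sup>2) summable_on A"
  by (simp add: norm_mult power_mult_distrib summable_on_cmult_right)

lift_definition scaleC :: "complex \<Rightarrow> 'a ell2 \<Rightarrow> 'a ell2" is "\<lambda>c f x. c * f x"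
  by (rule square_summable_scale)

instantiation ell2 :: (type) real_inner
begin

lift_definition zero_ell2 :: "'a ell2" is "\<lambda>_. 0" by simp
lift_definition plus_ell2 :: "'a ell2 \<Rightarrow> 'a ell2 \<Rightarrow> 'a ell2" is "\<lambda>f g x. f x + g x"
  by (rule square_summable_add)
lift_definition uminus_ell2 :: "'a ell2 \<Rightarrow> 'a ell2" is "\<lambda>f x. - f x" by simp
definition minus_ell2 :: "'a ell2 \<Rightarrow> 'a ell2 \<Rightarrow> 'a ell2" where "minus_ell2 f g = f + - g"
lift_definition scaleR_ell2 :: "real \<Rightarrow> 'a ell2 \<Rightarrow> 'a ell2" is "\<lambda>c f x. c *\<^sub>R f x"
  by (simp add: scaleR_conv_of_real square_summable_scale)
lift_definition inner_ell2 :: "'a ell2 \<Rightarrow> 'a ell2 \<Rightarrow> real" is "\<lambda>f g. \<Sum>\<^sub>\<infinity>x. Re (f x * cnj (g x))" .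
definition norm_ell2 :: "'a ell2 \<Rightarrow> real" where "norm_ell2 f = sqrt (inner f f)"
definition sgn_ell2 :: "'a ell2 \<Rightarrow> 'a ell2" where "sgn_ell2 f = scaleR (inverse (norm f)) f"
definition dist_ell2 :: "'a ell2 \<Rightarrow> 'a ell2 \<Rightarrow> real" where "dist_ell2 f g = norm (f - g)"
definition uniformity_ell2 :: "('a ell2 \<times> 'a ell2) filter" where
  "uniformity_ell2 = (INF e\<in>{0<..}. principal {(x, y). dist x y < e})"
definition open_ell2 :: "'a ell2 set \<Rightarrow> bool" where
  "open_ell2 U = (\<forall>x\<in>U. eventually (\<lambda>(x', y). x' = x \<longrightarrow> y \<in> U) uniformity)"

instance
proof
  fix f g h :: "'a ell2" and a b :: real
  show "f - g = f + - g" by (simp add: minus_ell2_def)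
  show "f + g + h = f + (g + h)" "f + g = g + f" "0 + f = f" "- f + f = 0"
    "a *\<^sub>R (f + g) = a *\<^sub>R f + a *\<^sub>R g" "(a + b) *\<^sub>R f = a *\<^sub>R f + b *\<^sub>R f"
    "a *\<^sub>R b *\<^sub>R f = (a * b) *\<^sub>R f" "1 *\<^sub>R f = f"
    by (transfer; simp add: algebra_simps)+
  show "dist f g = norm (f - g)" by (simp add: dist_ell2_def)
  show "sgn f = scaleR (inverse (norm f)) f" by (simp add: sgn_ell2_def)
  show "uniformity = (INF e\<in>{0<..}. principal {(x :: 'a ell2, y). dist x y < e})"
    by (simp add: uniformity_ell2_def)
  show "open U = (\<forall>x\<in>U. eventually (\<lambda>(x' :: 'a ell2, y). x' = x \<longrightarrow> y \<in> U) uniformity)" for U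
    by (simp add: open_ell2_def)
  have self: "inner f f = (\<Sum>\<^sub>\<infinity>x. (cmod (coef f x))\<^sup>2)" for f :: "'a ell2"
    by transfer (simp only: Re_mult_cnj_self)
  show "inner f g = inner g f"
    by transfer (simp add: mult.commute)
  show "inner (f + g) h = inner f h + inner g h"
    by transfer (simp add: distrib_right infsum_add square_summable_mult summable_on_Re
        del: times_complex.sel)
  show "inner (a *\<^sub>R f) g = a * inner f g"
  proof transfer
    fix a :: real and f g :: "'a \<Rightarrow> complex"
    have "Re ((a *\<^sub>R f x) * cnj (g x)) = a * Re (f x * cnj (g x))" for x by (simp add: algebra_simps)
    then show "(\<Sum>\<^sub>\<infinity>x. Re (a *\<^sub>R f x * cnj (g x))) = a * (\<Sum>\<^sub>\<infinity>x. Re (f x * cnj (g x)))"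
      by (simp only: infsum_cmult_right')
  qed
  show "0 \<le> inner f f" unfolding self by (intro infsum_nonneg) simp
  show "inner f f = 0 \<longleftrightarrow> f = 0"
  proof
    assume "inner f f = 0"
    then have "(cmod (coef f x))\<^sup>2 = 0" for x
      using finite_sum_le_infsum[OF square_summable_coef[of f], of "{x}"]
      unfolding self by (simp add: order_antisym)
    then show "f = 0" by (simp add: coef_inject[symmetric] zero_ell2.rep_eq fun_eq_iff)
  qed (simp add: self zero_ell2.rep_eq)
  show "norm f = sqrt (inner f f)" by (simp add: norm_ell2_def)
qed

end

lemmas coef_simps [simp] = zero_ell2.rep_eq plus_ell2.rep_eq uminus_ell2.rep_eq
  scaleR_ell2.rep_eq scaleC.rep_eq

lemma coef_minus [simp]: "coef (f - g) x = coef f x - coef g x"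
  unfolding minus_ell2_def coef_simps by simp

lemma ell2_eqI: "(\<And>x. coef f x = coef g x) \<Longrightarrow> f = g"
  by (simp add: coef_inject[symmetric] fun_eq_iff)

lemma norm_ell2_power2: "(norm f)\<^sup>2 = (\<Sum>\<^sub>\<infinity>x. (cmod (coef f x))\<^sup>2)"
  unfolding power2_norm_eq_inner[of f]
  by transfer (simp only: Re_mult_cnj_self)

lemma cmod_coef_le: "cmod (coef f x) \<le> norm f"
proof -
  have "(cmod (coef f x))\<^sup>2 \<le> (norm f)\<^sup>2"
    using finite_sum_le_infsum[OF square_summable_coef[of f], of "{x}"]
    by (simp add: norm_ell2_power2)
  then show ?thesis by (rule power2_le_imp_le) simp
qed

instance ell2 :: (type) complete_space
proof
  fix X :: "nat \<Rightarrow> 'a ell2" assume X: "Cauchy X"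
  have "Cauchy (\<lambda>n. coef (X n) x)" for x
  proof (rule metric_CauchyI)
    fix \<epsilon> :: real assume "\<epsilon> > 0"
    with X obtain M where "\<forall>m\<ge>M. \<forall>n\<ge>M. dist (X m) (X n) < \<epsilon>" by (meson metric_CauchyD)
    moreover have "dist (coef (X m) x) (coef (X n) x) \<le> dist (X m) (X n)" for m n
      using cmod_coef_le[of "X m - X n" x] by (simp add: dist_norm)
    ultimately show "\<exists>M. \<forall>m\<ge>M. \<forall>n\<ge>M. dist (coef (X m) x) (coef (X n) x) < \<epsilon>"
      by (meson le_less_trans)
  qed
  then have "\<exists>l. (\<lambda>n. coef (X n) x) \<longlonglongrightarrow> l" for x
    using Cauchy_convergent convergent_def by blast
  then obtain f where f: "\<And>x. (\<lambda>n. coef (X n) x) \<longlonglongrightarrow> f x" by metis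
  have partial: "(\<Sum>x\<in>F. (cmod (coef (X n) x - f x))\<^sup>2) \<le> \<epsilon>\<^sup>2"
    if F: "finite F" and M: "\<forall>m\<ge>M. \<forall>n\<ge>M. dist (X m) (X n) < \<epsilon>" and n: "n \<ge> M" for F M n \<epsilon>
  proof (rule LIMSEQ_le_const2)
    show "(\<lambda>m. \<Sum>x\<in>F. (cmod (coef (X n) x - coef (X m) x))\<^sup>2) \<longlonglongrightarrow> (\<Sum>x\<in>F. (cmod (coef (X n) x - f x))\<^sup>2)"
      by (intro tendsto_intros f)
    have "(\<Sum>x\<in>F. (cmod (coef (X n) x - coef (X m) x))\<^sup>2) \<le> \<epsilon>\<^sup>2" if "m \<ge> M" for m
    proof -
      have "(\<Sum>x\<in>F. (cmod (coef (X n - X m) x))\<^sup>2) \<le> (norm (X n - X m))\<^sup>2"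
        unfolding norm_ell2_power2 by (rule finite_sum_le_infsum[OF square_summable_coef F]) auto
      also have "\<dots> \<le> \<epsilon>\<^sup>2"
        using M n that by (intro power_mono) (auto simp: dist_norm less_imp_le)
      finally show ?thesis by simp
    qed
    then show "\<exists>N. \<forall>m\<ge>N. (\<Sum>x\<in>F. (cmod (coef (X n) x - coef (X m) x))\<^sup>2) \<le> \<epsilon>\<^sup>2" by blast
  qed
  have summ: "(\<lambda>x. (cmod (coef (X n) x - f x))\<^sup>2) summable_on UNIV"
    if "\<forall>m\<ge>M. \<forall>n\<ge>M. dist (X m) (X n) < \<epsilon>" "n \<ge> M" for n M \<epsilon>
    using partial[OF _ that] by (intro nonneg_bdd_above_summable_on bdd_aboveI2) auto
  obtain M where M: "\<forall>m\<ge>M. \<forall>n\<ge>M. dist (X m) (X n) < 1"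
    using metric_CauchyD[OF X, of 1] by auto
  have "(\<lambda>x. (cmod (coef (X M) x + - (coef (X M) x - f x)))\<^sup>2) summable_on UNIV"
    using summ[OF M order_refl] by (intro square_summable_add square_summable_coef) (simp add: norm_minus_commute)
  then have fs: "(\<lambda>x. (cmod (f x))\<^sup>2) summable_on UNIV" by simp
  define g where "g = Abs_ell2 f"
  have g: "coef g = f" using fs by (simp add: g_def Abs_ell2_inverse)
  have "X \<longlonglongrightarrow> g"
  proof (rule metric_LIMSEQ_I)
    fix \<epsilon> :: real assume "\<epsilon> > 0"
    then obtain M where M: "\<forall>m\<ge>M. \<forall>n\<ge>M. dist (X m) (X n) < \<epsilon>/2"
      using X by (meson metric_CauchyD half_gt_zero)
    have "dist (X n) g < \<epsilon>" if "n \<ge> M" for n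
    proof -
      have "(norm (X n - g))\<^sup>2 \<le> (\<epsilon>/2)\<^sup>2"
        unfolding norm_ell2_power2
        by (rule infsum_le_finite_sums[OF square_summable_coef]) (use partial[OF _ M that] in \<open>simp add: g\<close>)
      then have "norm (X n - g) \<le> \<epsilon>/2" using \<open>\<epsilon> > 0\<close> by (auto intro: power2_le_imp_le)
      then show ?thesis using \<open>\<epsilon> > 0\<close> by (simp add: dist_norm)
    qed
    then show "\<exists>M. \<forall>n\<ge>M. dist (X n) g < \<epsilon>" by blast
  qed
  then show "convergent X" by (auto simp: convergent_def)
qed

text \<open>The complex inner product; the one of the type class is its real part.\<close>

definition cip :: "'a ell2 \<Rightarrow> 'a ell2 \<Rightarrow> complex" where
  "cip f g = (\<Sum>\<^sub>\<infinity>x. coef f x * cnj (coef g x))"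

lemma cip_summable: "(\<lambda>x. coef f x * cnj (coef g x)) summable_on UNIV"
  by (rule square_summable_mult[OF square_summable_coef square_summable_coef])

lemma cip_eq_Complex: "cip f g = Complex (inner f g) (inner f (scaleC \<i> g))"
proof (rule complex_eqI)
  show "Re (cip f g) = Re (Complex (inner f g) (inner f (scaleC \<i> g)))"
    unfolding cip_def infsum_Re[OF cip_summable, symmetric] by (simp add: inner_ell2.rep_eq)
  show "Im (cip f g) = Im (Complex (inner f g) (inner f (scaleC \<i> g)))"
    unfolding cip_def infsum_Im[OF cip_summable, symmetric]
    by (simp add: inner_ell2.rep_eq mult.commute)
qed

lemma norm_scaleC: "norm (scaleC c f) = cmod c * norm f"
proof (rule power2_eq_imp_eq)
  show "(norm (scaleC c f))\<^sup>2 = (cmod c * norm f)\<^sup>2"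
    by (simp add: norm_ell2_power2 norm_mult power_mult_distrib infsum_cmult_right')
qed auto

lemma cmod_cip_le: "cmod (cip f g) \<le> 2 * norm f * norm g"
proof -
  have "\<bar>inner f (scaleC \<i> g)\<bar> \<le> norm f * norm g"
    using Cauchy_Schwarz_ineq2[of f "scaleC \<i> g"] by (simp add: norm_scaleC)
  then show ?thesis
    using cmod_le[of "cip f g"] Cauchy_Schwarz_ineq2[of f g] by (simp add: cip_eq_Complex)
qed

lemma cip_commute: "cip g f = cnj (cip f g)"
  unfolding cip_def infsum_cnj[symmetric] by (simp add: mult.commute)

lemma cip_self: "cip f f = of_real ((norm f)\<^sup>2)"
proof -
  have "((\<lambda>x. complex_of_real ((cmod (coef f x))\<^sup>2)) has_sum of_real ((norm f)\<^sup>2)) UNIV"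
    unfolding has_sum_of_real_iff norm_ell2_power2 by (rule has_sum_infsum[OF square_summable_coef])
  then show ?thesis
    unfolding cip_def by (simp add: complex_norm_square infsumI del: of_real_power)
qed

lemma square_summable_reindex:
  assumes "bij \<pi>" "(\<lambda>x. (cmod (f x))\<^sup>2) summable_on UNIV"
  shows "(\<lambda>x. (cmod (f (\<pi> x)))\<^sup>2) summable_on UNIV"
  using summable_on_reindex_bij_betw[of \<pi> UNIV UNIV "\<lambda>x. (cmod (f x))\<^sup>2"] assms by simp

lemma bij_diff_right: "bij (\<lambda>x. x - h :: 'g::group_add)"
  by (rule bij_betw_byWitness[of _ "\<lambda>x. x + h"]) auto

lemma bij_uminus_add: "bij (\<lambda>x. - x + h :: 'g::group_add)"
  by (rule bij_betw_byWitness[of _ "\<lambda>x. h - x"]) (auto simp: algebra_simps)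

lift_definition translate :: "'g::group_add \<Rightarrow> 'g ell2 \<Rightarrow> 'g ell2" is "\<lambda>h f x. f (x - h)"
  by (rule square_summable_reindex[OF bij_diff_right])

lift_definition ket :: "'a \<Rightarrow> 'a ell2" is "\<lambda>a x. if x = a then 1 else 0"
proof -
  fix a :: 'a
  have "(\<lambda>x. (cmod (if x = a then 1 else 0))\<^sup>2) summable_on {a}" by simp
  then show "(\<lambda>x. (cmod (if x = a then 1 else 0))\<^sup>2) summable_on UNIV"
    by (rule summable_on_cong_neutral[THEN iffD1, rotated 3]) auto
qed

lemma cip_ket: "cip (ket a) f = cnj (coef f a)"
proof -
  have "cip (ket a) f = (\<Sum>\<^sub>\<infinity>x\<in>{a}. cnj (coef f x))"
    unfolding cip_def by (rule infsum_cong_neutral) (auto simp: ket.rep_eq)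
  then show ?thesis by simp
qed

lemma norm_ket [simp]: "norm (ket a) = 1"
proof -
  have "(of_real ((norm (ket a))\<^sup>2) :: complex) = of_real 1"
    unfolding cip_self[symmetric] cip_ket by (simp add: ket.rep_eq)
  then have "(norm (ket a))\<^sup>2 = 1" unfolding of_real_eq_iff .
  then show ?thesis by (simp add: power2_eq_1_iff) (metis norm_ge_zero neg_0_le_iff_le not_one_le_zero)
qed

definition conv :: "'g::group_add ell2 \<Rightarrow> 'g ell2 \<Rightarrow> 'g \<Rightarrow> complex" where
  "conv f g x = (\<Sum>\<^sub>\<infinity>h. coef f h * coef g (- h + x))"

text \<open>Turns evaluation of a convolution at \<open>x\<close> into an inner product, and so bounds it by the norms.\<close>

lift_definition adjoint_at :: "'g::group_add \<Rightarrow> 'g ell2 \<Rightarrow> 'g ell2" is "\<lambda>x f h. cnj (f (- h + x))"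
proof -
  fix x :: 'g and f :: "'g \<Rightarrow> complex"
  assume "(\<lambda>x. (cmod (f x))\<^sup>2) summable_on UNIV"
  then show "(\<lambda>h. (cmod (cnj (f (- h + x))))\<^sup>2) summable_on UNIV"
    using square_summable_reindex[OF bij_uminus_add] by simp
qed

lemma conv_eq_cip: "conv f g x = cip f (adjoint_at x g)"
  by (simp add: conv_def cip_def adjoint_at.rep_eq)

lemma norm_adjoint_at: "norm (adjoint_at x f) = norm f"
proof (rule power2_eq_imp_eq)
  show "(norm (adjoint_at x f))\<^sup>2 = (norm f)\<^sup>2"
    unfolding norm_ell2_power2
    using infsum_reindex_bij_betw[OF bij_uminus_add[of x], of "\<lambda>h. (cmod (coef f h))\<^sup>2"]
    by (simp add: adjoint_at.rep_eq)
qed auto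

lemma cip_add_left: "cip (f + f') g = cip f g + cip f' g"
  unfolding cip_def by (simp add: distrib_right infsum_add cip_summable)

lemma bounded_bilinear_conv: "bounded_bilinear (\<lambda>f g. conv f g x)"
proof
  fix f f' g g' :: "'a ell2" and r :: real
  have summ: "(\<lambda>h. coef f h * coef g (- h + x)) summable_on UNIV" for f g :: "'a ell2"
    using cip_summable[of f "adjoint_at x g"] by (simp add: adjoint_at.rep_eq)
  show "conv (f + f') g x = conv f g x + conv f' g x" "conv f (g + g') x = conv f g x + conv f g' x"
    unfolding conv_def by (simp_all add: distrib_right distrib_left infsum_add summ)
  show "conv (r *\<^sub>R f) g x = r *\<^sub>R conv f g x" "conv f (r *\<^sub>R g) x = r *\<^sub>R conv f g x"
    unfolding conv_def by (simp_all add: infsum_cmult_right' scaleR_conv_of_real mult.left_commute mult.assoc)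
  have "cmod (conv f g x) \<le> norm f * norm g * 2" for f g :: "'a ell2"
    using cmod_cip_le[of f "adjoint_at x g"] by (simp add: conv_eq_cip norm_adjoint_at mult_ac)
  then show "\<exists>K. \<forall>f g. cmod (conv f g x) \<le> norm f * norm g * K" by blast
qed

lemma bounded_linear_coef: "bounded_linear (\<lambda>f. coef f x)"
  by (rule bounded_linear_intro[of _ 1]) (auto simp: cmod_coef_le)

text \<open>Convolution by \<open>e\<close> may be unbounded on \<open>\<ell>\<^sup>2\<close>, but it is defined pointwise and pointwise continuous;
  that suffices for \<open>{\<eta>. e * \<eta> = \<eta>}\<close> to be closed.  This set is invariant under right translations,
  and the projection \<open>q\<close> of the unit represents evaluation at each point through its translates.\<close>

theorem ell2_convolution_idempotent:
  fixes e :: "'g::group_add ell2"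
  assumes idem: "\<And>x. conv e e x = coef e x" and int: "coef e 0 \<in> \<int>"
  shows "e = 0 \<or> e = ket 0"
proof -
  \<comment> \<open>The range of the idempotent\<close>
  define K where "K = {\<eta>. \<forall>x. conv e \<eta> x = coef \<eta> x}"
  interpret conv: bounded_bilinear "\<lambda>f g. conv f g x" for x by (rule bounded_bilinear_conv)
  have conv_scaleC: "conv f (scaleC c g) x = c * conv f g x" for f g :: "'g ell2" and c x
    unfolding conv_def by (simp add: mult.left_commute infsum_cmult_right')
  have conv_translate: "conv f (translate h g) x = conv f g (x - h)" for f g :: "'g ell2" and h x
    by (simp add: conv_def translate.rep_eq add_diff_eq)
  have sub: "subspace K"
    by (auto simp: K_def subspace_def conv.zero_right conv.add_right conv.scaleR_right)
  have clo: "closed K"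
    unfolding K_def
    by (intro closed_Collect_all closed_Collect_eq linear_continuous_on
        conv.bounded_linear_right bounded_linear_coef)
  have K_C: "scaleC c k \<in> K" if "k \<in> K" for c k using that by (auto simp: K_def conv_scaleC)
  have K_T: "translate h k \<in> K" if "k \<in> K" for h k
    using that by (auto simp: K_def conv_translate translate.rep_eq)
  have eK: "e \<in> K" using idem by (simp add: K_def)
  obtain q where qK: "q \<in> K" and orth: "\<And>k. k \<in> K \<Longrightarrow> inner (ket 0 - q) k = 0"
    using closed_subspace_projection[OF sub clo] by blast
  have "cip (ket 0 - q) k = 0" if "k \<in> K" for k
    using orth[OF that] orth[OF K_C[OF that]] by (simp add: cip_eq_Complex complex_eq_iff)
  then have "cip (ket 0) k = cip q k" if "k \<in> K" for k
    using that cip_add_left[of "ket 0 - q" q k] by simp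
  then have rep0: "cnj (coef k 0) = cip q k" if "k \<in> K" for k
    using that by (simp add: cip_ket)
  have rep: "cnj (coef k h) = cip q (translate (- h) k)" if "k \<in> K" for k h
    using rep0[OF K_T[OF that, of "- h"]] by (simp add: translate.rep_eq)
  have sym: "coef q (- h) = cnj (coef q h)" for h
  proof -
    have "cip q (translate h q) = cip (translate (- h) q) q"
      unfolding cip_def translate.rep_eq
      using infsum_reindex_bij_betw[OF bij_diff_right[of "- h"], of "\<lambda>x. coef q x * cnj (coef q (x - h))"]
      by simp
    then have "cnj (coef q (- h)) = cnj (cip q (translate (- h) q))"
      using rep[OF qK, of "- h"] cip_commute[of "translate (- h) q" q] by simp
    then show ?thesis using rep[OF qK, of h] by simp
  qed
  have "coef e 0 = cip e q"
    using rep0[OF eK] cip_commute[of e q] by (metis complex_cnj_cnj)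
  also have "\<dots> = conv e q 0"
    by (simp add: cip_def conv_def sym)
  also have "\<dots> = coef q 0" using qK by (simp add: K_def)
  also have "\<dots> = of_real ((norm q)\<^sup>2)"
    using rep0[OF qK] unfolding cip_self by (metis complex_cnj_cnj complex_cnj_complex_of_real)
  finally have e0: "coef e 0 = of_real ((norm q)\<^sup>2)" .
  have pyth: "1 = (norm q)\<^sup>2 + (norm (ket 0 - q))\<^sup>2"
  proof -
    have "(norm (ket 0 :: 'g ell2))\<^sup>2 = (norm (q + (ket 0 - q)))\<^sup>2" by simp
    also have "\<dots> = (norm q)\<^sup>2 + (norm (ket 0 - q))\<^sup>2"
      using orth[OF qK] unfolding power2_norm_eq_inner
      by (simp only: inner_add_left inner_add_right inner_commute[of q "ket 0 - q"])
    finally show ?thesis by simp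
  qed
  from int obtain m where m: "complex_of_real ((norm q)\<^sup>2) = of_int m" unfolding e0 by (auto elim: Ints_cases)
  then have "(norm q)\<^sup>2 = of_int m" by (metis of_real_eq_iff of_real_of_int_eq)
  moreover from this pyth have "0 \<le> m" "m \<le> 1"
    by (metis of_int_0_le_iff zero_le_power2, metis add_increasing2 le_add_same_cancel1 of_int_le_1_iff zero_le_power2)
  ultimately consider "(norm q)\<^sup>2 = 0" | "(norm q)\<^sup>2 = 1" by (cases "m = 0") auto
  then show ?thesis
  proof cases
    case 1
    then have "q = 0" by simp
    then have "coef e h = 0" for h
      using rep[OF eK, of h] by (simp add: cip_def)
    then have "e = 0" by (intro ell2_eqI) simp
    then show ?thesis ..
  next
    case 2
    then have "ket 0 = q" using pyth by simp
    then have kK: "ket 0 \<in> K" using qK by simp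
    have "coef e x = coef (ket 0) x" for x
    proof -
      have "conv e (ket 0) x = (\<Sum>\<^sub>\<infinity>h\<in>{x}. coef e h)"
        unfolding conv_def
        by (rule infsum_cong_neutral) (auto simp: ket.rep_eq neg_eq_iff_add_eq_0[symmetric])
      then show ?thesis using kK by (simp add: K_def)
    qed
    then have "e = ket 0" by (rule ell2_eqI)
    then show ?thesis ..
  qed
qed

section \<open>The group ring and its two actions\<close>

abbreviation lookup where "lookup \<equiv> poly_mapping.lookup"
abbreviation keys where "keys \<equiv> Poly_Mapping.keys"

lemma lookup_mult_group:
  fixes f g :: "'g::group_add \<Rightarrow>\<^sub>0 'b::semiring_0"
  shows "lookup (f * g) k = (\<Sum>\<alpha>\<in>keys f. lookup f \<alpha> * lookup g (- \<alpha> + k))"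
proof -
  have "(\<Sum>q. lookup g q when k = l + q) = lookup g (- l + k)" for l
  proof -
    have eq: "k = l + q \<longleftrightarrow> q = - l + k" for q
      by (auto simp: add.assoc[symmetric])
    show ?thesis unfolding eq by simp
  qed
  then have "lookup (f * g) k = (\<Sum>l. lookup f l * lookup g (- l + k))"
    by (simp add: lookup_mult)
  also have "\<dots> = (\<Sum>l\<in>keys f. lookup f l * lookup g (- l + k))"
    by (rule Sum_any.expand_superset) (auto simp: in_keys_iff)
  finally show ?thesis .
qed

lemma lookup_single_mult: "lookup (Poly_Mapping.single 0 c * f) x = c * lookup f x"
  for f :: "'g::group_add \<Rightarrow>\<^sub>0 complex"
  by (cases "c = 0") (auto simp: lookup_mult_group)

text \<open>Defined on all functions, since \<open>f\<close> has finite support.  For the action by left translations this is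
  convolution by \<open>f\<close>.\<close>

definition act_op :: "('g \<Rightarrow> 'g \<Rightarrow> 'g) \<Rightarrow> ('g::group_add \<Rightarrow>\<^sub>0 complex) \<Rightarrow> ('g \<Rightarrow> complex) \<Rightarrow> 'g \<Rightarrow> complex" where
  "act_op act f \<xi> w = (\<Sum>\<alpha>\<in>keys f. lookup f \<alpha> * \<xi> (act (- \<alpha>) w))"

lemma act_op_superset:
  assumes "finite K" "keys f \<subseteq> K"
  shows "act_op act f \<xi> w = (\<Sum>\<alpha>\<in>K. lookup f \<alpha> * \<xi> (act (- \<alpha>) w))"
  unfolding act_op_def using assms by (intro sum.mono_neutral_left) (auto simp: in_keys_iff)

lemma act_op_mult:
  assumes act: "\<And>x y w. act (x + y) w = act x (act y w)"
  shows "act_op act (f * g) \<xi> = act_op act f (act_op act g \<xi>)"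
proof
  fix w
  define K where "K = (\<lambda>(\<alpha>, \<beta>). \<alpha> + \<beta>) ` (keys f \<times> keys g)"
  have K: "finite K" "keys (f * g) \<subseteq> K"
    using keys_mult[of f g] by (force simp: K_def)+
  have "act_op act (f * g) \<xi> w = (\<Sum>k\<in>K. \<Sum>\<alpha>\<in>keys f. lookup f \<alpha> * (lookup g (- \<alpha> + k) * \<xi> (act (- k) w)))"
    unfolding act_op_superset[OF K] lookup_mult_group sum_distrib_right by (simp only: mult.assoc)
  also have "\<dots> = (\<Sum>\<alpha>\<in>keys f. lookup f \<alpha> * (\<Sum>k\<in>K. lookup g (- \<alpha> + k) * \<xi> (act (- k) w)))"
    by (subst sum.swap) (simp only: sum_distrib_left)
  also have "\<dots> = act_op act f (act_op act g \<xi>) w"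
    unfolding act_op_def[of act f]
  proof (intro sum.cong refl arg_cong2[where f = "(*)"])
    fix \<alpha> assume \<alpha>: "\<alpha> \<in> keys f"
    have "(\<Sum>k\<in>K. lookup g (- \<alpha> + k) * \<xi> (act (- k) w)) = (\<Sum>k\<in>(+) \<alpha> ` keys g. lookup g (- \<alpha> + k) * \<xi> (act (- k) w))"
    proof (rule sum.mono_neutral_right)
      show "(+) \<alpha> ` keys g \<subseteq> K" using \<alpha> by (auto simp: K_def)
      show "\<forall>k\<in>K - (+) \<alpha> ` keys g. lookup g (- \<alpha> + k) * \<xi> (act (- k) w) = 0"
      proof
        fix k assume k: "k \<in> K - (+) \<alpha> ` keys g"
        have "k = \<alpha> + (- \<alpha> + k)" by (simp add: add.assoc[symmetric])
        then have "- \<alpha> + k \<notin> keys g" using k by blast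
        then show "lookup g (- \<alpha> + k) * \<xi> (act (- k) w) = 0" by (simp add: in_keys_iff)
      qed
    qed (rule K)
    also have "\<dots> = (\<Sum>\<beta>\<in>keys g. lookup g \<beta> * \<xi> (act (- (\<alpha> + \<beta>)) w))"
      by (subst sum.reindex) (auto simp: inj_on_def add.assoc[symmetric])
    also have "\<dots> = act_op act g \<xi> (act (- \<alpha>) w)"
      by (simp only: act_op_def minus_add act)
    finally show "(\<Sum>k\<in>K. lookup g (- \<alpha> + k) * \<xi> (act (- k) w)) = act_op act g \<xi> (act (- \<alpha>) w)" .
  qed
  finally show "act_op act (f * g) \<xi> w = act_op act f (act_op act g \<xi>) w" .
qed

lemma linear_op_act_op: "linear_op (act_op act f)"
  by (auto simp: linear_op_def act_op_def fun_eq_iff sum.distrib sum_distrib_right distrib_left mult.assoc)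

lemma translation_op_delta: "act_op (+) f (delta b) w = lookup f (w - b)"
proof -
  have eq: "- \<beta> + w = b \<longleftrightarrow> \<beta> = w - b" for \<beta>
    by (metis add.assoc add.right_neutral add_diff_cancel diff_add_cancel left_minus minus_add_cancel)
  have "act_op (+) f (delta b) w = (\<Sum>\<beta>\<in>insert (w - b) (keys f). lookup f \<beta> * delta b (- \<beta> + w))"
    by (rule act_op_superset) auto
  also have "\<dots> = (\<Sum>\<beta>\<in>insert (w - b) (keys f). if \<beta> = w - b then lookup f \<beta> else 0)"
    using eq by (intro sum.cong) (auto simp: delta_def)
  finally show ?thesis by simp
qed

lemma translation_op_one: "act_op (+) 1 \<xi> = \<xi>"
  by (simp add: act_op_def fun_eq_iff)

lemma translation_op_funpow: "(act_op (+) u ^^ k) \<xi> = act_op (+) (u ^ k) \<xi>"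
  by (induction k) (simp_all add: translation_op_one act_op_mult[of "(+)", OF add.assoc])

text \<open>The coefficient of \<open>x\<^sup>j\<close> in \<open>(1 - x)\<^bsup>-1/2\<^esup>\<close>.\<close>

definition binom_coeff :: "nat \<Rightarrow> real" where
  "binom_coeff j = (-1) ^ j * ((-1/2) gchoose j)"

lemma abs_binom_coeff_le: "\<bar>binom_coeff j\<bar> \<le> 1"
proof -
  have "\<bar>(-1/2 :: real) gchoose j\<bar> \<le> 1"
  proof (induction j)
    case (Suc j)
    have "(-1/2 :: real) * ((-1/2) gchoose j) = of_nat j * ((-1/2) gchoose j) + of_nat (Suc j) * ((-1/2) gchoose (Suc j))"
      by (rule gbinomial_mult_1)
    then have "(-1/2 :: real) gchoose (Suc j) = - ((1/2 + of_nat j) / of_nat (Suc j)) * ((-1/2) gchoose j)"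
      by (simp add: field_simps del: of_nat_Suc)
    then have "\<bar>(-1/2 :: real) gchoose (Suc j)\<bar> = ((1/2 + of_nat j) / of_nat (Suc j)) * \<bar>(-1/2) gchoose j\<bar>"
      by (simp add: abs_mult)
    also have "\<dots> \<le> 1 * 1" by (intro mult_mono Suc.IH) auto
    finally show ?case by simp
  qed simp
  then show ?thesis by (simp add: binom_coeff_def abs_mult)
qed

lemma binom_coeff_conv: "(\<Sum>i\<le>m. binom_coeff i * binom_coeff (m - i)) = 1"
proof -
  have "(\<Sum>i\<le>m. binom_coeff i * binom_coeff (m - i)) = (\<Sum>i\<le>m. (-1) ^ m * (((-1/2) gchoose i) * ((-1/2) gchoose (m - i))))"
  proof (rule sum.cong[OF refl])
    fix i assume "i \<in> {..m}"
    then have "(-1 :: real) ^ i * (-1) ^ (m - i) = (-1) ^ m" by (simp flip: power_add)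
    then show "binom_coeff i * binom_coeff (m - i) = (-1) ^ m * (((-1/2) gchoose i) * ((-1/2) gchoose (m - i)))"
      by (simp add: binom_coeff_def mult_ac)
  qed
  also have "\<dots> = (-1) ^ m * ((-1/2 + -1/2) gchoose m)"
    by (simp only: sum_distrib_left[symmetric] gbinomial_Vandermonde[symmetric] atLeast0AtMost)
  also have "(-1/2 + -1/2 :: real) gchoose m = (-1) ^ m"
    using gbinomial_minus[of "1 :: real" m] by (simp add: binomial_gbinomial[symmetric])
  finally show ?thesis by (simp flip: power_mult_distrib)
qed

text \<open>The square of the \<open>N\<close>-th partial sum agrees with the geometric series in all terms of degree below
  \<open>N\<close>, and the other at most \<open>N\<^sup>2\<close> terms are of order \<open>\<delta>\<^sup>N\<close>.\<close>

lemma square_partial_sums_tendsto: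
  fixes c :: "nat \<Rightarrow> real" and \<psi> :: "nat \<Rightarrow> complex"
  assumes c: "\<And>i. \<bar>c i\<bar> \<le> 1" "\<And>m. (\<Sum>i\<le>m. c i * c (m - i)) = 1"
    and \<delta>: "0 \<le> \<delta>" "\<delta> < 1" and \<psi>: "\<And>m. cmod (\<psi> m) \<le> M * \<delta> ^ m" and L: "\<psi> sums L"
  shows "(\<lambda>N. \<Sum>i<N. \<Sum>j<N. of_real (c i * c j) * \<psi> (i + j)) \<longlonglongrightarrow> L"
proof -
  have M: "0 \<le> M" using \<psi>[of 0] by (simp add: order_trans[OF norm_ge_zero])
  define g where "g = (\<lambda>(i, j). of_real (c i * c j) * \<psi> (i + j))"
  have diff: "(\<Sum>i<N. \<Sum>j<N. of_real (c i * c j) * \<psi> (i + j)) - (\<Sum>m<N. \<psi> m)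
      = (\<Sum>(i, j)\<in>{(i, j). i < N \<and> j < N \<and> N \<le> i + j}. g (i, j))" for N
  proof -
    have "(\<Sum>i<N. \<Sum>j<N. of_real (c i * c j) * \<psi> (i + j)) = sum g ({..<N} \<times> {..<N})"
      by (simp add: sum.cartesian_product g_def)
    also have "{..<N} \<times> {..<N} = {(i, j). i + j < N} \<union> {(i, j). i < N \<and> j < N \<and> N \<le> i + j}" by auto
    also have "sum g \<dots> = sum g {(i, j). i + j < N} + sum g {(i, j). i < N \<and> j < N \<and> N \<le> i + j}"
    proof (rule sum.union_disjoint)
      show "finite {(i, j). i + j < N}" by (rule finite_subset[of _ "{..<N} \<times> {..<N}"]) auto
      show "finite {(i, j). i < N \<and> j < N \<and> N \<le> i + j}" by (rule finite_subset[of _ "{..<N} \<times> {..<N}"]) auto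
    qed auto
    also have "sum g {(i, j). i + j < N} = (\<Sum>m<N. \<Sum>i\<le>m. g (i, m - i))"
      using sum.triangle_reindex[of "\<lambda>i j. g (i, j)" N] by (simp add: case_prod_unfold)
    also have "\<dots> = (\<Sum>m<N. \<psi> m)"
    proof (rule sum.cong[OF refl])
      fix m
      have "(\<Sum>i\<le>m. g (i, m - i)) = (\<Sum>i\<le>m. of_real (c i * c (m - i)) * \<psi> m)"
        by (rule sum.cong) (auto simp: g_def)
      also have "\<dots> = of_real (\<Sum>i\<le>m. c i * c (m - i)) * \<psi> m" by (simp add: sum_distrib_right)
      finally show "(\<Sum>i\<le>m. g (i, m - i)) = \<psi> m" by (simp add: c(2))
    qed
    finally show ?thesis by simp
  qed
  have bound: "cmod ((\<Sum>i<N. \<Sum>j<N. of_real (c i * c j) * \<psi> (i + j)) - (\<Sum>m<N. \<psi> m)) \<le> M * (real N * sqrt \<delta> ^ N)\<^sup>2" for N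
  proof -
    let ?A = "{(i, j). i < N \<and> j < N \<and> N \<le> i + j}"
    have sub: "?A \<subseteq> {..<N} \<times> {..<N}" by auto
    have "card ?A \<le> card ({..<N} \<times> {..<N})" by (rule card_mono[OF _ sub]) simp
    then have cardA: "real (card ?A) \<le> real N * real N"
      by (simp flip: of_nat_mult)
    have "cmod (g (i, j)) \<le> M * \<delta> ^ N" if "(i, j) \<in> ?A" for i j
    proof -
      have "cmod (g (i, j)) = \<bar>c i\<bar> * \<bar>c j\<bar> * cmod (\<psi> (i + j))" by (simp add: g_def norm_mult)
      also have "\<dots> \<le> 1 * 1 * (M * \<delta> ^ (i + j))" by (intro mult_mono c \<psi>) auto
      also have "\<dots> \<le> M * \<delta> ^ N"
        using that \<delta> M by (auto intro!: mult_left_mono power_decreasing)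
      finally show ?thesis .
    qed
    then have "cmod (\<Sum>(i, j)\<in>?A. g (i, j)) \<le> of_nat (card ?A) * (M * \<delta> ^ N)"
      by (intro sum_norm_bound) auto
    also have "\<dots> \<le> real N * real N * (M * \<delta> ^ N)"
      using cardA M \<delta> by (intro mult_right_mono) auto
    also have "\<delta> ^ N = (sqrt \<delta> ^ N)\<^sup>2"
    proof -
      have "(sqrt \<delta> ^ N)\<^sup>2 = ((sqrt \<delta>)\<^sup>2) ^ N"
        by (simp only: power_mult[symmetric] mult.commute)
      then show ?thesis using \<delta> by simp
    qed
    finally show ?thesis unfolding diff by (simp add: power2_eq_square mult_ac)
  qed
  have "(\<lambda>N. M * (real N * sqrt \<delta> ^ N)\<^sup>2) \<longlonglongrightarrow> M * 0\<^sup>2"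
    by (intro tendsto_intros powser_times_n_limit_0) (use \<delta> in \<open>simp add: real_sqrt_lt_1_iff\<close>)
  then have "(\<lambda>N. (\<Sum>i<N. \<Sum>j<N. of_real (c i * c j) * \<psi> (i + j)) - (\<Sum>m<N. \<psi> m)) \<longlonglongrightarrow> 0"
    by (intro Lim_null_comparison[OF always_eventually[rule_format, OF bound]]) simp
  from tendsto_add[OF this L[unfolded sums_def]] show ?thesis by simp
qed

instance ell2 :: (type) banach ..

lift_definition ell2_of :: "('a \<Rightarrow>\<^sub>0 complex) \<Rightarrow> 'a ell2" is "\<lambda>f. poly_mapping.lookup f"
proof -
  fix f :: "'a \<Rightarrow>\<^sub>0 complex"
  have "(\<lambda>x. (cmod (lookup f x))\<^sup>2) summable_on keys f" by simp
  then show "(\<lambda>x. (cmod (lookup f x))\<^sup>2) summable_on UNIV"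
    by (rule summable_on_cong_neutral[THEN iffD1, rotated 3]) (auto simp: in_keys_iff)
qed

lemma conv_ell2_of: "conv (ell2_of f) (ell2_of g) x = lookup (f * g) x"
proof -
  have "conv (ell2_of f) (ell2_of g) x = (\<Sum>\<^sub>\<infinity>h\<in>keys f. lookup f h * lookup g (- h + x))"
    unfolding conv_def ell2_of.rep_eq by (rule infsum_cong_neutral) (auto simp: in_keys_iff)
  then show ?thesis by (simp add: lookup_mult_group)
qed

lemma conv_ket_left: "conv (ket 0) f x = coef f x"
proof -
  have "conv (ket 0) f x = (\<Sum>\<^sub>\<infinity>h\<in>{0}. coef f (- h + x))"
    unfolding conv_def by (rule infsum_cong_neutral) (auto simp: ket.rep_eq)
  then show ?thesis by simp
qed

lemma conv_ket_right: "conv f (ket 0) x = coef f x"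
proof -
  have "conv f (ket 0) x = (\<Sum>\<^sub>\<infinity>h\<in>{x}. coef f h)"
    unfolding conv_def
    by (rule infsum_cong_neutral) (auto simp: ket.rep_eq neg_eq_iff_add_eq_0[symmetric])
  then show ?thesis by simp
qed

lemma lookup_geometric_series:
  fixes u :: "'g::group_add \<Rightarrow>\<^sub>0 complex"
  assumes \<delta>: "0 \<le> \<delta>" "\<delta> < 1" and bound: "\<exists>M. \<forall>j. cmod (lookup ((1 - u\<^sup>2) ^ j) x) \<le> M * \<delta> ^ j"
  shows "(\<lambda>j. lookup (u\<^sup>2 * (1 - u\<^sup>2) ^ j) x) sums lookup 1 x"
proof -
  define a where "a = 1 - u\<^sup>2"
  obtain M where M: "\<And>j. cmod (lookup (a ^ j) x) \<le> M * \<delta> ^ j" using bound unfolding a_def by blast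
  have "(\<lambda>j. M * \<delta> ^ j) \<longlonglongrightarrow> 0" using \<delta> by (intro tendsto_mult_right_zero LIMSEQ_power_zero) simp
  then have "(\<lambda>j. lookup (a ^ j) x) \<longlonglongrightarrow> 0"
    by (rule Lim_null_comparison[OF always_eventually[OF allI[OF M]]])
  then have "(\<lambda>j. lookup (a ^ j) x - lookup (a ^ Suc j) x) sums (lookup (a ^ 0) x - 0)"
    by (rule telescope_sums')
  moreover have "lookup (a ^ j) x - lookup (a ^ Suc j) x = lookup (u\<^sup>2 * a ^ j) x" for j
    by (simp add: a_def left_diff_distrib lookup_minus)
  ultimately show ?thesis by (simp add: a_def)
qed

text \<open>Partial sums of \<open>u (u\<^sup>2)\<^bsup>-1/2\<^esup>\<close>, expanded at \<open>u\<^sup>2 = 1\<close>.\<close>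

definition sign_series :: "('g::group_add \<Rightarrow>\<^sub>0 complex) \<Rightarrow> nat \<Rightarrow> ('g \<Rightarrow>\<^sub>0 complex)" where
  "sign_series u N = (\<Sum>j<N. Poly_Mapping.single 0 (of_real (binom_coeff j)) * (u * (1 - u\<^sup>2) ^ j))"

text \<open>All that is used of the free group: its left translations agree, each up to finitely many points,
  with an action that fixes the base point and is free elsewhere.\<close>

locale almost_free_action =
  fixes act :: "'g::group_add \<Rightarrow> 'g \<Rightarrow> 'g"
  assumes act_zero [simp]: "act 0 w = w"
    and act_add: "act (x + y) w = act x (act y w)"
    and act_base [simp]: "act x 0 = 0"
    and act_free: "act x w = w \<Longrightarrow> w \<noteq> 0 \<Longrightarrow> x = 0"
    and act_almost_translation: "finite {w. x + w \<noteq> act x w}"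
begin

lemma act_eq_0_iff [simp]: "act x w = 0 \<longleftrightarrow> w = 0"
  by (metis act_add act_base act_zero left_minus)

lemma act_op_one: "act_op act 1 \<xi> = \<xi>"
  by (simp add: act_op_def fun_eq_iff)

text \<open>Freeness makes each matrix entry of the action a single coefficient of \<open>f\<close>, or zero.\<close>

lemma act_op_delta:
  assumes "b \<noteq> 0 \<or> w \<noteq> 0"
  shows "(\<exists>\<alpha>. \<forall>f. act_op act f (delta b) w = lookup f \<alpha>) \<or> (\<forall>f. act_op act f (delta b) w = 0)"
proof (cases "\<exists>\<alpha>. act (- \<alpha>) w = b")
  case True
  then obtain \<alpha> where \<alpha>: "act (- \<alpha>) w = b" by blast
  have uniq: "\<beta> = \<alpha>" if "act (- \<beta>) w = b" for \<beta>
  proof -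
    have "act (\<beta> + - \<alpha>) w = w"
      unfolding act_add \<alpha> that[symmetric] by (simp flip: act_add)
    moreover have "w \<noteq> 0" using \<alpha> assms by auto
    ultimately have "\<beta> + - \<alpha> = 0" by (rule act_free)
    then show ?thesis by simp
  qed
  have "act_op act f (delta b) w = lookup f \<alpha>" for f
  proof -
    have "act_op act f (delta b) w = (\<Sum>\<beta>\<in>insert \<alpha> (keys f). lookup f \<beta> * delta b (act (- \<beta>) w))"
      by (rule act_op_superset) auto
    also have "\<dots> = (\<Sum>\<beta>\<in>insert \<alpha> (keys f). if \<beta> = \<alpha> then lookup f \<beta> else 0)"
    proof (intro sum.cong refl)
      fix \<beta>
      have "delta b (act (- \<beta>) w) = (if \<beta> = \<alpha> then 1 else 0)"
        unfolding delta_def using uniq[of \<beta>] \<alpha> by (cases "\<beta> = \<alpha>") auto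
      then show "lookup f \<beta> * delta b (act (- \<beta>) w) = (if \<beta> = \<alpha> then lookup f \<beta> else 0)" by simp
    qed
    finally show ?thesis by simp
  qed
  then show ?thesis by blast
next
  case False
  then have "act_op act f (delta b) w = 0" for f
    by (auto simp: act_op_def delta_def)
  then show ?thesis by blast
qed

text \<open>At the base point the action would contribute the sum of the coefficients of \<open>u\<close>, about which nothing
  is known.  It is replaced by the scalar \<open>-1\<close>, whose resolvent \<open>1 / (1 + t)\<close> is holomorphic on the
  annulus and inside the circle.\<close>

definition punctured_op :: "('g \<Rightarrow>\<^sub>0 complex) \<Rightarrow> ('g \<Rightarrow> complex) \<Rightarrow> 'g \<Rightarrow> complex" where
  "punctured_op u \<xi> w = (if w = 0 then - \<xi> 0 else act_op act u \<xi> w)"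

lemma linear_op_punctured_op: "linear_op (punctured_op u)"
  using linear_op_act_op[of act u]
  by (auto simp: linear_op_def punctured_op_def fun_eq_iff)

lemma punctured_op_funpow:
  "(punctured_op u ^^ k) \<xi> w = (if w = 0 then (-1) ^ k * \<xi> 0 else act_op act (u ^ k) \<xi> w)"
proof (induction k arbitrary: w)
  case 0
  then show ?case by (simp add: act_op_one)
next
  case (Suc k)
  have "act_op act u ((punctured_op u ^^ k) \<xi>) w = act_op act u (act_op act (u ^ k) \<xi>) w" if "w \<noteq> 0"
    unfolding act_op_def[of act u] using that by (simp add: Suc.IH)
  moreover have "(punctured_op u ^^ Suc k) \<xi> w = punctured_op u ((punctured_op u ^^ k) \<xi>) w" by simp
  ultimately show ?case
    unfolding punctured_op_def[of u "(punctured_op u ^^ k) \<xi>" w]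
    by (auto simp: Suc.IH act_op_mult[OF act_add])
qed

lemma finite_support_punctured_op:
  assumes "finite {w. \<xi> w \<noteq> 0}"
  shows "finite {w. punctured_op u \<xi> w \<noteq> 0}"
proof (rule finite_subset)
  show "{w. punctured_op u \<xi> w \<noteq> 0} \<subseteq> insert 0 (\<Union>\<alpha>\<in>keys u. act \<alpha> ` {w. \<xi> w \<noteq> 0})"
  proof
    fix w assume "w \<in> {w. punctured_op u \<xi> w \<noteq> 0}"
    then have w: "punctured_op u \<xi> w \<noteq> 0" by simp
    show "w \<in> insert 0 (\<Union>\<alpha>\<in>keys u. act \<alpha> ` {w. \<xi> w \<noteq> 0})"
    proof (cases "w = 0")
      case False
      with w have "act_op act u \<xi> w \<noteq> 0" by (simp add: punctured_op_def)
      then obtain \<alpha> where "\<alpha> \<in> keys u" "lookup u \<alpha> * \<xi> (act (- \<alpha>) w) \<noteq> 0"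
        unfolding act_op_def by (rule sum.not_neutral_contains_not_neutral)
      then have "\<alpha> \<in> keys u" "\<xi> (act (- \<alpha>) w) \<noteq> 0" by auto
      moreover have "w = act \<alpha> (act (- \<alpha>) w)" by (simp flip: act_add)
      ultimately show ?thesis by blast
    qed simp
  qed
  show "finite (insert 0 (\<Union>\<alpha>\<in>keys u. act \<alpha> ` {w. \<xi> w \<noteq> 0}))" using assms by simp
qed

text \<open>\<open>B\<close> has to contain the rows in which the two operators differ and the columns that these rows meet.\<close>

lemma translation_punctured_finite_rank:
  obtains B where "finite B"
    "\<And>\<xi> w. act_op (+) u \<xi> w = punctured_op u \<xi> w + (\<Sum>b\<in>B. \<Sum>c\<in>B. delta b w *
        (act_op (+) u (delta c) b - punctured_op u (delta c) b) * \<xi> c)"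
proof -
  define B1 where "B1 = insert 0 (\<Union>\<alpha>\<in>keys u. {w. - \<alpha> + w \<noteq> act (- \<alpha>) w})"
  define B where "B = B1 \<union> (\<Union>\<alpha>\<in>keys u. (\<lambda>w. - \<alpha> + w) ` B1 \<union> act (- \<alpha>) ` B1)"
  have fin1: "finite B1" unfolding B1_def using act_almost_translation by auto
  then have fin: "finite B" unfolding B_def by auto
  define r where "r b c = act_op (+) u (delta c) b - punctured_op u (delta c) b" for b c
  have off: "act_op (+) u \<xi> w = punctured_op u \<xi> w" if "w \<notin> B1" for \<xi> w
    using that unfolding punctured_op_def act_op_def B1_def by (auto intro!: sum.cong)
  have on: "act_op (+) u \<xi> w - punctured_op u \<xi> w = (\<Sum>c\<in>B. r w c * \<xi> c)" if w: "w \<in> B1" for \<xi> w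
  proof -
    define \<eta> where "\<eta> v = (if v \<in> B then \<xi> v else 0)" for v
    have mem: "- \<alpha> + w \<in> B" "act (- \<alpha>) w \<in> B" if "\<alpha> \<in> keys u" for \<alpha>
      using that w by (auto simp: B_def)
    have mem0: "0 \<in> B" by (simp add: B_def B1_def)
    have "act_op (+) u \<xi> w = act_op (+) u \<eta> w"
      unfolding act_op_def using mem by (intro sum.cong) (auto simp: \<eta>_def)
    moreover have "punctured_op u \<xi> w = punctured_op u \<eta> w"
      unfolding punctured_op_def act_op_def using mem mem0
      by (auto intro!: sum.cong simp: \<eta>_def)
    moreover have \<eta>: "\<eta> = (\<lambda>v. \<Sum>c\<in>B. delta c v * \<eta> c)"
      by (rule finite_support_expand[OF fin]) (simp add: \<eta>_def)
    have "act_op (+) u \<eta> w = (\<Sum>c\<in>B. act_op (+) u (delta c) w * \<eta> c)"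
      by (subst \<eta>) (simp only: linear_op_sum[OF linear_op_act_op] linear_op_scale[OF linear_op_act_op])
    moreover have "punctured_op u \<eta> w = (\<Sum>c\<in>B. punctured_op u (delta c) w * \<eta> c)"
      by (subst \<eta>) (simp only: linear_op_sum[OF linear_op_punctured_op] linear_op_scale[OF linear_op_punctured_op])
    ultimately have "act_op (+) u \<xi> w - punctured_op u \<xi> w = (\<Sum>c\<in>B. r w c * \<eta> c)"
      by (simp add: r_def sum_subtractf left_diff_distrib)
    also have "\<dots> = (\<Sum>c\<in>B. r w c * \<xi> c)" by (intro sum.cong) (auto simp: \<eta>_def)
    finally show ?thesis .
  qed
  have "act_op (+) u \<xi> w = punctured_op u \<xi> w + (\<Sum>b\<in>B. \<Sum>c\<in>B. delta b w * r b c * \<xi> c)" for \<xi> w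
  proof -
    have "(\<Sum>b\<in>B. \<Sum>c\<in>B. delta b w * r b c * \<xi> c) = (\<Sum>b\<in>B. if b = w then \<Sum>c\<in>B. r w c * \<xi> c else 0)"
      by (intro sum.cong) (auto simp: delta_def)
    also have "\<dots> = (if w \<in> B then \<Sum>c\<in>B. r w c * \<xi> c else 0)" using fin by auto
    also have "\<dots> = act_op (+) u \<xi> w - punctured_op u \<xi> w"
    proof (cases "w \<in> B1")
      case True
      then show ?thesis using on by (auto simp: B_def)
    next
      case False
      then show ?thesis using off by (simp add: r_def)
    qed
    finally show ?thesis by simp
  qed
  with fin show thesis using that unfolding r_def by blast
qed

text \<open>The integral of the generating function of the traces around the circle is a multiple of \<open>2 \<pi> \<i>\<close>, by
  the perturbation determinant, and equals \<open>- \<pi> \<i> (1 + s)\<close>, by termwise integration.  The bound on the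
  coefficients is what continues the resolvent entries to the annulus.\<close>

lemma trace_integrality:
  fixes u :: "'g \<Rightarrow>\<^sub>0 complex"
  defines "a \<equiv> 1 - u\<^sup>2"
  assumes \<delta>: "0 \<le> \<delta>" "\<delta> \<le> 1/50"
    and bound: "\<And>m. \<exists>M. \<forall>j x. cmod (lookup (u ^ m * a ^ j) x) \<le> M * \<delta> ^ j"
    and S: "(\<lambda>j. of_real (binom_coeff j) * lookup (u * a ^ j) 0) sums s"
  shows "(1 + s) / 2 \<in> \<int>"
proof -
  obtain B where B: "finite B" and UP: "\<And>\<xi> w. act_op (+) u \<xi> w = punctured_op u \<xi> w +
      (\<Sum>b\<in>B. \<Sum>c\<in>B. delta b w * (act_op (+) u (delta c) b - punctured_op u (delta c) b) * \<xi> c)"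
    using translation_punctured_finite_rank[of u] by blast
  define r where "r b c = act_op (+) u (delta c) b - punctured_op u (delta c) b" for b c
  note UP = UP[folded r_def]
  define T where "T k = lookup (u ^ k) 0 - (-1) ^ k" for k
  have tr: "(act_op (+) u ^^ k) (delta w) w - (punctured_op u ^^ k) (delta w) w = (if w = 0 then T k else 0)" for k w
  proof (cases "w = 0")
    case True
    then show ?thesis
      by (simp add: translation_op_funpow punctured_op_funpow translation_op_delta T_def) (simp add: delta_def)
  next
    case False
    have "act_op act (u ^ k) (delta w) w = lookup (u ^ k) 0"
    proof -
      have "act_op act (1 :: 'g \<Rightarrow>\<^sub>0 complex) (delta w) w = 1" by (simp add: act_op_one delta_def)
      then obtain \<alpha> where \<alpha>: "\<And>f. act_op act f (delta w) w = lookup f \<alpha>"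
        using act_op_delta[of w w] False by (metis zero_neq_one)
      have "\<alpha> = 0" using \<alpha>[of 1] by (auto simp: act_op_one delta_def lookup_one when_def split: if_splits)
      then show ?thesis using \<alpha> by simp
    qed
    then show ?thesis using False
      by (simp add: translation_op_funpow punctured_op_funpow translation_op_delta)
  qed
  obtain h where h: "bij_betw h {..<card B} B"
    using ex_bij_betw_nat_finite[OF B] by (auto simp: atLeast0LessThan)
  define n where "n = card B"
  have sum_h: "(\<Sum>b\<in>B. g b) = (\<Sum>i<n. g (h i))" for g :: "'g \<Rightarrow> complex"
    using sum.reindex_bij_betw[OF h, of g] by (simp add: n_def)
  define F where "F k i j = (punctured_op u ^^ k) (delta (h j)) (h i)" for k i j
  define V where "V k i j = (act_op (+) u ^^ k) (delta (h j)) (h i)" for k i j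
  \<comment> \<open>The resolvent of \<open>P\<close> is \<open>\<Sum>T\<^sub>k\<^sub>+\<^sub>1 t\<^sup>k\<close>; the term with \<open>j = 0\<close> is the contribution \<open>1 / (1 + t)\<close> of the base point\<close>
  define P where "P m j = lookup (u ^ Suc m * a ^ j) 0 + (if j = 0 then (-1) ^ m else 0)" for m j
  have u2: "u ^ (m + 2) * a ^ j = u ^ m * a ^ j - u ^ m * a ^ Suc j" for m j
  proof -
    have "u ^ (m + 2) * a ^ j = u ^ m * (u\<^sup>2 * a ^ j)" by (simp only: power_add mult.assoc)
    also have "u\<^sup>2 = 1 - a" by (simp add: a_def)
    finally show ?thesis by (simp add: algebra_simps)
  qed
  have indicator_bound: "\<exists>M. \<forall>j. cmod (if j = 0 then c else 0) \<le> M * \<delta> ^ j" for c :: complex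
    using \<delta>(1) by (intro exI[of _ "cmod c"]) (auto simp: power_0_left)
  have P_bound: "\<exists>M. \<forall>j. cmod (P m j) \<le> M * \<delta> ^ j" for m
  proof -
    obtain M where M: "\<forall>j x. cmod (lookup (u ^ Suc m * a ^ j) x) \<le> M * \<delta> ^ j" using bound by blast
    obtain N where N: "\<forall>j. cmod (if j = 0 then (-1) ^ m else 0) \<le> N * \<delta> ^ j" using indicator_bound by blast
    have "cmod (P m j) \<le> (M + N) * \<delta> ^ j" for j
      unfolding P_def distrib_right using M N by (intro norm_triangle_mono) auto
    then show ?thesis by blast
  qed
  have "\<exists>m :: int. contour_integral (circlepath 1 1) (resolvent P) = 2 * pi * \<i> * of_int m"
  proof (rule contour_integral_perturbation_trace[where n = n and r = "\<lambda>i j. r (h i) (h j)" and F = F and U = V and T = "\<lambda>k. T (Suc k)"])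
    show "V k i j = F k i j + (\<Sum>l<k. \<Sum>b<n. \<Sum>c<n. F l i b * r (h b) (h c) * V (k - 1 - l) c j)" for k i j
      unfolding V_def F_def
      by (subst funpow_perturbation[OF linear_op_punctured_op UP]) (simp only: sum_h)
    show "T (Suc k) = (\<Sum>b<n. \<Sum>c<n. r (h b) (h c) * (of_nat (k+1) * F k c b +
      (\<Sum>a<k. \<Sum>d<n. \<Sum>e<n. V a c d * r (h d) (h e) * (of_nat (k - a) * F (k - 1 - a) e b))))" for k
      unfolding V_def F_def
      by (subst trace_perturbation[OF linear_op_punctured_op linear_op_act_op finite_support_punctured_op B UP tr])
        (simp_all only: sum_h)
    show "\<exists>f. f holomorphic_on annulus \<and> f has_fps_expansion Abs_fps (\<lambda>k. F k i j)" for i j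
    proof (cases "h i = 0")
      case True
      define Q :: "nat \<Rightarrow> nat \<Rightarrow> complex" where "Q m j' = (if j' = 0 then (-1) ^ m * delta (h j) 0 else 0)" for m j'
      have 1: "\<exists>M. \<forall>j. cmod (Q m j) \<le> M * \<delta> ^ j" for m unfolding Q_def by (rule indicator_bound)
      have 2: "Q (m + 2) j' = Q m j' - Q m (Suc j')" for m j' by (simp add: Q_def)
      have "F k i j = Q k 0" for k using True by (simp add: F_def Q_def punctured_op_funpow)
      then show ?thesis using resolvent_has_fps_expansion[where P = Q, OF \<delta> 1 2] by auto
    next
      case False
      have F_eq: "F k i j = act_op act (u ^ k) (delta (h j)) (h i)" for k
        using False by (simp add: F_def punctured_op_funpow)
      consider \<alpha> where "\<And>f. act_op act f (delta (h j)) (h i) = lookup f \<alpha>" | "\<And>f. act_op act f (delta (h j)) (h i) = 0"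
        using act_op_delta[of "h j" "h i"] False by blast
      then show ?thesis
      proof cases
        case 1
        define Q where "Q m j' = lookup (u ^ m * a ^ j') \<alpha>" for m j'
        have b: "\<exists>M. \<forall>j. cmod (Q m j) \<le> M * \<delta> ^ j" for m unfolding Q_def using bound by blast
        have 2: "Q (m + 2) j' = Q m j' - Q m (Suc j')" for m j' unfolding Q_def u2 lookup_minus ..
        have "F k i j = Q k 0" for k by (simp add: F_eq 1 Q_def)
        then show ?thesis using resolvent_has_fps_expansion[where P = Q, OF \<delta> b 2] by auto
      next
        case 2
        then have "Abs_fps (\<lambda>k. F k i j) = 0" by (simp add: F_eq fps_eq_iff)
        then show ?thesis by (intro exI[of _ "\<lambda>_. 0"]) auto
      qed
    qed
    have 2: "P (m + 2) j = P m j - P m (Suc j)" for m j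
      using u2[of "Suc m" j] by (simp add: P_def lookup_minus)
    show "resolvent P holomorphic_on annulus" by (rule resolvent_has_fps_expansion(1)[where P = P, OF \<delta> P_bound 2])
    have "P k 0 = T (Suc k)" for k by (simp add: P_def T_def)
    then show "resolvent P has_fps_expansion Abs_fps (\<lambda>k. T (Suc k))"
      using resolvent_has_fps_expansion(2)[where P = P, OF \<delta> P_bound 2] by simp
  qed
  then obtain m :: int where m: "contour_integral (circlepath 1 1) (resolvent P) = 2 * pi * \<i> * of_int m" by blast
  obtain M where M: "\<And>j. cmod (P 0 j) \<le> M * \<delta> ^ j" "\<And>j. cmod (P 1 j) \<le> M * \<delta> ^ j"
    using common_geometric_bound[OF P_bound P_bound \<delta>(1)] by blast
  have sums: "(\<lambda>j. - (pi * \<i>) * ((-1) ^ j * ((-1/2) gchoose j) * P 0 j + P 1 j)) sums (2 * pi * \<i> * of_int m)"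
    using contour_integral_resolvent[OF \<delta> M] unfolding m .
  have s2: "(\<lambda>j. lookup (u ^ 2 * a ^ j) 0) sums 1"
    using lookup_geometric_series[of \<delta> u 0] \<delta> bound[of 0] by (auto simp: a_def)
  have c: "complex_of_real (binom_coeff j) = (-1) ^ j * ((-1/2) gchoose j)" for j
  proof -
    have "complex_of_real ((-1/2) gchoose j) = (of_real (-1/2) gchoose j)"
      by (simp add: gbinomial_prod_rev)
    then show ?thesis by (simp add: binom_coeff_def)
  qed
  have s0: "(\<lambda>j. if j = 0 then 1 else 0 :: complex) sums 1"
    using sums_single[of 0 "\<lambda>_. 1 :: complex"] by simp
  \<comment> \<open>The contributions of the base point cancel, because \<open>-1\<close> lies outside the circle\<close>
  have s3: "(\<lambda>j. - (pi * \<i>) * ((of_real (binom_coeff j) * lookup (u * a ^ j) 0 + (if j = 0 then 1 else 0)) +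
      (lookup (u ^ 2 * a ^ j) 0 - (if j = 0 then 1 else 0)))) sums (- (pi * \<i>) * ((s + 1) + (1 - 1)))"
    by (intro sums_mult sums_add sums_diff S s0 s2)
  have term_eq: "(of_real (binom_coeff j) * lookup (u * a ^ j) 0 + (if j = 0 then 1 else 0)) +
      (lookup (u ^ 2 * a ^ j) 0 - (if j = 0 then 1 else 0)) = (-1) ^ j * ((-1/2) gchoose j) * P 0 j + P 1 j" for j
    by (auto simp: c P_def numeral_2_eq_2 algebra_simps)
  have "2 * pi * \<i> * of_int m = - (pi * \<i>) * ((s + 1) + (1 - 1))"
    by (rule sums_unique2[OF sums s3[unfolded term_eq]])
  then have "(pi * \<i>) * (1 + s + 2 * of_int m) = 0" by (simp add: algebra_simps)
  then have "1 + s + 2 * of_int m = 0" by simp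
  then have "(1 + s) / 2 = of_int (- m)" by (simp add: field_simps eq_neg_iff_add_eq_0)
  then show ?thesis by (metis Ints_of_int)
qed

theorem sign_series_trivial:
  fixes u :: "'g \<Rightarrow>\<^sub>0 complex"
  defines "a \<equiv> 1 - u\<^sup>2"
  assumes \<delta>: "0 \<le> \<delta>" "\<delta> \<le> 1/50"
    and bound: "\<And>m. \<exists>M. \<forall>j. norm (ell2_of (u ^ m * a ^ j)) \<le> M * \<delta> ^ j"
  shows "(\<forall>x. (\<lambda>N. lookup (sign_series u N) x) \<longlonglongrightarrow> lookup 1 x) \<or>
    (\<forall>x. (\<lambda>N. lookup (sign_series u N) x) \<longlonglongrightarrow> lookup (- 1) x)"
proof -
  have bound': "\<exists>M. \<forall>j x. cmod (lookup (u ^ m * a ^ j) x) \<le> M * \<delta> ^ j" for m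
    using bound[of m] cmod_coef_le[of "ell2_of _"] unfolding ell2_of.rep_eq by (meson order_trans)
  define t where "t j = binom_coeff j *\<^sub>R ell2_of (u * a ^ j)" for j
  obtain M where M: "\<And>j. norm (ell2_of (u * a ^ j)) \<le> M * \<delta> ^ j"
    using bound[of 1] by auto
  have "norm (t j) \<le> M * \<delta> ^ j" for j
  proof -
    have "norm (t j) \<le> 1 * (M * \<delta> ^ j)"
      unfolding t_def norm_scaleR by (intro mult_mono abs_binom_coeff_le M) auto
    then show ?thesis by simp
  qed
  moreover have "summable (\<lambda>j. M * \<delta> ^ j)" using \<delta> by (intro summable_mult summable_geometric) simp
  ultimately have "summable t" by (intro summable_comparison_test'[of "\<lambda>j. M * \<delta> ^ j" 0 t])
  define S where "S = suminf t"
  have S: "t sums S" unfolding S_def using \<open>summable t\<close> by (rule summable_sums)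
  have part: "(\<Sum>j<N. t j) = ell2_of (sign_series u N)" for N
    by (rule ell2_eqI, induction N)
       (simp_all add: sign_series_def t_def ell2_of.rep_eq lookup_add lookup_single_mult a_def scaleR_conv_of_real)
  have lim: "(\<lambda>N. ell2_of (sign_series u N)) \<longlonglongrightarrow> S"
    using S unfolding sums_def part .
  interpret conv: bounded_bilinear "\<lambda>f g. conv f g x" for x :: 'g by (rule bounded_bilinear_conv)
  have SS: "conv S S x = coef (ket 0) x" for x
  proof -
    define \<psi> where "\<psi> m = lookup (u\<^sup>2 * a ^ m) x" for m
    obtain M where M: "\<And>j. cmod (\<psi> j) \<le> M * \<delta> ^ j" using bound'[of 2] unfolding \<psi>_def by blast
    have L: "\<psi> sums lookup 1 x"
      unfolding \<psi>_def a_def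
      by (rule lookup_geometric_series[of \<delta>]) (use \<delta> bound'[of 0] in \<open>auto simp: a_def\<close>)
    have comm: "a ^ i * u = u * a ^ i" for i
    proof (induction i)
      case (Suc i)
      have au: "a * u = u * a"
        by (simp add: a_def left_diff_distrib right_diff_distrib power2_eq_square mult.assoc)
      have "a ^ Suc i * u = a * (u * a ^ i)" by (simp add: mult.assoc Suc.IH)
      also have "\<dots> = u * a ^ Suc i" by (simp add: mult.assoc[symmetric] au)
      finally show ?case .
    qed simp
    have "conv (ell2_of (sign_series u N)) (ell2_of (sign_series u N)) x
      = (\<Sum>i<N. \<Sum>j<N. of_real (binom_coeff i * binom_coeff j) * \<psi> (i + j))" for N
    proof -
      have "conv (t i) (t j) x = of_real (binom_coeff i * binom_coeff j) * \<psi> (i + j)" for i j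
      proof -
        have "u * a ^ i * (u * a ^ j) = u * (a ^ i * u) * a ^ j" by (simp only: mult.assoc)
        also have "\<dots> = u\<^sup>2 * a ^ (i + j)" unfolding comm power2_eq_square power_add by (simp only: mult.assoc)
        finally show ?thesis
          by (simp add: t_def conv.scaleR_left conv.scaleR_right conv_ell2_of \<psi>_def scaleR_conv_of_real)
      qed
      then show ?thesis
        unfolding part[symmetric] by (simp add: conv.sum_left conv.sum_right, subst sum.swap, simp)
    qed
    note conv_eq = this
    have lim1: "(\<lambda>N. conv (ell2_of (sign_series u N)) (ell2_of (sign_series u N)) x) \<longlonglongrightarrow> conv S S x"
      by (intro conv.tendsto lim)
    have lim2: "(\<lambda>N. \<Sum>i<N. \<Sum>j<N. of_real (binom_coeff i * binom_coeff j) * \<psi> (i + j)) \<longlonglongrightarrow> lookup 1 x"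
      by (rule square_partial_sums_tendsto[OF abs_binom_coeff_le binom_coeff_conv \<delta>(1) _ M L]) (use \<delta> in simp)
    have "conv S S x = lookup 1 x" by (rule LIMSEQ_unique[OF lim1[unfolded conv_eq] lim2])
    then show ?thesis by (simp add: ket.rep_eq lookup_one when_def)
  qed
  define e where "e = (1/2) *\<^sub>R (ket 0 + S)"
  have "conv e e x = coef e x" for x
    by (simp add: e_def conv.scaleR_left conv.scaleR_right conv.add_left conv.add_right conv_ket_left
        conv_ket_right SS) (simp add: scaleR_conv_of_real field_simps)
  moreover have "coef e 0 \<in> \<int>"
  proof -
    have "(\<lambda>j. coef (t j) 0) sums coef S 0" by (rule bounded_linear.sums[OF bounded_linear_coef S])
    then have "(\<lambda>j. of_real (binom_coeff j) * lookup (u * a ^ j) 0) sums coef S 0"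
      by (simp add: t_def ell2_of.rep_eq scaleR_conv_of_real)
    then have "(1 + coef S 0) / 2 \<in> \<int>"
      using trace_integrality[OF \<delta>, of u] bound' by (simp add: a_def)
    then show ?thesis by (simp add: e_def ket.rep_eq scaleR_conv_of_real)
  qed
  ultimately consider "e = 0" | "e = ket 0" using ell2_convolution_idempotent by blast
  then have "S = - ket 0 \<or> S = ket 0"
  proof cases
    case 1
    then have "ket 0 + S = 0" by (simp add: e_def)
    then show ?thesis by (simp add: eq_neg_iff_add_eq_0 add.commute)
  next
    case 2
    then have "2 *\<^sub>R e = 2 *\<^sub>R ket 0" by simp
    then have "ket 0 + S = ket 0 + ket 0" by (simp add: e_def scaleR_2)
    then show ?thesis by simp
  qed
  moreover have "(\<lambda>N. lookup (sign_series u N) x) \<longlonglongrightarrow> coef S x" for x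
    using bounded_linear.tendsto[OF bounded_linear_coef lim] by (simp add: ell2_of.rep_eq)
  moreover have "coef (ket 0) = lookup 1"
    by (simp add: ket.rep_eq lookup_one when_def fun_eq_iff)
  ultimately show ?thesis by (metis coef_simps(3) lookup_uminus)
qed

end

section \<open>Norm bounds for sequences\<close>

text \<open>Convexity on the open half-line, extended to the boundary point \<open>0\<close>.\<close>

lemma powr_convex_nonneg:
  fixes x y \<theta> P :: real
  assumes P: "1 \<le> P" and x: "0 \<le> x" and y: "0 \<le> y" and \<theta>: "0 \<le> \<theta>" "\<theta> \<le> 1"
  shows "((1 - \<theta>) * x + \<theta> * y) powr P \<le> (1 - \<theta>) * x powr P + \<theta> * y powr P"
proof -
  have scale: "(t * z) powr P \<le> t * z powr P" if "0 \<le> t" "t \<le> 1" "0 \<le> z" for t z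
  proof -
    have "t powr P \<le> t"
      using powr_mono'[of 1 P t] P that by (cases "t = 0") auto
    then show ?thesis using that by (simp add: powr_mult mult_right_mono)
  qed
  consider "x = 0" | "y = 0" | "x > 0" "y > 0" using x y by linarith
  then show ?thesis
  proof cases
    case 1
    then show ?thesis using scale[of \<theta> y] \<theta> y by simp
  next
    case 2
    then show ?thesis using scale[of "1 - \<theta>" x] \<theta> x by simp
  next
    case 3
    then show ?thesis
      using convex_onD[OF powr_convex[OF P], of \<theta> x y] \<theta> by simp
  qed
qed

text \<open>Write \<open>(f + g) / (a + b)\<close> as a convex combination of \<open>f / a\<close> and \<open>g / b\<close>.\<close>

lemma Minkowski_finite:
  fixes f g :: "'a \<Rightarrow> complex"
  assumes P: "1 \<le> P" and Y: "finite Y" and a: "0 \<le> a" and b: "0 \<le> b"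
    and f: "(\<Sum>x\<in>Y. cmod (f x) powr P) \<le> a powr P" and g: "(\<Sum>x\<in>Y. cmod (g x) powr P) \<le> b powr P"
  shows "(\<Sum>x\<in>Y. cmod (f x + g x) powr P) \<le> (a + b) powr P"
proof -
  have vanish: "h x = 0" if "(\<Sum>x\<in>Y. cmod (h x) powr P) \<le> 0 powr P" "x \<in> Y" for h :: "'a \<Rightarrow> complex" and x
  proof -
    have "(\<Sum>x\<in>Y. cmod (h x) powr P) = 0"
      using that(1) P by (simp add: order_antisym sum_nonneg)
    then show ?thesis using Y that(2) by (simp add: sum_nonneg_eq_0_iff)
  qed
  show ?thesis
  proof (cases "a = 0 \<or> b = 0")
    case True
    then show ?thesis
    proof
      assume "a = 0"
      then have "(\<Sum>x\<in>Y. cmod (f x + g x) powr P) = (\<Sum>x\<in>Y. cmod (g x) powr P)"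
      proof (intro sum.cong refl)
        fix x assume "x \<in> Y"
        then have "f x = 0" using f unfolding \<open>a = 0\<close> by (rule vanish[rotated])
        then show "cmod (f x + g x) powr P = cmod (g x) powr P" by simp
      qed
      then show ?thesis using g \<open>a = 0\<close> by simp
    next
      assume "b = 0"
      then have "(\<Sum>x\<in>Y. cmod (f x + g x) powr P) = (\<Sum>x\<in>Y. cmod (f x) powr P)"
      proof (intro sum.cong refl)
        fix x assume "x \<in> Y"
        then have "g x = 0" using g unfolding \<open>b = 0\<close> by (rule vanish[rotated])
        then show "cmod (f x + g x) powr P = cmod (f x) powr P" by simp
      qed
      then show ?thesis using f \<open>b = 0\<close> by simp
    qed
  next
    case False
    then have pos: "a > 0" "b > 0" using a b by auto
    define \<theta> where "\<theta> = b / (a + b)"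
    have \<theta>: "0 \<le> \<theta>" "\<theta> \<le> 1" "1 - \<theta> = a / (a + b)" using pos by (auto simp: \<theta>_def field_simps)
    have "cmod (f x + g x) powr P \<le> (a + b) powr P * ((1 - \<theta>) * (cmod (f x) powr P / a powr P) + \<theta> * (cmod (g x) powr P / b powr P))" for x
    proof -
      have "cmod (f x + g x) \<le> (a + b) * ((1 - \<theta>) * (cmod (f x) / a) + \<theta> * (cmod (g x) / b))"
      proof -
        have "(a + b) * (a / (a + b) * (y / a) + b / (a + b) * (z / b)) = y + z" for y z
          using pos by (simp add: distrib_left)
        then show ?thesis
          using norm_triangle_ineq[of "f x" "g x"] unfolding \<theta>(3) by (simp add: \<theta>_def)
      qed
      then have "cmod (f x + g x) powr P \<le> ((a + b) * ((1 - \<theta>) * (cmod (f x) / a) + \<theta> * (cmod (g x) / b))) powr P"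
        using P by (intro powr_mono2) auto
      also have "\<dots> = (a + b) powr P * ((1 - \<theta>) * (cmod (f x) / a) + \<theta> * (cmod (g x) / b)) powr P"
        using pos \<theta> by (intro powr_mult)
      also have "\<dots> \<le> (a + b) powr P * ((1 - \<theta>) * (cmod (f x) / a) powr P + \<theta> * (cmod (g x) / b) powr P)"
        using P \<theta> pos by (intro mult_left_mono powr_convex_nonneg) auto
      finally show ?thesis using pos by (simp add: powr_divide)
    qed
    then have "(\<Sum>x\<in>Y. cmod (f x + g x) powr P) \<le>
      (\<Sum>x\<in>Y. (a + b) powr P * ((1 - \<theta>) * (cmod (f x) powr P / a powr P) + \<theta> * (cmod (g x) powr P / b powr P)))"
      by (rule sum_mono)
    also have "\<dots> = (a + b) powr P * ((1 - \<theta>) * ((\<Sum>x\<in>Y. cmod (f x) powr P) / a powr P) + \<theta> * ((\<Sum>x\<in>Y. cmod (g x) powr P) / b powr P))"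
      by (simp only: sum_distrib_left[symmetric] sum.distrib sum_divide_distrib)
    also have "\<dots> \<le> (a + b) powr P * ((1 - \<theta>) * 1 + \<theta> * 1)"
      using f g pos \<theta> by (intro mult_left_mono add_mono) (auto simp: divide_le_eq_1)
    finally show ?thesis by simp
  qed
qed

text \<open>The norm bound \<open>\<parallel>\<xi>\<parallel>\<^sub>p \<le> c\<close>, stated through finite partial sums so that it passes to pointwise limits
  and can be tested locally, for finite and infinite \<open>p\<close> alike.\<close>

definition lp_le :: "ennreal \<Rightarrow> 'a set \<Rightarrow> real \<Rightarrow> ('a \<Rightarrow> complex) \<Rightarrow> bool" where
  "lp_le p X c \<xi> \<longleftrightarrow> 0 \<le> c \<and> (\<forall>x. x \<notin> X \<longrightarrow> \<xi> x = 0) \<and>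
     (if p = \<infinity> then \<forall>x. cmod (\<xi> x) \<le> c
      else \<forall>Y. finite Y \<longrightarrow> (\<Sum>x\<in>Y. cmod (\<xi> x) powr enn2real p) \<le> c powr enn2real p)"

lemma enn2real_ge_1: "1 \<le> p \<Longrightarrow> p \<noteq> \<infinity> \<Longrightarrow> 1 \<le> enn2real p"
  by (metis enn2real_1 enn2real_mono infinity_ennreal_def less_top)

lemma lp_le_infinite_iff:
  "p = \<infinity> \<Longrightarrow> lp_le p X c \<xi> \<longleftrightarrow> 0 \<le> c \<and> (\<forall>x. x \<notin> X \<longrightarrow> \<xi> x = 0) \<and> (\<forall>x. cmod (\<xi> x) \<le> c)"
  by (simp only: lp_le_def if_True simp_thms)

lemma lp_le_finite_iff:
  "p \<noteq> \<infinity> \<Longrightarrow> lp_le p X c \<xi> \<longleftrightarrow> 0 \<le> c \<and> (\<forall>x. x \<notin> X \<longrightarrow> \<xi> x = 0) \<and>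
     (\<forall>Y. finite Y \<longrightarrow> (\<Sum>x\<in>Y. cmod (\<xi> x) powr enn2real p) \<le> c powr enn2real p)"
  by (simp only: lp_le_def if_False simp_thms)

lemma lp_le_iff_norm:
  assumes p: "1 \<le> p" and X: "X \<noteq> {}"
  shows "lp_le p X c \<xi> \<longleftrightarrow> 0 \<le> c \<and> \<xi> \<in> lp_space p X \<and> lp_norm p X \<xi> \<le> c"
proof (cases "p = \<infinity>")
  case True
  show ?thesis
  proof
    assume l: "lp_le p X c \<xi>"
    then have b: "\<And>x. cmod (\<xi> x) \<le> c" by (simp add: lp_le_infinite_iff[OF True])
    then have "bounded (\<xi> ` X)" by (auto simp: bounded_iff)
    moreover have "(SUP x\<in>X. norm (\<xi> x)) \<le> c" using X b by (intro cSUP_least)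
    ultimately show "0 \<le> c \<and> \<xi> \<in> lp_space p X \<and> lp_norm p X \<xi> \<le> c"
      using l by (simp add: lp_le_infinite_iff[OF True]) (simp add: lp_space_def lp_norm_def True)
  next
    assume r: "0 \<le> c \<and> \<xi> \<in> lp_space p X \<and> lp_norm p X \<xi> \<le> c"
    then have z: "\<forall>x. x \<notin> X \<longrightarrow> \<xi> x = 0" and "bounded (\<xi> ` X)" and s: "(SUP x\<in>X. norm (\<xi> x)) \<le> c"
      by (simp_all add: lp_space_def lp_norm_def True)
    then have "bdd_above ((\<lambda>x. norm (\<xi> x)) ` X)" by (auto simp: bounded_iff bdd_above_def)
    then have "cmod (\<xi> x) \<le> c" if "x \<in> X" for x using cSUP_upper[OF that] s by (meson order_trans)
    then show "lp_le p X c \<xi>" using r z by (force simp: lp_le_infinite_iff[OF True])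
  qed
next
  case False
  define P where "P = enn2real p"
  have P: "1 \<le> P" using enn2real_ge_1[OF p False] by (simp add: P_def)
  show ?thesis
  proof
    assume l: "lp_le p X c \<xi>"
    then have b: "\<And>Y. finite Y \<Longrightarrow> (\<Sum>x\<in>Y. cmod (\<xi> x) powr P) \<le> c powr P" and c: "0 \<le> c"
      by (simp_all add: lp_le_finite_iff[OF False] P_def)
    have s: "(\<lambda>x. norm (\<xi> x) powr P) summable_on X"
      by (rule nonneg_bdd_above_summable_on) (auto intro!: bdd_aboveI2 b)
    have "infsum (\<lambda>x. norm (\<xi> x) powr P) X \<le> c powr P"
      by (rule infsum_le_finite_sums[OF s]) (use b in auto)
    then have "infsum (\<lambda>x. norm (\<xi> x) powr P) X powr (1 / P) \<le> (c powr P) powr (1 / P)"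
      using P by (intro powr_mono2 infsum_nonneg) auto
    then have "infsum (\<lambda>x. norm (\<xi> x) powr P) X powr (1 / P) \<le> c"
      using c P by (simp add: powr_powr)
    then show "0 \<le> c \<and> \<xi> \<in> lp_space p X \<and> lp_norm p X \<xi> \<le> c"
      using l s False by (simp add: lp_le_finite_iff[OF False]) (simp add: lp_space_def lp_norm_def P_def)
  next
    assume r: "0 \<le> c \<and> \<xi> \<in> lp_space p X \<and> lp_norm p X \<xi> \<le> c"
    then have z: "\<forall>x. x \<notin> X \<longrightarrow> \<xi> x = 0" and s: "(\<lambda>x. norm (\<xi> x) powr P) summable_on X"
      and n: "infsum (\<lambda>x. norm (\<xi> x) powr P) X powr (1 / P) \<le> c"
      using False by (simp_all add: lp_space_def lp_norm_def P_def)
    have "infsum (\<lambda>x. norm (\<xi> x) powr P) X = (infsum (\<lambda>x. norm (\<xi> x) powr P) X powr (1 / P)) powr P"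
      using P by (simp add: powr_powr infsum_nonneg)
    also have "\<dots> \<le> c powr P" using n P by (intro powr_mono2) auto
    finally have I: "infsum (\<lambda>x. norm (\<xi> x) powr P) X \<le> c powr P" .
    have "(\<Sum>x\<in>Y. cmod (\<xi> x) powr P) \<le> c powr P" if Y: "finite Y" for Y
    proof -
      have "(\<Sum>x\<in>Y. cmod (\<xi> x) powr P) = (\<Sum>x\<in>Y \<inter> X. cmod (\<xi> x) powr P)"
        using Y z P by (intro sum.mono_neutral_right) auto
      also have "\<dots> \<le> infsum (\<lambda>x. norm (\<xi> x) powr P) X"
        using Y by (intro finite_sum_le_infsum[OF s]) auto
      finally show ?thesis using I by simp
    qed
    then show "lp_le p X c \<xi>" using r z by (simp add: lp_le_finite_iff[OF False] P_def)
  qed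
qed

lemma lp_le_nonneg: "lp_le p X c \<xi> \<Longrightarrow> 0 \<le> c"
  and lp_le_outside: "lp_le p X c \<xi> \<Longrightarrow> x \<notin> X \<Longrightarrow> \<xi> x = 0"
  by (simp_all add: lp_le_def)

lemma powr_le_imp_le: "0 < P \<Longrightarrow> 0 \<le> c \<Longrightarrow> x powr P \<le> c powr P \<Longrightarrow> x \<le> c"
  for x c P :: real
  by (metis linorder_not_le powr_less_mono2)

lemma lp_le_pointwise:
  assumes p: "1 \<le> p" and l: "lp_le p X c \<xi>"
  shows "cmod (\<xi> x) \<le> c"
proof (cases "p = \<infinity>")
  case False
  define P where "P = enn2real p"
  have P: "1 \<le> P" using enn2real_ge_1[OF p False] by (simp add: P_def)
  have "(\<Sum>x\<in>{x}. cmod (\<xi> x) powr P) \<le> c powr P"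
    using l unfolding lp_le_finite_iff[OF False] P_def by blast
  then have le: "cmod (\<xi> x) powr P \<le> c powr P" by simp
  show ?thesis by (rule powr_le_imp_le[OF _ lp_le_nonneg[OF l] le]) (use P in simp)
next
  case True
  show ?thesis using l unfolding lp_le_infinite_iff[OF True] by blast
qed

lemma lp_le_mono:
  assumes "1 \<le> p" "lp_le p X c \<xi>" "c \<le> d"
  shows "lp_le p X d \<xi>"
proof -
  have c: "0 \<le> c" using assms(2) by (rule lp_le_nonneg)
  have "c powr enn2real p \<le> d powr enn2real p" if "p \<noteq> \<infinity>"
    using assms c enn2real_ge_1[OF assms(1) that] by (intro powr_mono2) auto
  note powr_le = this
  show ?thesis
  proof (cases "p = \<infinity>")
    case True
    show ?thesis using assms(2,3) c unfolding lp_le_infinite_iff[OF True] by (meson order_trans)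
  next
    case False
    show ?thesis using assms(2,3) c powr_le[OF False] unfolding lp_le_finite_iff[OF False]
      by (meson order_trans)
  qed
qed

lemma lp_le_add:
  assumes p: "1 \<le> p" and f: "lp_le p X a f" and g: "lp_le p X b g"
  shows "lp_le p X (a + b) (\<lambda>x. f x + g x)"
proof (cases "p = \<infinity>")
  case True
  then show ?thesis using f g by (auto simp: lp_le_infinite_iff intro: norm_triangle_mono)
next
  case False
  show ?thesis
    using f g unfolding lp_le_finite_iff[OF False]
    by (intro conjI allI impI Minkowski_finite[OF enn2real_ge_1[OF p False]]) auto
qed

lemma lp_le_scale:
  assumes p: "1 \<le> p" and f: "lp_le p X a f"
  shows "lp_le p X (cmod c * a) (\<lambda>x. c * f x)"
proof (cases "p = \<infinity>")
  case True
  then show ?thesis using f by (auto simp: lp_le_infinite_iff norm_mult intro: mult_left_mono)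
next
  case False
  have "(\<Sum>x\<in>Y. cmod (c * f x) powr enn2real p) \<le> (cmod c * a) powr enn2real p" if "finite Y" for Y
  proof -
    have "(\<Sum>x\<in>Y. cmod (c * f x) powr enn2real p) = cmod c powr enn2real p * (\<Sum>x\<in>Y. cmod (f x) powr enn2real p)"
      by (simp add: norm_mult powr_mult sum_distrib_left)
    also have "\<dots> \<le> cmod c powr enn2real p * a powr enn2real p"
      using f that unfolding lp_le_finite_iff[OF False] by (intro mult_left_mono) auto
    also have "\<dots> = (cmod c * a) powr enn2real p"
      using lp_le_nonneg[OF f] by (simp add: powr_mult)
    finally show ?thesis .
  qed
  then show ?thesis using f unfolding lp_le_finite_iff[OF False] by auto
qed

lemma lp_le_diff:
  assumes "1 \<le> p" "lp_le p X a f" "lp_le p X b g"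
  shows "lp_le p X (a + b) (\<lambda>x. f x - g x)"
  using lp_le_add[OF assms(1,2) lp_le_scale[OF assms(1,3), of "-1"]] by simp

text \<open>Used to replace a sequence by a truncation on which convolution is a finite sum.\<close>

lemma lp_le_local:
  assumes "0 \<le> c" "\<And>x. x \<notin> X \<Longrightarrow> \<xi> x = 0"
    and "\<And>Y. finite Y \<Longrightarrow> \<exists>\<eta>. lp_le p X c \<eta> \<and> (\<forall>x\<in>Y. \<eta> x = \<xi> x)"
  shows "lp_le p X c \<xi>"
proof (cases "p = \<infinity>")
  case True
  have "cmod (\<xi> x) \<le> c" for x
  proof -
    obtain \<eta> where "lp_le p X c \<eta>" "\<eta> x = \<xi> x" using assms(3)[of "{x}"] by auto
    then show ?thesis unfolding lp_le_infinite_iff[OF True] by metis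
  qed
  then show ?thesis using assms True by (simp add: lp_le_infinite_iff)
next
  case False
  have "(\<Sum>x\<in>Y. cmod (\<xi> x) powr enn2real p) \<le> c powr enn2real p" if Y: "finite Y" for Y
  proof -
    obtain \<eta> where \<eta>: "lp_le p X c \<eta>" "\<forall>x\<in>Y. \<eta> x = \<xi> x" using assms(3)[OF Y] by blast
    then have "(\<Sum>x\<in>Y. cmod (\<xi> x) powr enn2real p) = (\<Sum>x\<in>Y. cmod (\<eta> x) powr enn2real p)"
      by (intro sum.cong) auto
    then show ?thesis using \<eta>(1) Y by (simp add: lp_le_finite_iff[OF False])
  qed
  then show ?thesis using assms by (simp add: lp_le_finite_iff[OF False])
qed

lemma lp_le_LIMSEQ:
  assumes p: "1 \<le> p" and lim: "\<And>x. (\<lambda>n. \<xi> n x) \<longlonglongrightarrow> \<eta> x" and l: "\<And>n. lp_le p X c (\<xi> n)"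
  shows "lp_le p X c \<eta>"
proof -
  have "\<eta> x = 0" if "x \<notin> X" for x
  proof -
    have "(\<lambda>n. 0) \<longlonglongrightarrow> \<eta> x" using lim[of x] lp_le_outside[OF l that] by simp
    then show ?thesis by (simp add: LIMSEQ_const_iff)
  qed
  moreover have "0 \<le> c" using lp_le_nonneg[OF l] .
  moreover have "cmod (\<eta> x) \<le> c" if "p = \<infinity>" for x
    by (rule LIMSEQ_le_const2[OF tendsto_norm[OF lim]]) (use l that in \<open>auto simp: lp_le_infinite_iff\<close>)
  moreover have "(\<Sum>x\<in>Y. cmod (\<eta> x) powr enn2real p) \<le> c powr enn2real p" if "p \<noteq> \<infinity>" "finite Y" for Y
  proof (rule LIMSEQ_le_const2)
    have "(\<lambda>n. cmod (\<xi> n x) powr enn2real p) \<longlonglongrightarrow> cmod (\<eta> x) powr enn2real p" for x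
      by (rule tendsto_powr'[OF tendsto_norm[OF lim] tendsto_const])
        (use enn2real_ge_1[OF p that(1)] in simp)
    then show "(\<lambda>n. \<Sum>x\<in>Y. cmod (\<xi> n x) powr enn2real p) \<longlonglongrightarrow> (\<Sum>x\<in>Y. cmod (\<eta> x) powr enn2real p)"
      by (intro tendsto_sum)
    show "\<exists>N. \<forall>n\<ge>N. (\<Sum>x\<in>Y. cmod (\<xi> n x) powr enn2real p) \<le> c powr enn2real p"
      using l that(2) by (simp add: lp_le_finite_iff[OF that(1)])
  qed
  ultimately show ?thesis
    by (cases "p = \<infinity>") (simp_all add: lp_le_infinite_iff lp_le_finite_iff)
qed

lemma lp_le_truncate:
  assumes "1 \<le> p" "lp_le p X c \<xi>"
  shows "lp_le p X c (\<lambda>x. if x \<in> A then \<xi> x else 0)"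
proof -
  have le: "cmod (if x \<in> A then \<xi> x else 0) \<le> cmod (\<xi> x)" for x by simp
  have "(\<Sum>x\<in>Y. cmod (if x \<in> A then \<xi> x else 0) powr enn2real p) \<le> (\<Sum>x\<in>Y. cmod (\<xi> x) powr enn2real p)"
    if "p \<noteq> \<infinity>" for Y
    using enn2real_ge_1[OF assms(1) that] by (intro sum_mono powr_mono2 le) auto
  then show ?thesis using assms(2)
    by (cases "p = \<infinity>") (auto simp: lp_le_infinite_iff lp_le_finite_iff intro: order_trans[OF le] order_trans)
qed

lemma lp_le_compose:
  assumes \<pi>: "inj_on \<pi> Z" and l: "lp_le p X c \<xi>"
  shows "lp_le p Z c (\<lambda>x. if x \<in> Z then \<xi> (\<pi> x) else 0)"
proof (cases "p = \<infinity>")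
  case True
  show ?thesis using l unfolding lp_le_infinite_iff[OF True] by auto
next
  case False
  have le: "(\<Sum>x\<in>Y. cmod (\<xi> x) powr enn2real p) \<le> c powr enn2real p" if "finite Y" for Y
    using l that unfolding lp_le_finite_iff[OF False] by simp
  have "(\<Sum>x\<in>Y. cmod (if x \<in> Z then \<xi> (\<pi> x) else 0) powr enn2real p) \<le> c powr enn2real p" if Y: "finite Y" for Y
  proof -
    have "(\<Sum>x\<in>Y. cmod (if x \<in> Z then \<xi> (\<pi> x) else 0) powr enn2real p) = (\<Sum>x\<in>Y \<inter> Z. cmod (\<xi> (\<pi> x)) powr enn2real p)"
      using Y by (intro sum.mono_neutral_cong_right) auto
    also have "\<dots> = (\<Sum>x\<in>\<pi> ` (Y \<inter> Z). cmod (\<xi> x) powr enn2real p)"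
      using \<pi> by (simp add: sum.reindex inj_on_subset)
    also have "\<dots> \<le> c powr enn2real p"
      using Y by (intro le) simp
    finally show ?thesis .
  qed
  then show ?thesis using lp_le_nonneg[OF l] unfolding lp_le_finite_iff[OF False] by simp
qed

text \<open>The norm of \<open>\<ell>\<^sup>r\<close> decreases in \<open>r\<close>, as each entry is bounded by the norm.\<close>

lemma lp_le_comparison_2:
  fixes \<xi> :: "'a \<Rightarrow> complex"
  assumes A: "finite A" "\<And>x. x \<notin> A \<Longrightarrow> \<xi> x = 0" and n: "0 \<le> n" and P: "1 \<le> P"
  shows "P \<le> 2 \<Longrightarrow> (\<Sum>x\<in>A. cmod (\<xi> x) powr P) \<le> n powr P \<Longrightarrow> (\<Sum>x\<in>A. (cmod (\<xi> x))\<^sup>2) \<le> n\<^sup>2"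
    and "2 \<le> P \<Longrightarrow> (\<Sum>x\<in>A. (cmod (\<xi> x))\<^sup>2) \<le> n\<^sup>2 \<Longrightarrow> (\<Sum>x\<in>A. cmod (\<xi> x) powr P) \<le> n powr P"
proof -
  have gen: "(\<Sum>x\<in>A. cmod (\<xi> x) powr s) \<le> n powr s"
    if r: "1 \<le> r" "r \<le> s" and le: "(\<Sum>x\<in>A. cmod (\<xi> x) powr r) \<le> n powr r" for r s
  proof -
    have pt: "cmod (\<xi> x) \<le> n" if "x \<in> A" for x
    proof -
      have le': "cmod (\<xi> x) powr r \<le> (\<Sum>x\<in>A. cmod (\<xi> x) powr r)"
        using A that by (intro member_le_sum) auto
      show ?thesis by (rule powr_le_imp_le[OF _ n order_trans[OF le' le]]) (use r in auto)
    qed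
    have "(\<Sum>x\<in>A. cmod (\<xi> x) powr s) \<le> (\<Sum>x\<in>A. cmod (\<xi> x) powr r * n powr (s - r))"
    proof (rule sum_mono)
      fix x assume x: "x \<in> A"
      have "cmod (\<xi> x) powr s = cmod (\<xi> x) powr r * cmod (\<xi> x) powr (s - r)"
        by (simp flip: powr_add)
      also have "\<dots> \<le> cmod (\<xi> x) powr r * n powr (s - r)"
        using pt[OF x] r by (intro mult_left_mono powr_mono2) auto
      finally show "cmod (\<xi> x) powr s \<le> cmod (\<xi> x) powr r * n powr (s - r)" .
    qed
    also have "\<dots> = (\<Sum>x\<in>A. cmod (\<xi> x) powr r) * n powr (s - r)" by (simp add: sum_distrib_right)
    also have "\<dots> \<le> n powr r * n powr (s - r)" using le by (intro mult_right_mono) auto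
    also have "\<dots> = n powr s" by (simp flip: powr_add)
    finally show ?thesis .
  qed
  have two: "z powr 2 = z\<^sup>2" if "0 \<le> z" for z :: real using that by simp
  show "(\<Sum>x\<in>A. (cmod (\<xi> x))\<^sup>2) \<le> n\<^sup>2" if "P \<le> 2" "(\<Sum>x\<in>A. cmod (\<xi> x) powr P) \<le> n powr P"
    using gen[OF P that] n by simp
  show "(\<Sum>x\<in>A. cmod (\<xi> x) powr P) \<le> n powr P" if "2 \<le> P" "(\<Sum>x\<in>A. (cmod (\<xi> x))\<^sup>2) \<le> n\<^sup>2"
    using gen[of 2 P] that n by simp
qed

section \<open>Convolution operators on sequence spaces\<close>

definition conv_bound :: "ennreal \<Rightarrow> 'g::group_add set \<Rightarrow> real \<Rightarrow> ('g \<Rightarrow>\<^sub>0 complex) \<Rightarrow> bool" where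
  "conv_bound p H c f \<longleftrightarrow> 0 \<le> c \<and> (\<forall>\<xi> b. lp_le p H b \<xi> \<longrightarrow> lp_le p H (c * b) (act_op (+) f \<xi>))"

lemma conv_boundI:
  "0 \<le> c \<Longrightarrow> (\<And>\<xi> b. lp_le p H b \<xi> \<Longrightarrow> lp_le p H (c * b) (act_op (+) f \<xi>)) \<Longrightarrow> conv_bound p H c f"
  and conv_boundD: "conv_bound p H c f \<Longrightarrow> lp_le p H b \<xi> \<Longrightarrow> lp_le p H (c * b) (act_op (+) f \<xi>)"
  by (simp_all add: conv_bound_def)

lemma act_op_add: "act_op act (f + g) \<xi> w = act_op act f \<xi> w + act_op act g \<xi> w"
proof -
  have K: "finite (keys f \<union> keys g)" "keys (f + g) \<subseteq> keys f \<union> keys g"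
    using Poly_Mapping.keys_add[of f g] by auto
  show ?thesis
    by (simp add: act_op_superset[OF K] act_op_superset[OF K(1), of f] act_op_superset[OF K(1), of g]
        lookup_add distrib_right sum.distrib)
qed

lemma act_op_scale: "act_op act (Poly_Mapping.single 0 c * f) \<xi> w = c * act_op act f \<xi> w"
proof -
  have K: "keys (Poly_Mapping.single 0 c * f) \<subseteq> keys f"
    by (auto simp: in_keys_iff lookup_single_mult)
  show ?thesis
    by (simp add: act_op_superset[OF _ K] act_op_def[of act f] lookup_single_mult sum_distrib_left mult.assoc)
qed

lemma act_op_uminus: "act_op act (- f) \<xi> w = - act_op act f \<xi> w"
  by (simp add: act_op_def sum_negf)

lemma act_op_diff: "act_op act (f - g) \<xi> w = act_op act f \<xi> w - act_op act g \<xi> w"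
  using act_op_add[of act f "- g"] by (simp add: act_op_uminus)

lemma act_op_mult_plus: "act_op (+) (f * g) \<xi> = act_op (+) f (act_op (+) g \<xi>)"
  by (rule act_op_mult) (rule add.assoc)

context
  fixes p :: ennreal and H :: "'g::group_add set"
  assumes p: "1 \<le> p"
begin

lemma conv_bound_add:
  assumes "conv_bound p H c f" "conv_bound p H d g"
  shows "conv_bound p H (c + d) (f + g)"
proof (rule conv_boundI)
  show "lp_le p H ((c + d) * b) (act_op (+) (f + g) \<xi>)" if "lp_le p H b \<xi>" for \<xi> b
    using lp_le_add[OF p conv_boundD[OF assms(1) that] conv_boundD[OF assms(2) that]]
    by (simp add: act_op_add[abs_def] distrib_right)
qed (use assms in \<open>simp add: conv_bound_def\<close>)

lemma conv_bound_diff: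
  assumes "conv_bound p H c f" "conv_bound p H d g"
  shows "conv_bound p H (c + d) (f - g)"
proof (rule conv_boundI)
  show "lp_le p H ((c + d) * b) (act_op (+) (f - g) \<xi>)" if "lp_le p H b \<xi>" for \<xi> b
    using lp_le_diff[OF p conv_boundD[OF assms(1) that] conv_boundD[OF assms(2) that]]
    by (simp add: act_op_diff[abs_def] distrib_right)
qed (use assms in \<open>simp add: conv_bound_def\<close>)

lemma conv_bound_scale:
  assumes "conv_bound p H c f"
  shows "conv_bound p H (cmod z * c) (Poly_Mapping.single 0 z * f)"
proof (rule conv_boundI)
  show "lp_le p H (cmod z * c * b) (act_op (+) (Poly_Mapping.single 0 z * f) \<xi>)" if "lp_le p H b \<xi>" for \<xi> b
    using lp_le_scale[OF p conv_boundD[OF assms that], of z]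
    by (simp add: act_op_scale[abs_def] mult.assoc)
qed (use assms in \<open>simp add: conv_bound_def\<close>)

lemma conv_bound_mult: "conv_bound p H c f \<Longrightarrow> conv_bound p H d g \<Longrightarrow> conv_bound p H (c * d) (f * g)"
  by (auto simp: conv_bound_def act_op_mult_plus mult.assoc)

lemma conv_bound_one: "conv_bound p H 1 1"
  by (simp add: conv_bound_def translation_op_one)

lemma conv_bound_power: "conv_bound p H c f \<Longrightarrow> conv_bound p H (c ^ m) (f ^ m)"
  by (induction m) (auto intro: conv_bound_one conv_bound_mult)

lemma conv_bound_mono: "conv_bound p H c f \<Longrightarrow> c \<le> d \<Longrightarrow> conv_bound p H d f"
  unfolding conv_bound_def
  by (meson lp_le_mono[OF p] lp_le_nonneg mult_right_mono order_trans)

lemma lp_le_sum: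
  assumes "finite I" "\<And>i. i \<in> I \<Longrightarrow> lp_le p H (c i) (f i)"
  shows "lp_le p H (\<Sum>i\<in>I. c i) (\<lambda>x. \<Sum>i\<in>I. f i x)"
  using assms
proof (induction I rule: finite_induct)
  case empty
  show ?case by (simp add: lp_le_def)
next
  case (insert i I)
  then show ?case using lp_le_add[OF p, of H "c i" "f i"] by simp
qed

lemma conv_bound_exists:
  assumes H: "\<And>x. x \<in> H \<Longrightarrow> - x \<in> H" "\<And>x y. x \<in> H \<Longrightarrow> y \<in> H \<Longrightarrow> x + y \<in> H"
    and f: "keys f \<subseteq> H"
  shows "conv_bound p H (\<Sum>\<alpha>\<in>keys f. cmod (lookup f \<alpha>)) f"
proof (rule conv_boundI)
  show "0 \<le> (\<Sum>\<alpha>\<in>keys f. cmod (lookup f \<alpha>))" by (simp add: sum_nonneg)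
  fix \<xi> b assume \<xi>: "lp_le p H b \<xi>"
  have "lp_le p H (cmod (lookup f \<alpha>) * b) (\<lambda>x. lookup f \<alpha> * \<xi> (- \<alpha> + x))" if \<alpha>: "\<alpha> \<in> keys f" for \<alpha>
  proof (rule lp_le_scale[OF p])
    have "lp_le p H b (\<lambda>x. if x \<in> H then \<xi> (- \<alpha> + x) else 0)"
      by (rule lp_le_compose[OF _ \<xi>]) (simp add: inj_on_def)
    moreover have "\<xi> (- \<alpha> + x) = 0" if "x \<notin> H" for x
    proof -
      have "x = \<alpha> + (- \<alpha> + x)" by (simp add: add.assoc[symmetric])
      then have "- \<alpha> + x \<notin> H" using H(2)[of \<alpha> "- \<alpha> + x"] f \<alpha> that by auto
      then show ?thesis using lp_le_outside[OF \<xi>] by blast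
    qed
    then have "(\<lambda>x. if x \<in> H then \<xi> (- \<alpha> + x) else 0) = (\<lambda>x. \<xi> (- \<alpha> + x))" by auto
    ultimately show "lp_le p H b (\<lambda>x. \<xi> (- \<alpha> + x))" by simp
  qed
  then have "lp_le p H (\<Sum>\<alpha>\<in>keys f. cmod (lookup f \<alpha>) * b) (\<lambda>x. \<Sum>\<alpha>\<in>keys f. lookup f \<alpha> * \<xi> (- \<alpha> + x))"
    by (intro lp_le_sum) auto
  then show "lp_le p H ((\<Sum>\<alpha>\<in>keys f. cmod (lookup f \<alpha>)) * b) (act_op (+) f \<xi>)"
    by (simp add: act_op_def[abs_def] sum_distrib_right)
qed

text \<open>Any finite set of values of a convolution depends on finitely many values of \<open>\<xi>\<close>, and for finitely
  supported \<open>\<xi>\<close> the convolutions converge pointwise.  This works for infinite \<open>p\<close> too, where finitely supported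
  sequences are not dense.\<close>

lemma conv_bound_LIMSEQ:
  assumes lim: "\<And>x. (\<lambda>N. lookup (y N) x) \<longlonglongrightarrow> lookup z x" and y: "\<And>N. conv_bound p H c (y N)"
    and z: "conv_bound p H d z"
  shows "conv_bound p H c z"
  unfolding conv_bound_def
proof (intro conjI allI impI)
  show c: "0 \<le> c" using y by (simp add: conv_bound_def)
  fix \<xi> b assume \<xi>: "lp_le p H b \<xi>"
  show "lp_le p H (c * b) (act_op (+) z \<xi>)"
  proof (rule lp_le_local)
    show "0 \<le> c * b" using c lp_le_nonneg[OF \<xi>] by simp
    show "act_op (+) z \<xi> x = 0" if "x \<notin> H" for x
      using lp_le_outside[OF conv_boundD[OF z \<xi>] that] .
    fix Y :: "'g set" assume Y: "finite Y"
    define Z where "Z = (\<Union>x\<in>Y. (\<lambda>\<alpha>. - \<alpha> + x) ` keys z)"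
    have Z: "finite Z" using Y by (simp add: Z_def)
    define \<eta> where "\<eta> = (\<lambda>x. if x \<in> Z then \<xi> x else 0)"
    have \<eta>: "lp_le p H b \<eta>" unfolding \<eta>_def by (rule lp_le_truncate[OF p \<xi>])
    have expand: "act_op (+) f \<eta> w = (\<Sum>v\<in>Z. lookup f (w - v) * \<eta> v)" for f w
    proof -
      have e: "\<eta> = (\<lambda>v. \<Sum>w\<in>Z. delta w v * \<eta> w)"
        by (rule finite_support_expand[OF Z]) (simp add: \<eta>_def)
      show ?thesis
        by (subst e) (simp only: linear_op_sum[OF linear_op_act_op] linear_op_scale[OF linear_op_act_op] translation_op_delta)
    qed
    have "lp_le p H (c * b) (act_op (+) z \<eta>)"
    proof (rule lp_le_LIMSEQ[OF p])
      show "(\<lambda>N. act_op (+) (y N) \<eta> x) \<longlonglongrightarrow> act_op (+) z \<eta> x" for x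
        unfolding expand by (intro tendsto_intros lim)
      show "lp_le p H (c * b) (act_op (+) (y N) \<eta>)" for N
        using y[of N] \<eta> by (simp add: conv_bound_def)
    qed
    moreover have "act_op (+) z \<eta> x = act_op (+) z \<xi> x" if "x \<in> Y" for x
      unfolding act_op_def \<eta>_def Z_def using that by (intro sum.cong) auto
    ultimately show "\<exists>\<eta>. lp_le p H (c * b) \<eta> \<and> (\<forall>x\<in>Y. \<eta> x = act_op (+) z \<xi> x)" by blast
  qed
qed

text \<open>For \<open>p \<le> 2\<close> apply the operator to the unit and use \<open>\<parallel>y\<parallel>\<^sub>2 \<le> \<parallel>y\<parallel>\<^sub>p\<close>.  For \<open>p \<ge> 2\<close> apply it to the
  adjoint \<open>y\<^sup>*\<close>: the value at \<open>0\<close> is \<open>\<parallel>y\<parallel>\<^sub>2\<^sup>2\<close>, and it is at most \<open>c \<parallel>y\<^sup>*\<parallel>\<^sub>p \<le> c \<parallel>y\<parallel>\<^sub>2\<close>.\<close>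

lemma conv_bound_imp_norm_le:
  assumes y: "conv_bound p H c y" and keys: "keys y \<subseteq> H" and H: "0 \<in> H" "\<And>x. x \<in> H \<Longrightarrow> - x \<in> H"
  shows "norm (ell2_of y) \<le> c"
proof -
  have c: "0 \<le> c" using y by (simp add: conv_bound_def)
  have norm_y: "(norm (ell2_of y))\<^sup>2 = (\<Sum>x\<in>keys y. (cmod (lookup y x))\<^sup>2)"
  proof -
    have "(norm (ell2_of y))\<^sup>2 = (\<Sum>\<^sub>\<infinity>x\<in>keys y. (cmod (lookup y x))\<^sup>2)"
      unfolding norm_ell2_power2 ell2_of.rep_eq
      by (rule infsum_cong_neutral) (auto simp: in_keys_iff)
    then show ?thesis by simp
  qed
  show ?thesis
  proof (cases "p \<noteq> \<infinity> \<and> enn2real p \<le> 2")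
    case True
    define P where "P = enn2real p"
    have P: "1 \<le> P" using enn2real_ge_1[OF p] True by (simp add: P_def)
    have "lp_le p H 1 (delta 0)"
    proof -
      have "(\<Sum>x\<in>Y. cmod (delta (0::'g) x) powr P) \<le> 1" if "finite Y" for Y
      proof -
        have "(\<Sum>x\<in>Y. cmod (delta (0::'g) x) powr P) = (\<Sum>x\<in>Y. if x = 0 then 1 else 0)"
          by (intro sum.cong) (auto simp: delta_def)
        also have "\<dots> \<le> 1" using that by simp
        finally show ?thesis .
      qed
      then show ?thesis using True H by (auto simp: lp_le_finite_iff delta_def P_def)
    qed
    then have "lp_le p H (c * 1) (act_op (+) y (delta 0))" using y unfolding conv_bound_def by blast
    moreover have "act_op (+) y (delta 0) = lookup y"
      by (rule ext) (simp add: translation_op_delta)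
    ultimately have "(\<Sum>x\<in>keys y. cmod (lookup y x) powr P) \<le> c powr P"
      using True by (simp add: lp_le_finite_iff P_def)
    then have "(norm (ell2_of y))\<^sup>2 \<le> c\<^sup>2"
      unfolding norm_y using True
      by (intro lp_le_comparison_2(1)[OF _ _ c P]) (auto simp: in_keys_iff P_def)
    then show ?thesis using c by (rule power2_le_imp_le)
  next
    case False
    define n where "n = norm (ell2_of y)"
    define \<xi> where "\<xi> x = cnj (lookup y (- x))" for x
    have outside: "\<xi> x = 0" if "x \<notin> H" for x
    proof -
      have "- x \<notin> keys y" using keys H(2)[of "- x"] that by auto
      then show ?thesis by (simp add: \<xi>_def in_keys_iff)
    qed
    have "lp_le p H n \<xi>"
    proof (cases "p = \<infinity>")
      case True
      have "cmod (\<xi> x) \<le> n" for x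
        using cmod_coef_le[of "ell2_of y" "- x"] by (simp add: \<xi>_def n_def ell2_of.rep_eq)
      then show ?thesis using True outside by (simp add: lp_le_infinite_iff n_def)
    next
      case p': False
      define P where "P = enn2real p"
      have P: "2 \<le> P" using False p' by (simp add: P_def)
      have sum_le: "(\<Sum>x\<in>keys y. cmod (lookup y x) powr P) \<le> n powr P"
        using P norm_y by (intro lp_le_comparison_2(2)) (auto simp: n_def in_keys_iff)
      have "(\<Sum>x\<in>Y. cmod (\<xi> x) powr P) \<le> n powr P" if Y: "finite Y" for Y
      proof -
        have "(\<Sum>x\<in>Y. cmod (\<xi> x) powr P) = (\<Sum>x\<in>uminus ` Y. cmod (lookup y x) powr P)"
          by (simp add: sum.reindex inj_on_def \<xi>_def)
        also have "\<dots> = (\<Sum>x\<in>uminus ` Y \<inter> keys y. cmod (lookup y x) powr P)"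
          using Y P by (intro sum.mono_neutral_right) (auto simp: in_keys_iff)
        also have "\<dots> \<le> (\<Sum>x\<in>keys y. cmod (lookup y x) powr P)"
          by (intro sum_mono2) auto
        finally show ?thesis using sum_le by simp
      qed
      then show ?thesis using outside by (simp add: lp_le_finite_iff[OF p'] n_def P_def)
    qed
    then have "lp_le p H (c * n) (act_op (+) y \<xi>)" using y unfolding conv_bound_def by blast
    then have "cmod (act_op (+) y \<xi> 0) \<le> c * n" by (rule lp_le_pointwise[OF p])
    also have "act_op (+) y \<xi> 0 = of_real (n\<^sup>2)"
      by (simp add: act_op_def \<xi>_def n_def norm_y complex_norm_square del: of_real_power)
    finally have "n * n \<le> c * n" by (simp add: power2_eq_square norm_mult n_def)
    then show ?thesis using c by (cases "n = 0") (auto simp: n_def)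
  qed
qed

end

context almost_free_action
begin

text \<open>\<open>T\<close> is an idempotent operator on the sequences supported on the subgroup \<open>H\<close> that is a limit of
  convolution operators.  The subgroup allows the generating set of the algebra to be smaller than that
  of the group that acts on the tree.\<close>

theorem lp_idempotent_trivial:
  fixes p :: ennreal and H :: "'g set" and T :: "('g \<Rightarrow> complex) \<Rightarrow> ('g \<Rightarrow> complex)"
  assumes p: "1 \<le> p"
    and H: "0 \<in> H" "\<And>x. x \<in> H \<Longrightarrow> - x \<in> H" "\<And>x y. x \<in> H \<Longrightarrow> y \<in> H \<Longrightarrow> x + y \<in> H"
    and t: "0 \<le> t" "\<And>\<xi> b. lp_le p H b \<xi> \<Longrightarrow> lp_le p H (t * b) (T \<xi>)"
    and diff: "\<And>\<xi> \<eta> b c. lp_le p H b \<xi> \<Longrightarrow> lp_le p H c \<eta> \<Longrightarrow> T (\<lambda>x. \<xi> x - \<eta> x) = (\<lambda>x. T \<xi> x - T \<eta> x)"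
    and idem: "\<And>\<xi> b. lp_le p H b \<xi> \<Longrightarrow> T (T \<xi>) = T \<xi>"
    and approx: "\<And>\<epsilon>. \<epsilon> > 0 \<Longrightarrow> \<exists>f. keys f \<subseteq> H \<and>
        (\<forall>\<xi> b. lp_le p H b \<xi> \<longrightarrow> lp_le p H (\<epsilon> * b) (\<lambda>x. T \<xi> x - act_op (+) f \<xi> x))"
  shows "(\<forall>\<xi> b. lp_le p H b \<xi> \<longrightarrow> T \<xi> = (\<lambda>x. 0)) \<or> (\<forall>\<xi> b. lp_le p H b \<xi> \<longrightarrow> T \<xi> = \<xi>)"
proof -
  note le_add = lp_le_add[OF p] and le_diff = lp_le_diff[OF p] and le_mono = lp_le_mono[OF p]
  define C where "C = 2 * t + 3"
  \<comment> \<open>Below \<open>1/50\<close> for the annulus; \<open>2 C \<delta>\<close> bounds the distance of the sign series from \<open>u\<close>\<close>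
  define \<delta> where "\<delta> = 1 / (50 * C)"
  \<comment> \<open>Chosen so that \<open>\<parallel>f - f\<^sup>2\<parallel> \<le> (2 t + 2) \<epsilon> = \<delta> / 4\<close>; then \<open>a\<close> has norm at most \<open>\<delta>\<close>\<close>
  define \<epsilon> where "\<epsilon> = \<delta> / (8 * t + 8)"
  have C: "3 \<le> C" using t by (simp add: C_def)
  have \<delta>: "0 < \<delta>" "\<delta> \<le> 1/50" "C * \<delta> = 1/50" using C by (auto simp: \<delta>_def field_simps)
  have \<epsilon>: "0 < \<epsilon>" "(8 * t + 8) * \<epsilon> = \<delta>" using \<delta>(1) t(1) by (auto simp: \<epsilon>_def)
  have "\<epsilon> \<le> \<delta> / 1" unfolding \<epsilon>_def using \<delta>(1) t(1) by (intro divide_left_mono) auto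
  then have \<epsilon>_le: "\<epsilon> \<le> 1/50" using \<delta>(2) by simp
  obtain f where f: "keys f \<subseteq> H"
    and fT: "\<And>\<xi> b. lp_le p H b \<xi> \<Longrightarrow> lp_le p H (\<epsilon> * b) (\<lambda>x. T \<xi> x - act_op (+) f \<xi> x)"
    using approx[OF \<epsilon>(1)] by blast
  have f_bound: "conv_bound p H (t + 1) f"
    unfolding conv_bound_def
  proof (intro conjI allI impI)
    fix \<xi> b assume \<xi>: "lp_le p H b \<xi>"
    have "lp_le p H (t * b + \<epsilon> * b) (\<lambda>x. T \<xi> x - (T \<xi> x - act_op (+) f \<xi> x))"
      by (rule le_diff[OF t(2)[OF \<xi>] fT[OF \<xi>]])
    moreover have "\<epsilon> * b \<le> 1 * b" using \<epsilon>_le lp_le_nonneg[OF \<xi>] by (intro mult_right_mono) auto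
    ultimately show "lp_le p H ((t + 1) * b) (act_op (+) f \<xi>)"
      by (auto intro: le_mono simp: distrib_right)
  qed (use t in simp)
  have "conv_bound p H ((t + 1) * \<epsilon> + \<epsilon> * t + \<epsilon>) (f - f * f)"
    unfolding conv_bound_def
  proof (intro conjI allI impI)
    show "0 \<le> (t + 1) * \<epsilon> + \<epsilon> * t + \<epsilon>" using \<epsilon> t by simp
    fix \<xi> b assume \<xi>: "lp_le p H b \<xi>"
    have 1: "lp_le p H ((t + 1) * (\<epsilon> * b)) (act_op (+) f (\<lambda>x. T \<xi> x - act_op (+) f \<xi> x))"
      using f_bound fT[OF \<xi>] unfolding conv_bound_def by blast
    have 2: "lp_le p H (\<epsilon> * (t * b)) (\<lambda>x. T (T \<xi>) x - act_op (+) f (T \<xi>) x)"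
      by (rule fT[OF t(2)[OF \<xi>]])
    have "lp_le p H (((t + 1) * (\<epsilon> * b) + \<epsilon> * (t * b)) + \<epsilon> * b)
       (\<lambda>x. (act_op (+) f (\<lambda>x. T \<xi> x - act_op (+) f \<xi> x) x + (T (T \<xi>) x - act_op (+) f (T \<xi>) x)) - (T \<xi> x - act_op (+) f \<xi> x))"
      by (rule le_diff[OF le_add[OF 1 2] fT[OF \<xi>]])
    moreover have "act_op (+) f (\<lambda>x. T \<xi> x - act_op (+) f \<xi> x) x = act_op (+) f (T \<xi>) x - act_op (+) f (act_op (+) f \<xi>) x" for x
      by (simp add: act_op_def right_diff_distrib sum_subtractf)
    ultimately show "lp_le p H (((t + 1) * \<epsilon> + \<epsilon> * t + \<epsilon>) * b) (act_op (+) (f - f * f) \<xi>)"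
      by (simp add: act_op_diff[abs_def] act_op_mult_plus idem[OF \<xi>] algebra_simps)
  qed
  then have ff: "conv_bound p H (\<delta> / 4) (f - f * f)"
    by (rule conv_bound_mono[OF p]) (use \<epsilon>(2) in \<open>simp add: algebra_simps\<close>)
  define u where "u = f + f - 1"
  define a where "a = 1 - u\<^sup>2"
  have u_bound: "conv_bound p H C u"
    unfolding u_def using conv_bound_diff[OF p conv_bound_add[OF p f_bound f_bound] conv_bound_one[OF p]]
    by (rule conv_bound_mono[OF p]) (simp add: C_def)
  have "a = (f - f * f) + (f - f * f) + ((f - f * f) + (f - f * f))"
    by (simp add: a_def u_def power2_eq_square algebra_simps)
  moreover have "conv_bound p H (\<delta> / 4 + \<delta> / 4 + (\<delta> / 4 + \<delta> / 4)) \<dots>"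
    by (intro conv_bound_add[OF p] ff)
  ultimately have a_bound: "conv_bound p H \<delta> a" by simp
  have keys_mult_H: "keys (g * h) \<subseteq> H" if "keys g \<subseteq> H" "keys h \<subseteq> H" for g h :: "'g \<Rightarrow>\<^sub>0 complex"
    using keys_mult[of g h] that H(3) by blast
  have keys_one_H: "keys (1 :: 'g \<Rightarrow>\<^sub>0 complex) \<subseteq> H" using H(1) by simp
  have keys_diff_H: "keys (g - h) \<subseteq> H" if "keys g \<subseteq> H" "keys h \<subseteq> H" for g h :: "'g \<Rightarrow>\<^sub>0 complex"
    using Poly_Mapping.keys_diff[of g h] that by blast
  have keys_power_H: "keys (g ^ m) \<subseteq> H" if "keys g \<subseteq> H" for g :: "'g \<Rightarrow>\<^sub>0 complex" and m
    by (induction m) (auto intro: keys_mult_H[THEN subsetD] that[THEN subsetD] simp: H(1))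
  have keys_u: "keys u \<subseteq> H"
    unfolding u_def using Poly_Mapping.keys_add[of f f] f by (intro keys_diff_H keys_one_H) blast
  have keys_a: "keys a \<subseteq> H"
    unfolding a_def by (intro keys_diff_H keys_one_H keys_power_H keys_u)
  have "norm (ell2_of (u ^ m * a ^ j)) \<le> C ^ m * \<delta> ^ j" for m j
  proof (rule conv_bound_imp_norm_le[OF p, where H = H])
    show "conv_bound p H (C ^ m * \<delta> ^ j) (u ^ m * a ^ j)"
      by (intro conv_bound_mult[OF p] conv_bound_power[OF p] u_bound a_bound)
    show "keys (u ^ m * a ^ j) \<subseteq> H"
      by (intro keys_mult_H keys_power_H keys_u keys_a)
  qed (use H in auto)
  then have "\<exists>M. \<forall>j. norm (ell2_of (u ^ m * (1 - u\<^sup>2) ^ j)) \<le> M * \<delta> ^ j" for m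
    unfolding a_def by blast
  then have trivial: "(\<forall>x. (\<lambda>N. lookup (sign_series u N) x) \<longlonglongrightarrow> lookup 1 x) \<or>
    (\<forall>x. (\<lambda>N. lookup (sign_series u N) x) \<longlonglongrightarrow> lookup (- 1) x)"
    using sign_series_trivial[of \<delta> u] \<delta> by simp
  have series: "conv_bound p H (\<Sum>j<N. C * \<delta> ^ Suc j) (sign_series u (Suc N) - u)" for N
  proof (induction N)
    case 0
    have "conv_bound p H 0 0" by (simp add: conv_bound_def act_op_def lp_le_def)
    then show ?case by (simp add: sign_series_def binom_coeff_def)
  next
    case (Suc N)
    have "conv_bound p H (\<bar>binom_coeff (Suc N)\<bar> * (C * \<delta> ^ Suc N))
        (Poly_Mapping.single 0 (of_real (binom_coeff (Suc N))) * (u * a ^ Suc N))"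
      using conv_bound_scale[OF p conv_bound_mult[OF p u_bound conv_bound_power[OF p a_bound]], of "of_real (binom_coeff (Suc N))" "Suc N"]
      by simp
    moreover have "\<bar>binom_coeff (Suc N)\<bar> * (C * \<delta> ^ Suc N) \<le> 1 * (C * \<delta> ^ Suc N)"
      using C \<delta> by (intro mult_right_mono abs_binom_coeff_le) auto
    ultimately have "conv_bound p H (C * \<delta> ^ Suc N)
        (Poly_Mapping.single 0 (of_real (binom_coeff (Suc N))) * (u * a ^ Suc N))"
      using conv_bound_mono[OF p] by simp
    from conv_bound_add[OF p Suc.IH this] show ?case
      by (simp add: sign_series_def a_def algebra_simps)
  qed
  have geom: "(\<Sum>j<N. C * \<delta> ^ Suc j) \<le> 1/4" for N
  proof -
    have "(\<Sum>j<N. \<delta> ^ j) \<le> suminf (\<lambda>j. \<delta> ^ j)"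
      using \<delta> by (intro sum_le_suminf) auto
    also have "\<dots> \<le> 2" using \<delta> by (simp add: suminf_geometric field_simps)
    finally have "C * \<delta> * (\<Sum>j<N. \<delta> ^ j) \<le> C * \<delta> * 2" using \<delta>(3) by (intro mult_left_mono) auto
    moreover have "(\<Sum>j<N. C * \<delta> ^ Suc j) = C * \<delta> * (\<Sum>j<N. \<delta> ^ j)"
      by (simp add: sum_distrib_left mult.assoc)
    ultimately show ?thesis unfolding \<delta>(3) by linarith
  qed
  have limit: "conv_bound p H (1/4) (s - u)"
    if s: "\<And>x. (\<lambda>N. lookup (sign_series u N) x) \<longlonglongrightarrow> lookup s x" and keys_s: "keys s \<subseteq> H" for s
  proof (rule conv_bound_LIMSEQ[OF p])
    show "(\<lambda>N. lookup (sign_series u (Suc N) - u) x) \<longlonglongrightarrow> lookup (s - u) x" for x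
      unfolding lookup_minus by (intro tendsto_intros LIMSEQ_Suc[OF s])
    show "conv_bound p H (1/4) (sign_series u (Suc N) - u)" for N
      by (rule conv_bound_mono[OF p series geom])
    show "conv_bound p H (\<Sum>\<alpha>\<in>keys (s - u). cmod (lookup (s - u) \<alpha>)) (s - u)"
      by (rule conv_bound_exists[OF p H(2,3) keys_diff_H[OF keys_s keys_u]])
  qed
  have small_idem: "S \<xi> = (\<lambda>x. 0)"
    if half: "\<And>\<xi> b. lp_le p H b \<xi> \<Longrightarrow> lp_le p H (b / 2) (S \<xi>)"
      and S: "\<And>\<xi> b. lp_le p H b \<xi> \<Longrightarrow> S (S \<xi>) = S \<xi>" and \<xi>: "lp_le p H b \<xi>" for S \<xi> b
  proof
    fix x
    \<comment> \<open>\<open>S \<xi> = S\<^sup>n\<^sup>+\<^sup>1 \<xi>\<close>, and each application halves the bound\<close>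
    have "lp_le p H (b * (1/2) ^ n) (S \<xi>)" for n
    proof (induction n)
      case 0
      show ?case using half[OF \<xi>] lp_le_nonneg[OF \<xi>] by (auto intro: le_mono)
    next
      case (Suc n)
      from half[OF this] show ?case by (simp add: S[OF \<xi>])
    qed
    then have "cmod (S \<xi> x) \<le> b * (1/2) ^ n" for n by (rule lp_le_pointwise[OF p])
    moreover have "(\<lambda>n. b * (1/2) ^ n) \<longlonglongrightarrow> b * 0"
      by (intro tendsto_intros LIMSEQ_power_zero) simp
    ultimately have "cmod (S \<xi> x) \<le> b * 0" by (intro LIMSEQ_le_const) auto
    then show "S \<xi> x = 0" by simp
  qed
  from trivial show ?thesis
  proof
    assume "\<forall>x. (\<lambda>N. lookup (sign_series u N) x) \<longlonglongrightarrow> lookup 1 x"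
    then have "conv_bound p H (1/4) (1 - u)" using limit keys_one_H by blast
    moreover have "1 - u = (1 - f) + (1 - f)" by (simp add: u_def)
    ultimately have 1: "lp_le p H (1/4 * b) (\<lambda>x. act_op (+) (1 - f) \<xi> x + act_op (+) (1 - f) \<xi> x)" if "lp_le p H b \<xi>" for \<xi> b
      using that by (simp add: conv_bound_def act_op_add[abs_def])
    have "lp_le p H (b / 2) (\<lambda>x. \<xi> x - T \<xi> x)" if \<xi>: "lp_le p H b \<xi>" for \<xi> b
    proof -
      have "lp_le p H (cmod (1/2) * (1/4 * b) + \<epsilon> * b)
        (\<lambda>x. 1/2 * (act_op (+) (1 - f) \<xi> x + act_op (+) (1 - f) \<xi> x) - (T \<xi> x - act_op (+) f \<xi> x))"
        by (intro le_diff lp_le_scale[OF p] 1 fT \<xi>)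
      moreover have "\<epsilon> * b \<le> 1/50 * b" using \<epsilon>_le lp_le_nonneg[OF \<xi>] by (rule mult_right_mono)
      moreover have "1/2 * (act_op (+) (1 - f) \<xi> x + act_op (+) (1 - f) \<xi> x) - (T \<xi> x - act_op (+) f \<xi> x) = \<xi> x - T \<xi> x" for x
      proof -
        have "1/2 * (z + z) = z" for z :: complex by simp
        then show ?thesis by (simp only: act_op_diff translation_op_one) simp
      qed
      ultimately have "lp_le p H (cmod (1/2) * (1/4 * b) + \<epsilon> * b) (\<lambda>x. \<xi> x - T \<xi> x)"
        by (simp only:)
      then show ?thesis
        by (rule le_mono) (use \<open>\<epsilon> * b \<le> 1/50 * b\<close> lp_le_nonneg[OF \<xi>] in \<open>simp add: norm_divide\<close>)
    qed
    moreover have "(\<lambda>x. (\<lambda>x. \<xi> x - T \<xi> x) x - T (\<lambda>x. \<xi> x - T \<xi> x) x) = (\<lambda>x. \<xi> x - T \<xi> x)" if \<xi>: "lp_le p H b \<xi>" for \<xi> b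
      using diff[OF \<xi> t(2)[OF \<xi>]] idem[OF \<xi>] by simp
    ultimately have "(\<lambda>x. \<xi> x - T \<xi> x) = (\<lambda>x. 0)" if "lp_le p H b \<xi>" for \<xi> b
      using small_idem[of "\<lambda>\<xi> x. \<xi> x - T \<xi> x"] that by blast
    then have "T \<xi> = \<xi>" if "lp_le p H b \<xi>" for \<xi> b
      using that by (metis (no_types, lifting) eq_iff_diff_eq_0 ext)
    then show ?thesis by blast
  next
    assume "\<forall>x. (\<lambda>N. lookup (sign_series u N) x) \<longlonglongrightarrow> lookup (- 1) x"
    then have "conv_bound p H (1/4) (- 1 - u)" using limit[of "- 1"] keys_one_H by simp
    moreover have "- 1 - u = (- f) + (- f)" by (simp add: u_def)
    ultimately have "conv_bound p H (1/4) ((- f) + (- f))" by (simp only:)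
    from conv_boundD[OF this] have 1: "lp_le p H (1/4 * b) (\<lambda>x. - act_op (+) f \<xi> x + - act_op (+) f \<xi> x)" if "lp_le p H b \<xi>" for \<xi> b
      using that by (simp only: act_op_add[abs_def] act_op_uminus)
    have "lp_le p H (b / 2) (T \<xi>)" if \<xi>: "lp_le p H b \<xi>" for \<xi> b
    proof -
      have "lp_le p H (cmod (- 1/2) * (1/4 * b) + \<epsilon> * b)
        (\<lambda>x. - 1/2 * (- act_op (+) f \<xi> x + - act_op (+) f \<xi> x) + (T \<xi> x - act_op (+) f \<xi> x))"
        by (intro le_add lp_le_scale[OF p] 1 fT \<xi>)
      moreover have "\<epsilon> * b \<le> 1/50 * b" using \<epsilon>_le lp_le_nonneg[OF \<xi>] by (rule mult_right_mono)
      moreover have "- 1/2 * (- act_op (+) f \<xi> x + - act_op (+) f \<xi> x) + (T \<xi> x - act_op (+) f \<xi> x) = T \<xi> x" for x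
      proof -
        have "- 1/2 * (- z + - z) = z" for z :: complex by simp
        then show ?thesis by (simp only:) simp
      qed
      ultimately have "lp_le p H (cmod (- 1/2) * (1/4 * b) + \<epsilon> * b) (T \<xi>)"
        by (simp only:)
      then show ?thesis
        by (rule le_mono) (use \<open>\<epsilon> * b \<le> 1/50 * b\<close> lp_le_nonneg[OF \<xi>] in \<open>simp add: norm_divide\<close>)
    qed
    then have "T \<xi> = (\<lambda>x. 0)" if "lp_le p H b \<xi>" for \<xi> b
      using small_idem[of T] idem that by blast
    then show ?thesis by blast
  qed
qed

end

section \<open>The reduced algebra of the free group\<close>

interpretation free: almost_free_action "edge_act :: 'a free \<Rightarrow> 'a free \<Rightarrow> 'a free"
  by unfold_locales (simp_all add: edge_act_add edge_act_fixed finite_edge_act_neq)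

lemma lp_norm_nonneg:
  assumes "X \<noteq> {}" "\<xi> \<in> lp_space p X"
  shows "0 \<le> lp_norm p X \<xi>"
proof (cases "p = \<infinity>")
  case True
  then have "bounded (\<xi> ` X)" using assms(2) by (simp add: lp_space_def)
  then have bdd: "bdd_above ((\<lambda>x. norm (\<xi> x)) ` X)" by (auto simp: bounded_iff bdd_above_def)
  obtain x where "x \<in> X" using assms(1) by blast
  then have "norm (\<xi> x) \<le> (SUP x\<in>X. norm (\<xi> x))" by (rule cSUP_upper[OF _ bdd])
  then show ?thesis unfolding lp_norm_def if_P[OF True] using norm_ge_zero order_trans by blast
next
  case False
  then show ?thesis by (simp add: lp_norm_def)
qed

theorem mainTheorem3:
  fixes n :: nat and p :: ennreal
  assumes "n \<ge> 1" and "1 \<le> p"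
  shows "\<not> (\<exists>a. nontrivial_idempotent (reduced_lp_algebra p (free_group {..<n})) a)"
proof
  assume "\<exists>a. nontrivial_idempotent (reduced_lp_algebra p (free_group {..<n})) a"
  define G where "G = free_group {..<n}"
  define X where "X = carrier G"
  define H where "H = {h :: nat free. word h \<in> X}"
  define lp where "lp = lp_space p X"
  note p = \<open>1 \<le> p\<close>
  obtain T where T: "nontrivial_idempotent (reduced_lp_algebra p G) T"
    using \<open>\<exists>a. _ a\<close> by (auto simp: G_def)
  have X_def': "X = {w. reduced_word w \<and> set w \<subseteq> {..<n} \<times> UNIV}"
    by (simp add: X_def G_def free_group_def)
  have G_mult: "x \<otimes>\<^bsub>G\<^esub> y = foldr cancel_cons x y" for x y by (simp add: G_def free_group_def)
  have G_one: "\<one>\<^bsub>G\<^esub> = []" by (simp add: G_def free_group_def)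
  interpret G: group G unfolding G_def by (rule group_free_group)
  have H0: "0 \<in> H" by (simp add: H_def X_def' zero_free.rep_eq reduced_word_def)
  have H_uminus: "- x \<in> H" if "x \<in> H" for x
    using that by (auto simp: H_def X_def' uminus_free.rep_eq reduced_word_inverse inv_letter_def)
  have H_add: "x + y \<in> H" if "x \<in> H" "y \<in> H" for x y
    using that set_foldr_cancel_cons[of "word x" "word y"]
    by (auto simp: H_def X_def' plus_free.rep_eq reduced_word_foldr)
  have X_ne: "X \<noteq> {}" unfolding X_def by (rule G.carrier_not_empty)
  have inv_word: "inv\<^bsub>G\<^esub> (word g) = word (- g)" if "g \<in> H" for g
  proof (rule G.inv_equality)
    show "word (- g) \<otimes>\<^bsub>G\<^esub> word g = \<one>\<^bsub>G\<^esub>"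
      unfolding G_mult G_one plus_free.rep_eq[symmetric] by (simp add: zero_free.rep_eq)
    show "word g \<in> carrier G" "word (- g) \<in> carrier G"
      using that H_uminus[OF that] by (simp_all add: H_def X_def)
  qed
  have Abs_word: "word (Abs_free x) = x" if "x \<in> X" for x
    using that by (simp add: X_def' Abs_free_inverse)
  have word_Abs: "Abs_free (word h) = h" for h :: "nat free" by (rule word_inverse)
  \<comment> \<open>The words in the first \<open>n\<close> generators form the subgroup \<open>H\<close> of the free group on all natural numbers; \<open>push\<close> and \<open>pull\<close> identify the sequences on them\<close>
  define push where "push \<zeta> = (\<lambda>x. if x \<in> X then \<zeta> (Abs_free x) else 0)" for \<zeta> :: "nat free \<Rightarrow> complex"
  define pull where "pull \<xi> = (\<lambda>h. if h \<in> H then \<xi> (word h) else 0)" for \<xi> :: "(nat \<times> bool) list \<Rightarrow> complex"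
  have lp_push: "lp_le p X b (push \<zeta>)" if "lp_le p H b \<zeta>" for b \<zeta>
    unfolding push_def
    by (rule lp_le_compose[OF _ that]) (metis Abs_word inj_on_inverseI)
  have lp_pull: "lp_le p H b (pull \<xi>)" if "lp_le p X b \<xi>" for b \<xi>
    unfolding pull_def by (rule lp_le_compose[OF _ that]) (simp add: inj_on_def word_inject)
  have pull_push: "pull (push \<zeta>) = \<zeta>" if "lp_le p H b \<zeta>" for b \<zeta>
    using lp_le_outside[OF that] by (auto simp: pull_def push_def H_def word_Abs)
  have push_pull: "push (pull \<xi>) = \<xi>" if "\<xi> \<in> lp" for \<xi>
    using that by (auto simp: pull_def push_def H_def lp_def lp_space_def Abs_word)
  note lp_iff = lp_le_iff_norm[OF p X_ne, folded lp_def]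
  have lp_norm_le: "lp_le p X (lp_norm p X \<xi>) \<xi>" if "\<xi> \<in> lp" for \<xi>
    using that lp_norm_nonneg[OF X_ne that[unfolded lp_def]] by (simp add: lp_iff)
  have T_ops: "T \<in> lp_bounded_ops p X"
    and T_approx: "\<And>\<epsilon>. \<epsilon> > 0 \<Longrightarrow> \<exists>f\<in>group_algebra G. lp_opnorm p X (\<lambda>\<xi>\<in>lp. \<lambda>x. T \<xi> x - left_regular_ext p G f \<xi> x) < \<epsilon>"
    and T_idem: "compose lp T T = T"
    and T_ne_0: "T \<noteq> (\<lambda>\<xi>\<in>lp. \<lambda>x. 0)" and T_ne_1: "T \<noteq> (\<lambda>\<xi>\<in>lp. \<xi>)"
    using T by (auto simp: nontrivial_idempotent_def reduced_lp_algebra_def X_def lp_def)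
  have T_fun: "T \<in> lp \<rightarrow>\<^sub>E lp"
    and T_add: "\<And>\<xi> \<eta>. \<xi> \<in> lp \<Longrightarrow> \<eta> \<in> lp \<Longrightarrow> T (\<lambda>x. \<xi> x + \<eta> x) = (\<lambda>x. T \<xi> x + T \<eta> x)"
    and T_scale: "\<And>c \<xi>. \<xi> \<in> lp \<Longrightarrow> T (\<lambda>x. c * \<xi> x) = (\<lambda>x. c * T \<xi> x)"
    and T_bdd: "\<exists>C. \<forall>\<xi>\<in>lp. lp_norm p X (T \<xi>) \<le> C * lp_norm p X \<xi>"
    using T_ops by (auto simp: lp_bounded_ops_def lp_def)
  have T_ext: "T \<in> extensional lp" using T_fun by (simp add: PiE_def)
  have T_lp: "T \<xi> \<in> lp" if "\<xi> \<in> lp" for \<xi> using T_fun that by auto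
  have T_T: "T (T \<xi>) = T \<xi>" if "\<xi> \<in> lp" for \<xi>
    using fun_cong[OF T_idem, of \<xi>] that by (simp add: compose_def)
  obtain C where C: "\<And>\<xi>. \<xi> \<in> lp \<Longrightarrow> lp_norm p X (T \<xi>) \<le> C * lp_norm p X \<xi>" using T_bdd by blast
  define t where "t = max C 0"
  have T_le: "lp_le p X (t * b) (T \<xi>)" if "lp_le p X b \<xi>" for b \<xi>
  proof -
    have \<xi>: "\<xi> \<in> lp" "lp_norm p X \<xi> \<le> b" "0 \<le> b" using that by (simp_all add: lp_iff)
    have "C * lp_norm p X \<xi> \<le> t * lp_norm p X \<xi>"
      using lp_norm_nonneg[OF X_ne \<xi>(1)[unfolded lp_def]] by (intro mult_right_mono) (auto simp: t_def)
    also have "\<dots> \<le> t * b" using \<xi>(2) by (intro mult_left_mono) (auto simp: t_def)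
    finally show ?thesis using C[OF \<xi>(1)] T_lp[OF \<xi>(1)] \<xi>(3) by (auto simp: lp_iff t_def)
  qed
  define T' where "T' \<zeta> = pull (T (push \<zeta>))" for \<zeta>
  have push_lp: "push \<zeta> \<in> lp" if "lp_le p H b \<zeta>" for b \<zeta>
    using lp_push[OF that] by (simp add: lp_iff)
  have push_T': "push (T' \<zeta>) = T (push \<zeta>)" if "lp_le p H b \<zeta>" for b \<zeta>
    unfolding T'_def by (rule push_pull[OF T_lp[OF push_lp[OF that]]])
  have "(\<forall>\<zeta> b. lp_le p H b \<zeta> \<longrightarrow> T' \<zeta> = (\<lambda>x. 0)) \<or> (\<forall>\<zeta> b. lp_le p H b \<zeta> \<longrightarrow> T' \<zeta> = \<zeta>)"
  proof (rule free.lp_idempotent_trivial[OF p H0 H_uminus H_add])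
    show "0 \<le> t" by (simp add: t_def)
    show "lp_le p H (t * b) (T' \<zeta>)" if "lp_le p H b \<zeta>" for \<zeta> b
      unfolding T'_def by (intro lp_pull T_le lp_push that)
    show "T' (T' \<zeta>) = T' \<zeta>" if "lp_le p H b \<zeta>" for \<zeta> b
      using T_T[OF push_lp[OF that]] push_T'[OF that] by (simp add: T'_def[of "T' \<zeta>"]) (simp add: T'_def)
    show "T' (\<lambda>x. \<zeta> x - \<eta> x) = (\<lambda>x. T' \<zeta> x - T' \<eta> x)" if "lp_le p H b \<zeta>" "lp_le p H c \<eta>" for \<zeta> \<eta> b c
    proof -
      have push_diff: "push (\<lambda>x. \<zeta> x - \<eta> x) = (\<lambda>x. push \<zeta> x + (-1) * push \<eta> x)" by (auto simp: push_def)
      have "(\<lambda>x. (-1) * push \<eta> x) \<in> lp"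
        using lp_le_scale[OF p lp_push[OF that(2)], of "-1"] by (simp add: lp_iff)
      from T_add[OF push_lp[OF that(1)] this]
      have "T (push (\<lambda>x. \<zeta> x - \<eta> x)) = (\<lambda>x. T (push \<zeta>) x + (-1) * T (push \<eta>) x)"
        unfolding push_diff T_scale[OF push_lp[OF that(2)]] .
      then show ?thesis by (auto simp: T'_def pull_def)
    qed
    fix \<epsilon> :: real assume \<epsilon>: "\<epsilon> > 0"
    obtain f where f: "f \<in> group_algebra G"
      and f_near: "lp_opnorm p X (\<lambda>\<xi>\<in>lp. \<lambda>x. T \<xi> x - left_regular_ext p G f \<xi> x) < \<epsilon>"
      using T_approx[OF \<epsilon>] by blast
    have f_fin: "finite {\<alpha>. f \<alpha> \<noteq> 0}" and f_X: "{\<alpha>. f \<alpha> \<noteq> 0} \<subseteq> X"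
      using f by (simp_all add: group_algebra_def X_def)
    define f' where "f' = Abs_poly_mapping (\<lambda>h :: nat free. f (word h))"
    have "finite (word -` {\<alpha>. f \<alpha> \<noteq> 0} :: nat free set)"
      by (rule finite_vimageI[OF f_fin]) (simp add: inj_on_def word_inject)
    then have "finite {h :: nat free. f (word h) \<noteq> 0}" by (simp add: vimage_def)
    then have look: "lookup f' h = f (word h)" for h by (simp add: f'_def)
    have keys_f': "keys f' \<subseteq> H" using f_X by (auto simp: in_keys_iff look H_def)
    have supp_f: "{\<alpha>. f \<alpha> \<noteq> 0} = word ` keys f'"
    proof (intro equalityI subsetI)
      fix \<alpha> assume "\<alpha> \<in> {\<alpha>. f \<alpha> \<noteq> 0}"
      then have "\<alpha> = word (Abs_free \<alpha>)" "Abs_free \<alpha> \<in> keys f'"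
        using f_X Abs_word by (auto simp: in_keys_iff look)
      then show "\<alpha> \<in> word ` keys f'" by blast
    qed (auto simp: in_keys_iff look)
    have ext: "left_regular_ext p G f \<xi> = push (act_op (+) f' (pull \<xi>))" if \<xi>: "\<xi> \<in> lp" for \<xi>
    proof
      fix x
      have "left_regular_ext p G f \<xi> x = (\<Sum>g\<in>keys f'. lookup f' g * left_regular p G (word g) \<xi> x)"
        using \<xi> unfolding left_regular_ext_def supp_f
        by (simp add: lp_def X_def sum.reindex inj_on_def word_inject look)
      also have "\<dots> = push (act_op (+) f' (pull \<xi>)) x"
      proof (cases "x \<in> X")
        case True
        have "left_regular p G (word g) \<xi> x = pull \<xi> (- g + Abs_free x)" if "g \<in> keys f'" for g
        proof -
          have g: "g \<in> H" using keys_f' that by blast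
          have x: "Abs_free x \<in> H" using True by (simp add: H_def Abs_word)
          have "inv\<^bsub>G\<^esub> word g \<otimes>\<^bsub>G\<^esub> x = word (- g + Abs_free x)"
            by (simp add: inv_word[OF g] G_mult plus_free.rep_eq Abs_word[OF True])
          then show ?thesis
            using \<xi> True H_add[OF H_uminus[OF g] x] by (simp add: left_regular_def lp_def X_def pull_def)
        qed
        then show ?thesis using True by (simp add: push_def act_op_def)
      next
        case False
        then show ?thesis using \<xi> by (simp add: push_def left_regular_def lp_def X_def)
      qed
      finally show "left_regular_ext p G f \<xi> x = push (act_op (+) f' (pull \<xi>)) x" .
    qed
    define D where "D = (\<lambda>\<xi>\<in>lp. \<lambda>x. T \<xi> x - left_regular_ext p G f \<xi> x)"
    define c where "c = (\<Sum>\<alpha>\<in>keys f'. cmod (lookup f' \<alpha>))"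
    have c: "conv_bound p H c f'"
      unfolding c_def by (rule conv_bound_exists[OF p H_uminus H_add keys_f'])
    have D_le: "lp_le p X (t * b + c * b) (D \<xi>)" if "lp_le p X b \<xi>" for b \<xi>
    proof -
      have \<xi>: "\<xi> \<in> lp" using that by (simp add: lp_iff)
      have "lp_le p X (c * b) (left_regular_ext p G f \<xi>)"
        unfolding ext[OF \<xi>] by (intro lp_push conv_boundD[OF c] lp_pull that)
      then show ?thesis using lp_le_diff[OF p T_le[OF that]] \<xi> by (simp add: D_def)
    qed
    have D_scale: "D (\<lambda>x. z * \<xi> x) = (\<lambda>x. z * D \<xi> x)" if \<xi>: "\<xi> \<in> lp" for z \<xi>
    proof -
      have z: "(\<lambda>x. z * \<xi> x) \<in> lp" using lp_le_scale[OF p lp_norm_le[OF \<xi>], of z] by (simp add: lp_iff)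
      have "pull (\<lambda>x. z * \<xi> x) = (\<lambda>h. z * pull \<xi> h)" by (auto simp: pull_def)
      then have "left_regular_ext p G f (\<lambda>x. z * \<xi> x) x = z * left_regular_ext p G f \<xi> x" for x
        unfolding ext[OF \<xi>] ext[OF z] by (simp add: push_def act_op_def sum_distrib_left mult.left_commute)
      then show ?thesis using \<xi> z by (simp add: D_def T_scale right_diff_distrib)
    qed
    have bdd: "bdd_above ((\<lambda>\<xi>. lp_norm p X (D \<xi>)) ` {\<xi> \<in> lp. lp_norm p X \<xi> \<le> 1})"
    proof (rule bdd_aboveI2)
      fix \<xi> assume "\<xi> \<in> {\<xi> \<in> lp. lp_norm p X \<xi> \<le> 1}"
      then have "lp_le p X 1 \<xi>" by (simp add: lp_iff)
      from D_le[OF this] show "lp_norm p X (D \<xi>) \<le> t * 1 + c * 1" by (simp add: lp_iff)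
    qed
    have unit: "lp_le p X \<epsilon> (D \<xi>)" if "lp_le p X 1 \<xi>" for \<xi>
    proof -
      have \<xi>: "\<xi> \<in> {\<xi> \<in> lp. lp_norm p X \<xi> \<le> 1}" using that by (simp add: lp_iff)
      have "lp_norm p X (D \<xi>) \<le> lp_opnorm p X D"
        unfolding lp_opnorm_def lp_def[symmetric] by (rule cSUP_upper[OF \<xi> bdd])
      then have "lp_norm p X (D \<xi>) \<le> \<epsilon>" using f_near by (simp add: D_def)
      then show ?thesis using D_le[OF that] \<epsilon> by (simp add: lp_iff)
    qed
    have D_small: "lp_le p X (\<epsilon> * b) (D \<xi>)" if \<xi>: "lp_le p X b \<xi>" for b \<xi>
    proof (cases "b = 0")
      case True
      then have "\<xi> = (\<lambda>x. 0)" using lp_le_pointwise[OF p \<xi>] by auto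
      then have "D \<xi> = (\<lambda>x. 0)" using D_scale[of \<xi> 0] \<xi> by (simp add: lp_iff)
      then show ?thesis using True by (simp add: lp_le_def)
    next
      case False
      then have b: "b > 0" using lp_le_nonneg[OF \<xi>] by simp
      have "lp_le p X (cmod (1 / of_real b) * b) (\<lambda>x. (1 / of_real b) * \<xi> x)"
        by (rule lp_le_scale[OF p \<xi>])
      then have "lp_le p X 1 (\<lambda>x. (1 / of_real b) * \<xi> x)" using b by (simp add: norm_divide)
      from lp_le_scale[OF p unit[OF this], of "of_real b"] show ?thesis
        using b D_scale[of \<xi> "1 / of_real b"] \<xi> by (simp add: lp_iff mult.commute)
    qed
    have "lp_le p H (\<epsilon> * b) (\<lambda>h. T' \<zeta> h - act_op (+) f' \<zeta> h)" if \<zeta>: "lp_le p H b \<zeta>" for b \<zeta>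
    proof -
      have "T' \<zeta> h - act_op (+) f' \<zeta> h = pull (D (push \<zeta>)) h" for h
      proof (cases "h \<in> H")
        case True
        then have "word h \<in> X" by (simp add: H_def)
        then show ?thesis
          using True push_lp[OF \<zeta>]
          by (simp add: T'_def D_def ext pull_push[OF \<zeta>]) (simp add: pull_def push_def word_Abs)
      next
        case False
        then show ?thesis
          using lp_le_outside[OF conv_boundD[OF c \<zeta>]] by (simp add: T'_def pull_def)
      qed
      then show ?thesis using lp_pull[OF D_small[OF lp_push[OF \<zeta>]]] by simp
    qed
    then show "\<exists>f. keys f \<subseteq> H \<and> (\<forall>\<zeta> b. lp_le p H b \<zeta> \<longrightarrow> lp_le p H (\<epsilon> * b) (\<lambda>x. T' \<zeta> x - act_op (+) f \<zeta> x))"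
      using keys_f' by blast
  qed
  then show False
  proof
    assume z: "\<forall>\<zeta> b. lp_le p H b \<zeta> \<longrightarrow> T' \<zeta> = (\<lambda>x. 0)"
    have "T \<xi> = (\<lambda>x. 0)" if \<xi>: "\<xi> \<in> lp" for \<xi>
    proof -
      have l: "lp_le p H (lp_norm p X \<xi>) (pull \<xi>)" by (rule lp_pull[OF lp_norm_le[OF \<xi>]])
      then have "T' (pull \<xi>) = (\<lambda>x. 0)" using z by blast
      then have "push (T' (pull \<xi>)) = (\<lambda>x. 0)" by (simp add: push_def)
      then show ?thesis using push_T'[OF l] by (simp add: push_pull[OF \<xi>])
    qed
    then have "T = (\<lambda>\<xi>\<in>lp. \<lambda>x. 0)"
      by (intro extensionalityI[OF T_ext]) simp_all
    then show False using T_ne_0 by blast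
  next
    assume z: "\<forall>\<zeta> b. lp_le p H b \<zeta> \<longrightarrow> T' \<zeta> = \<zeta>"
    have "T \<xi> = \<xi>" if \<xi>: "\<xi> \<in> lp" for \<xi>
    proof -
      have l: "lp_le p H (lp_norm p X \<xi>) (pull \<xi>)" by (rule lp_pull[OF lp_norm_le[OF \<xi>]])
      then have "T' (pull \<xi>) = pull \<xi>" using z by blast
      then show ?thesis using push_T'[OF l] by (simp add: push_pull[OF \<xi>])
    qed
    then have "T = (\<lambda>\<xi>\<in>lp. \<xi>)"
      by (intro extensionalityI[OF T_ext]) simp_all
    then show False using T_ne_1 by blast
  qed
qed

end
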